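(* Let $n, m\ge 5$ be integers. If $n\neq m$, then $br(C_{2n}, C_{2m})=n+m-1$. If $n=m$, then $br(C_{2n}, C_{2m})=m+n$.
   Context: $C_k$ denotes the cycle with $k$ vertices, and $K_{N,N}$ the complete bipartite graph with both parts of size $N$. For bipartite graphs $H_1, H_2$, the bipartite Ramsey number $br(H_1,H_2)$ is the minimum integer $N$ such that every coloring of the edges of $K_{N,N}$ with two colors $1,2$ contains, for some $i\in\{1,2\}$, a copy of $H_i$ (as a not necessarily induced subgraph) all of whose edges have color $i$. *)

theory Defs
  imports Complex_Main
begin

text \<open>Simple undirected graphs, with edges as two-element sets of vertices.\<close>

record 'a ugraph =
  verts :: "'a set"
  edges :: "'a set set"

definition cycle_graph :: "nat \<Rightarrow> nat ugraph" where
  \<comment> \<open>The cycle on \<open>k\<close> vertices, meant for \<open>k \<ge> 3\<close>.\<close>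
  "cycle_graph k = \<lparr>verts = {..<k}, edges = {{i, (i + 1) mod k} | i. i < k}\<rparr>"

definition complete_bipartite :: "nat \<Rightarrow> (nat + nat) ugraph" where
  "complete_bipartite N =
     \<lparr>verts = Inl ` {..<N} \<union> Inr ` {..<N},
      edges = {{Inl i, Inr j} | i j. i < N \<and> j < N}\<rparr>"

definition contains_copy :: "'a ugraph \<Rightarrow> 'b ugraph \<Rightarrow> bool" where
  \<comment> \<open>Some subgraph of \<open>G\<close>, not necessarily induced, is isomorphic to \<open>H\<close>.\<close>
  "contains_copy G H \<longleftrightarrow>
     (\<exists>f. inj_on f (verts H) \<and> f ` verts H \<subseteq> verts G \<and> (\<forall>e\<in>edges H. f ` e \<in> edges G))"

definition two_coloring :: "'a ugraph \<Rightarrow> ('a set \<Rightarrow> nat) \<Rightarrow> bool" where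
  "two_coloring G c \<longleftrightarrow> (\<forall>e\<in>edges G. c e \<in> {1, 2})"

definition color_class :: "'a ugraph \<Rightarrow> ('a set \<Rightarrow> nat) \<Rightarrow> nat \<Rightarrow> 'a ugraph" where
  "color_class G c i = \<lparr>verts = verts G, edges = {e \<in> edges G. c e = i}\<rparr>"

definition br_arrows :: "nat \<Rightarrow> 'a ugraph \<Rightarrow> 'b ugraph \<Rightarrow> bool" where
  "br_arrows N H1 H2 \<longleftrightarrow>
     (\<forall>c. two_coloring (complete_bipartite N) c \<longrightarrow>
        contains_copy (color_class (complete_bipartite N) c 1) H1 \<or>
        contains_copy (color_class (complete_bipartite N) c 2) H2)"

definition br :: "'a ugraph \<Rightarrow> 'b ugraph \<Rightarrow> nat" where
  \<comment> \<open>Meant for finite bipartite graphs; if no \<open>N\<close> has the property, the value is unspecified.\<close>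
  "br H1 H2 = (LEAST N. br_arrows N H1 H2)"

end

theory Submission
  imports Defs
begin

text \<open>Write the two colours as red and blue. For the lower bounds, the colouring in which \<open>n - 1\<close> vertices of one
side send only red edges and the remaining at most \<open>m - 1\<close> vertices of that side send only blue edges has no red
\<open>C\<^bsub>2n\<^esub>\<close> and no blue \<open>C\<^bsub>2m\<^esub>\<close>. For \<open>n = m\<close> there is one more vertex to spare on each side: take
two red and two blue copies of \<open>K\<^bsub>n-1,n-1\<^esub>\<close> arranged in a square, add one vertex that is joined in red to
everything on the other side, and one on the other side that is joined in blue to the square.

For the upper bounds let \<open>n \<ge> m\<close>, and suppose that there is no blue \<open>C\<^bsub>2m\<^esub>\<close>. It is enough to find a red cycle of
length at least \<open>2n\<close>, because lengths are easy to correct (\<open>descent\<close>): if there is a red cycle of length \<open>2L\<close> but none of length \<open>2L - 2\<close>, then every chord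
that would cut off exactly two vertices is blue, so are many of the chords that cut off four, and these chords
together carry blue cycles of all lengths \<open>2m\<close> with \<open>5 \<le> m \<le> L - 1\<close>.

The long red cycle comes from lemma \<open>core\<close>. Let \<open>K\<close> be a longest red cycle, of length \<open>2c\<close>, and let \<open>M\<close>
vertices remain outside on each side. If all red components outside \<open>K\<close> had fewer than \<open>M\<close> vertices, nonadjacent
vertices would have large blue degree sum, and the bipartite Ore condition of Moon and Moser would give a blue
\<open>C\<^bsub>2M\<^esub>\<close> outside \<open>K\<close> (\<open>large_component\<close>). So some red component \<open>U\<close> has at least \<open>M\<close> vertices. Red neighbours of
\<open>U\<close> on \<open>K\<close> are never consecutive, so at least half of \<open>K\<close> is joined to \<open>U\<close> entirely in blue, and so is everything
outside \<open>K\<close> and \<open>U\<close>. This gives two large disjoint blue complete bipartite graphs. Two disjoint blue edges between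
them close a blue cycle of a length that is assumed to be missing; so, apart from some tight cases, all blue edges
between them share one vertex, and the red edges that this forces make it possible to lengthen \<open>K\<close>, either by
rerouting it through \<open>U\<close> or by inserting outside vertices. In the remaining configurations all vertices of \<open>K\<close> on one side that
have red neighbours in \<open>U\<close> have the same one, and without it the blue complete bipartite graph takes in that whole
side of \<open>K\<close>.

Lemma \<open>core\<close> is applied twice: with \<open>M = m\<close> when some red cycle has length at least \<open>2m\<close>, and with \<open>M = c + 2\<close>
to show that a coloured \<open>K\<^bsub>2m,2m\<^esub>\<close> has a monochromatic cycle of length at least \<open>2m\<close>; such a cycle, when it is
blue and there is no blue \<open>C\<^bsub>2m\<^esub>\<close>, is turned into a red \<open>C\<^bsub>2m\<^esub>\<close> by \<open>descent\<close> with the colours exchanged.\<close>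

section \<open>Paths and cycles as vertex lists\<close>

definition path :: "('v \<Rightarrow> 'v \<Rightarrow> bool) \<Rightarrow> 'v list \<Rightarrow> bool" where
  "path E xs \<longleftrightarrow> xs \<noteq> [] \<and> distinct xs \<and> successively E xs"

definition cyc :: "('v \<Rightarrow> 'v \<Rightarrow> bool) \<Rightarrow> 'v list \<Rightarrow> bool" where
  "cyc E xs \<longleftrightarrow> 3 \<le> length xs \<and> distinct xs \<and> successively E xs \<and> E (last xs) (hd xs)"

definition has_cyc :: "('v \<Rightarrow> 'v \<Rightarrow> bool) \<Rightarrow> nat \<Rightarrow> bool" where
  "has_cyc E k \<longleftrightarrow> (\<exists>xs. cyc E xs \<and> length xs = k)"

lemma path_single [simp]: "path E [x]"
  by (simp add: path_def)

lemma path_append: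
  assumes "path E xs" "path E ys" "set xs \<inter> set ys = {}" "E (last xs) (hd ys)"
  shows "path E (xs @ ys)"
  using assms by (auto simp: path_def successively_append_iff)

lemma path_Cons:
  assumes "path E xs" "x \<notin> set xs" "E x (hd xs)"
  shows "path E (x # xs)"
  using path_append[of E "[x]" xs] assms by auto

lemma path_rev:
  assumes "path E xs" "symp E"
  shows "path E (rev xs)"
proof -
  have "successively (\<lambda>x y. E y x) xs"
    using assms by (auto simp: path_def intro: successively_mono dest: sympD)
  then show ?thesis
    using assms by (auto simp: path_def)
qed

lemma cyc_join:
  assumes "path E xs" "path E ys" "set xs \<inter> set ys = {}"
    and "E (last xs) (hd ys)" "E (last ys) (hd xs)" "3 \<le> length xs + length ys"
  shows "cyc E (xs @ ys)"
  using assms by (auto simp: path_def cyc_def successively_append_iff)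

lemma cyc_swap:
  assumes "cyc E (xs @ ys)"
  shows "cyc E (ys @ xs)"
  using assms by (cases "xs = []"; cases "ys = []") (auto simp: cyc_def successively_append_iff)

lemma cyc_path: "cyc E xs \<Longrightarrow> path E xs"
  by (auto simp: cyc_def path_def)

lemma cyc_adjacent:
  assumes "cyc E (xs @ x # y # ys)"
  shows "E x y"
  using assms by (auto simp: cyc_def successively_append_iff)

lemma cyc_closeI:
  assumes "path E xs" "3 \<le> length xs" "E (last xs) (hd xs)"
  shows "cyc E xs"
  using assms by (auto simp: path_def cyc_def)

lemma has_cycI: "cyc E xs \<Longrightarrow> length xs = k \<Longrightarrow> has_cyc E k"
  by (auto simp: has_cyc_def)

lemma cyc_split:
  assumes "cyc E (xs @ ys)" "xs \<noteq> []" "ys \<noteq> []"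
  shows "path E xs" "path E ys" "E (last xs) (hd ys)" "E (last ys) (hd xs)"
  using assms by (auto simp: cyc_def path_def successively_append_iff)

lemma cyc_mono: "cyc E xs \<Longrightarrow> (\<And>x y. x \<in> set xs \<Longrightarrow> y \<in> set xs \<Longrightarrow> E x y \<Longrightarrow> E' x y) \<Longrightarrow> cyc E' xs"
  unfolding cyc_def by (cases "xs = []") (auto intro: successively_mono)

lemma path_mono: "path E xs \<Longrightarrow> (\<And>x y. x \<in> set xs \<Longrightarrow> y \<in> set xs \<Longrightarrow> E x y \<Longrightarrow> E' x y) \<Longrightarrow> path E' xs"
  unfolding path_def by (auto intro: successively_mono)

lemma path_prefix: "path E (xs @ ys) \<Longrightarrow> xs \<noteq> [] \<Longrightarrow> path E xs"
  by (auto simp: path_def successively_append_iff)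

text \<open>Besides the path itself the induction keeps that all its vertices are reachable, so that paths inside a red
component stay inside it.\<close>

lemma reachable_path:
  assumes "E\<^sup>*\<^sup>* x y"
  shows "\<exists>ws. path E ws \<and> hd ws = x \<and> last ws = y \<and> (\<forall>w\<in>set ws. E\<^sup>*\<^sup>* x w)"
  using assms
proof (induction rule: rtranclp_induct)
  case base
  then show ?case
    by (intro exI[of _ "[x]"]) auto
next
  case (step y z)
  then obtain ws where ws: "path E ws" "hd ws = x" "last ws = y" "\<forall>w\<in>set ws. E\<^sup>*\<^sup>* x w"
    by blast
  show ?case
  proof (cases "z \<in> set ws")
    case True
    then obtain us vs where uv: "ws = (us @ [z]) @ vs"
      using split_list by fastforce
    have "path E (us @ [z])"
      using ws(1) uv path_prefix by blast
    moreover have "hd (us @ [z]) = x"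
      using ws(2) uv by (cases us) auto
    ultimately show ?thesis
      using ws(4) uv by (intro exI[of _ "us @ [z]"]) auto
  next
    case False
    have "path E (ws @ [z])"
      by (rule path_append) (use ws False step in auto)
    moreover have "hd (ws @ [z]) = x"
      using ws by (auto simp: path_def)
    moreover have "E\<^sup>*\<^sup>* x z"
      using step by auto
    ultimately show ?thesis
      using ws by (intro exI[of _ "ws @ [z]"]) auto
  qed
qed

lemma successivelyI_split:
  assumes "\<And>us x y vs. xs = us @ x # y # vs \<Longrightarrow> S x y"
  shows "successively S xs"
  using assms
proof (induction xs rule: induct_list012)
  case (3 x y zs)
  have "successively S (y # zs)"
    by (rule 3(2)) (metis 3(3) append_Cons)
  then show ?case
    using 3(3)[of "[]" x y zs] by simp
qed auto

lemma filter_length_half: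
  assumes "successively (\<lambda>x y. \<not> (S x \<and> S y)) xs"
  shows "length (filter S xs) \<le> (length xs + 1) div 2"
  using assms by (induction xs rule: induct_list012) (auto simp: successively_Cons)

text \<open>Membership in two sets that both alternate along a list agrees up to complement.\<close>

lemma alternating_sets:
  assumes "successively (\<lambda>x y. (x \<in> S) \<noteq> (y \<in> S) \<and> (x \<in> S') \<noteq> (y \<in> S')) xs" "z \<in> set xs"
  shows "(z \<in> S) = (hd xs \<in> S) \<longleftrightarrow> (z \<in> S') = (hd xs \<in> S')"
  using assms
proof (induction xs arbitrary: z rule: induct_list012)
  case (3 x y zs)
  show ?case
  proof (cases "z = x")
    case False
    then have "(z \<in> S) = (y \<in> S) \<longleftrightarrow> (z \<in> S') = (y \<in> S')"
      using 3(2)[of z] 3(3,4) by simp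
    then show ?thesis
      using 3(3) by auto
  qed simp
qed auto

section \<open>Cardinalities\<close>

lemma card_ge_2E:
  assumes "2 \<le> card S"
  obtains x y where "x \<in> S" "y \<in> S" "x \<noteq> y"
proof -
  have f: "finite S"
    using assms by (metis card.infinite not_numeral_le_zero)
  then have "\<not> (\<forall>x\<in>S. \<forall>y\<in>S. x = y)"
    using card_le_Suc0_iff_eq[OF f] assms by simp
  then show thesis
    using that by blast
qed

lemma card_ge_2_avoid:
  assumes "2 \<le> card S"
  obtains x where "x \<in> S" "x \<noteq> w"
  using card_ge_2E[OF assms] by metis

lemma card_ge_1E:
  assumes "1 \<le> card S"
  obtains x where "x \<in> S"
  using assms by (metis card.empty equals0I not_one_le_zero)

lemma two_agree_of_three:
  fixes N :: "'a \<Rightarrow> bool"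
  assumes "3 \<le> card S"
  obtains x y where "x \<in> S" "y \<in> S" "x \<noteq> y" "N x = N y"
proof -
  obtain S' where "S' \<subseteq> S" "card S' = 3"
    using obtain_subset_with_card_n[OF assms] by blast
  then obtain x y z where "x \<in> S" "y \<in> S" "z \<in> S" "x \<noteq> y" "x \<noteq> z" "y \<noteq> z"
    by (auto simp: card_3_iff)
  then show thesis
    using that by metis
qed

lemma card_Diff_single_ge: "finite S \<Longrightarrow> card S - 1 \<le> card (S - {x})"
  by (cases "x \<in> S") auto

lemma superset_of_card:
  assumes "S \<subseteq> A" "finite A" "card S \<le> k" "k \<le> card A"
  obtains S' where "S \<subseteq> S'" "S' \<subseteq> A" "card S' = k"
proof -
  have "k - card S \<le> card (A - S)"
    using assms by (simp add: card_Diff_subset finite_subset)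
  then obtain D where D: "D \<subseteq> A - S" "card D = k - card S" "finite D"
    using obtain_subset_with_card_n by metis
  have "card (S \<union> D) = card S + card D"
    by (rule card_Un_disjoint) (use D assms finite_subset in auto)
  then show thesis
    using that[of "S \<union> D"] D assms by auto
qed

text \<open>Distributes the length of a blue cycle among the two blocks that it passes through.\<close>

lemma sum_split:
  fixes m1 m2 s :: nat
  assumes "1 \<le> m1" "1 \<le> m2" "2 \<le> s" "s \<le> m1 + m2"
  shows "\<exists>i j. i + j = s \<and> 1 \<le> i \<and> i \<le> m1 \<and> 1 \<le> j \<and> j \<le> m2"
  using assms by (intro exI[of _ "min m1 (s - 1)"] exI[of _ "s - min m1 (s - 1)"]) auto

text \<open>A set of pairs without two disjoint members is a star; the centre may belong to either coordinate, and
with no pairs at all any vertex serves. Used for the blue edges between two blue blocks.\<close>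

lemma star_of_no_two_disjoint:
  assumes "\<And>x y x' y'. E x y \<Longrightarrow> E x' y' \<Longrightarrow> x = x' \<or> y = y'"
  shows "\<exists>v. \<forall>x y. E x y \<longrightarrow> x = v \<or> y = v"
proof (cases "\<exists>x y. E x y")
  case True
  then obtain x y where xy: "E x y"
    by blast
  show ?thesis
  proof (cases "\<forall>x' y'. E x' y' \<longrightarrow> x' = x")
    case True
    then show ?thesis
      by blast
  next
    case False
    then obtain x' y' where "E x' y'" "x' \<noteq> x"
      by blast
    then show ?thesis
      using assms xy by (metis (no_types))
  qed
qed blast

section \<open>Complete bipartite graphs and the degree condition of Moon and Moser\<close>

definition complete :: "('v \<Rightarrow> 'v \<Rightarrow> bool) \<Rightarrow> 'v set \<Rightarrow> 'v set \<Rightarrow> bool" where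
  "complete E X Y \<longleftrightarrow> (\<forall>x\<in>X. \<forall>y\<in>Y. E x y \<and> E y x)"

lemma complete_sym: "complete E X Y \<Longrightarrow> complete E Y X"
  by (auto simp: complete_def)

lemma complete_mono: "complete E X Y \<Longrightarrow> X' \<subseteq> X \<Longrightarrow> Y' \<subseteq> Y \<Longrightarrow> complete E X' Y'"
  by (auto simp: complete_def)

text \<open>In a complete bipartite graph every parity-admissible length is realised between prescribed ends. These two
lemmas are the only source of long paths in what follows.\<close>

lemma complete_path_opposite:
  assumes "complete E X Y" "finite X" "finite Y" "X \<inter> Y = {}"
    and "x \<in> X" "y \<in> Y" "1 \<le> i" "i \<le> card X" "i \<le> card Y"
  shows "\<exists>ws. path E ws \<and> hd ws = x \<and> last ws = y \<and> set ws \<subseteq> X \<union> Y \<and> length ws = 2 * i"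
  using assms(7,1-6,8-)
proof (induction i arbitrary: X Y x y rule: dec_induct)
  case base
  then show ?case
    by (intro exI[of _ "[x, y]"]) (auto simp: path_def complete_def)
next
  case (step i)
  have "card (Y - {y}) \<ge> 1" "card (X - {x}) \<ge> 1"
    using step by auto
  then obtain x' y' where x': "x' \<in> X" "x' \<noteq> x" and y': "y' \<in> Y" "y' \<noteq> y"
    by (metis DiffE One_nat_def card.empty equals0I insertCI not_one_le_zero)
  have "\<exists>ws. path E ws \<and> hd ws = x' \<and> last ws = y \<and> set ws \<subseteq> (X - {x}) \<union> (Y - {y'}) \<and> length ws = 2 * i"
    by (rule step.IH) (use step x' y' in \<open>auto simp: complete_def\<close>)
  then obtain ws where ws: "path E ws" "hd ws = x'" "last ws = y"
      "set ws \<subseteq> (X - {x}) \<union> (Y - {y'})" "length ws = 2 * i"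
    by blast
  have "path E (y' # ws)"
    by (rule path_Cons) (use ws step x' y' in \<open>auto simp: complete_def\<close>)
  then have "path E (x # y' # ws)"
    by (rule path_Cons) (use ws step x' y' in \<open>auto simp: complete_def\<close>)
  moreover have "last (x # y' # ws) = y"
    using ws by (auto simp: path_def)
  moreover have "set (x # y' # ws) \<subseteq> X \<union> Y"
    using ws step x' y' by auto
  ultimately show ?case
    using ws by (intro exI[of _ "x # y' # ws"]) auto
qed

lemma complete_path_same:
  assumes "complete E X Y" "finite X" "finite Y" "X \<inter> Y = {}"
    and "x \<in> X" "x' \<in> X" "x \<noteq> x'" "1 \<le> i" "i < card X" "i \<le> card Y"
  shows "\<exists>ws. path E ws \<and> hd ws = x \<and> last ws = x' \<and> set ws \<subseteq> X \<union> Y \<and> length ws = 2 * i + 1"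
proof -
  obtain y where y: "y \<in> Y"
    using assms by fastforce
  have "\<exists>ws. path E ws \<and> hd ws = y \<and> last ws = x' \<and> set ws \<subseteq> Y \<union> (X - {x}) \<and> length ws = 2 * i"
    by (rule complete_path_opposite) (use assms y in \<open>auto simp: complete_def\<close>)
  then obtain ws where ws: "path E ws" "hd ws = y" "last ws = x'" "set ws \<subseteq> Y \<union> (X - {x})" "length ws = 2 * i"
    by blast
  have "path E (x # ws)"
    by (rule path_Cons) (use ws assms y in \<open>auto simp: complete_def\<close>)
  moreover have "last (x # ws) = x'"
    using ws by (auto simp: path_def)
  ultimately show ?thesis
    using ws assms by (intro exI[of _ "x # ws"]) auto
qed

lemma complete_has_cyc:
  assumes "complete E X Y" "finite X" "finite Y" "X \<inter> Y = {}" "2 \<le> i" "i \<le> card X" "i \<le> card Y"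
  shows "has_cyc E (2 * i)"
proof -
  obtain x where x: "x \<in> X"
    using assms by fastforce
  obtain y where y: "y \<in> Y"
    using assms by fastforce
  obtain ws where ws: "path E ws" "hd ws = x" "last ws = y" "length ws = 2 * i"
    using complete_path_opposite[of E X Y x y i] assms x y by auto
  then have "cyc E ws"
    using assms x y by (intro cyc_closeI) (auto simp: complete_def)
  then show ?thesis
    using ws by (auto intro: has_cycI)
qed

text \<open>The bipartite form of Ore's theorem. Adding a missing edge \<open>ab\<close> preserves the hypothesis, so by induction on
the number of missing edges the enlarged graph has a Hamiltonian cycle. If that cycle uses \<open>ab\<close>, removing it
leaves a Hamiltonian path from \<open>a\<close> to \<open>b\<close>, and the degree condition forces two crossing neighbours along it.\<close>

lemma moon_moser:
  assumes "finite X" "finite Y" "card X = k" "card Y = k" "X \<inter> Y = {}" "2 \<le> k"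
    and sym: "symp E"
    and bip: "\<And>u v. E u v \<Longrightarrow> u \<in> X \<and> v \<in> Y \<or> u \<in> Y \<and> v \<in> X"
    and deg: "\<And>x y. x \<in> X \<Longrightarrow> y \<in> Y \<Longrightarrow> \<not> E x y \<Longrightarrow>
        k < card {v \<in> Y. E x v} + card {v \<in> X. E y v}"
  shows "\<exists>xs. cyc E xs \<and> length xs = 2 * k \<and> set xs \<subseteq> X \<union> Y"
  using sym bip deg
proof (induction "card {(x, y). x \<in> X \<and> y \<in> Y \<and> \<not> E x y}" arbitrary: E rule: less_induct)
  case less
  let ?N = "\<lambda>E. {(x, y). x \<in> X \<and> y \<in> Y \<and> \<not> E x y}"
  show ?case
  proof (cases "?N E = {}")
    case True
    then have comp: "complete E X Y"
      using less.prems(1) by (auto simp: complete_def dest: sympD)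
    obtain x y where xy: "x \<in> X" "y \<in> Y"
      using assms(1-6) by (metis card.empty equals0I not_numeral_le_zero)
    obtain ws where ws: "path E ws" "hd ws = x" "last ws = y" "length ws = 2 * k" "set ws \<subseteq> X \<union> Y"
      using complete_path_opposite[OF comp assms(1,2,5) xy, of k] assms(1-6) by auto
    then have "cyc E ws"
      using assms(1-6) xy comp by (intro cyc_closeI) (auto simp: complete_def)
    then show ?thesis
      using ws by blast
  next
    case False
    then obtain a b where ab: "a \<in> X" "b \<in> Y" "\<not> E a b"
      by auto
    define E' where "E' = (\<lambda>u v. E u v \<or> (u = a \<and> v = b) \<or> (u = b \<and> v = a))"
    have sym': "symp E'"
      using less.prems(1) by (auto simp: E'_def symp_def)
    have fin: "finite (?N E)"
      by (rule finite_subset[of _ "X \<times> Y"]) (use assms(1-6) in auto)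
    have "?N E' \<subset> ?N E"
      using ab by (auto simp: E'_def)
    then have lt: "card (?N E') < card (?N E)"
      using fin by (rule psubset_card_mono[rotated])
    have deg': "k < card {v \<in> Y. E' x v} + card {v \<in> X. E' y v}"
      if "x \<in> X" "y \<in> Y" "\<not> E' x y" for x y
    proof -
      have "card {v \<in> Y. E x v} \<le> card {v \<in> Y. E' x v}" "card {v \<in> X. E y v} \<le> card {v \<in> X. E' y v}"
        by (rule card_mono; use assms(1-6) in \<open>auto simp: E'_def\<close>)+
      moreover have "k < card {v \<in> Y. E x v} + card {v \<in> X. E y v}"
        using less.prems(3)[of x y] that by (auto simp: E'_def)
      ultimately show ?thesis
        by linarith
    qed
    have bip': "u \<in> X \<and> v \<in> Y \<or> u \<in> Y \<and> v \<in> X" if "E' u v" for u v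
      using that less.prems(2)[of u v] ab unfolding E'_def by blast
    obtain xs where xs: "cyc E' xs" "length xs = 2 * k" "set xs \<subseteq> X \<union> Y"
      using less.hyps[OF lt sym' bip' deg'] by blast
    have dist: "distinct xs" and suc: "successively E' xs" and cl: "E' (last xs) (hd xs)"
      using xs by (auto simp: cyc_def)
    have setxs: "set xs = X \<union> Y"
    proof (rule card_subset_eq)
      show "card (set xs) = card (X \<union> Y)"
        using dist xs assms(1-6) by (simp add: distinct_card card_Un_disjoint)
    qed (use assms(1-6) xs in auto)
    (* Either the new edge is unused, or the cycle opens to a Hamiltonian path from a to b. *)
    have "cyc E xs \<or> (\<exists>ps. path E ps \<and> hd ps = a \<and> last ps = b \<and> set ps = X \<union> Y)"
    proof (cases "\<exists>us u v vs. xs = us @ u # v # vs \<and> {u, v} = {a, b}")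
      case True
      then obtain us u v vs where uv: "xs = us @ u # v # vs" "{u, v} = {a, b}"
        by blast
      define ps where "ps = (v # vs) @ us @ [u]"
      have c: "cyc E' (v # vs @ us @ [u])"
        using cyc_swap[of E' "us @ [u]" "v # vs"] xs(1) uv by auto
      have d: "distinct ps"
        using c by (auto simp: cyc_def ps_def)
      have "successively E' ps"
        using c by (auto simp: cyc_def ps_def)
      moreover have "successively E ps"
        unfolding successively_conv_nth
      proof (intro allI impI)
        fix i
        assume i: "Suc i < length ps"
        have "E' (ps ! i) (ps ! Suc i)"
          using calculation i by (auto simp: successively_conv_nth)
        moreover have "\<not> (ps ! i = u \<and> ps ! Suc i = v)"
        proof
          assume "ps ! i = u \<and> ps ! Suc i = v"
          moreover have "ps ! 0 = v"
            by (simp add: ps_def)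
          ultimately show False
            using d i by (metis Zero_not_Suc gr_implies_not0 neq0_conv nth_eq_iff_index_eq)
        qed
        moreover have "\<not> (ps ! i = v \<and> ps ! Suc i = u)"
        proof
          assume as: "ps ! i = v \<and> ps ! Suc i = u"
          have "ps ! 0 = v" "ps ! (length ps - 1) = u"
            by (auto simp: ps_def nth_append)
          then have "i = 0" "Suc i = length ps - 1"
            using as d i by (metis Suc_lessD gr_implies_not0 neq0_conv nth_eq_iff_index_eq,
              metis as One_nat_def diff_less i length_greater_0_conv nth_eq_iff_index_eq d
                length_0_conv less_nat_zero_code zero_less_one)
          moreover have "length ps = 2 * k"
            using xs uv by (auto simp: ps_def)
          ultimately show False
            using assms(1-6) by auto
        qed
        ultimately show "E (ps ! i) (ps ! Suc i)"
          using uv(2) by (auto simp: E'_def doubleton_eq_iff)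
      qed
      ultimately have p: "path E ps"
        using d by (auto simp: path_def ps_def)
      have s: "set ps = X \<union> Y"
        using setxs uv by (auto simp: ps_def)
      show ?thesis
      proof (cases "v = a")
        case True
        then have "hd ps = a" "last ps = b"
          using uv(2) ab assms(5) by (auto simp: ps_def doubleton_eq_iff)
        then show ?thesis
          using p s by blast
      next
        case False
        then have "v = b" "u = a"
          using uv(2) by (auto simp: doubleton_eq_iff)
        then have "hd (rev ps) = a" "last (rev ps) = b"
          by (auto simp: ps_def)
        moreover have "path E (rev ps)"
          using path_rev p less.prems(1) by blast
        ultimately show ?thesis
          using s by (metis set_rev)
      qed
    next
      case noin: False
      have "E (xs ! i) (xs ! Suc i)" if "Suc i < length xs" for i
      proof -
        have "E' (xs ! i) (xs ! Suc i)"
          using suc that by (auto simp: successively_conv_nth)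
        moreover have "xs = take i xs @ xs ! i # xs ! Suc i # drop (Suc (Suc i)) xs"
          using that by (metis Cons_nth_drop_Suc Suc_lessD append_take_drop_id)
        then have "{xs ! i, xs ! Suc i} \<noteq> {a, b}"
          using noin by metis
        ultimately show ?thesis
          by (auto simp: E'_def)
      qed
      then have suc': "successively E xs"
        by (auto simp: successively_conv_nth)
      show ?thesis
      proof (cases "E (last xs) (hd xs)")
        case True
        then show ?thesis
          using suc' xs by (auto simp: cyc_def)
      next
        case False
        have p: "path E xs"
          using suc' dist xs assms(1-6) by (auto simp: path_def)
        have "(last xs = a \<and> hd xs = b) \<or> (last xs = b \<and> hd xs = a)"
          using False cl by (auto simp: E'_def)
        then show ?thesis
        proof
          assume "last xs = b \<and> hd xs = a"
          then show ?thesis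
            using p setxs by blast
        next
          assume "last xs = a \<and> hd xs = b"
          then have "hd (rev xs) = a \<and> last (rev xs) = b"
            by (simp add: hd_rev last_rev)
          then show ?thesis
            using path_rev[OF p less.prems(1)] setxs by (metis set_rev)
        qed
      qed
    qed
    then show ?thesis
    proof
      assume "cyc E xs"
      then show ?thesis
        using xs by blast
    next
      assume "\<exists>ps. path E ps \<and> hd ps = a \<and> last ps = b \<and> set ps = X \<union> Y"
      then obtain ps where ps: "path E ps" "hd ps = a" "last ps = b" "set ps = X \<union> Y"
        by blast
      have d: "distinct ps" and s: "successively E ps"
        using ps by (auto simp: path_def)
      have len: "length ps = 2 * k"
        using distinct_card[OF d] ps assms(1-6) by (simp add: card_Un_disjoint)
      (* Crossing: some position j with a adjacent to the entry at Suc j and the entry at j adjacent to b. *)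
      define J where "J = {j. Suc j < length ps \<and> ps ! Suc j \<in> Y}"
      define J1 where "J1 = {j \<in> J. E a (ps ! Suc j)}"
      define J2 where "J2 = {j \<in> J. E (ps ! j) b}"
      have finJ: "finite J"
        by (rule finite_subset[of _ "{..<length ps}"]) (auto simp: J_def)
      have "card J \<le> card Y"
        by (rule card_inj_on_le[of "\<lambda>j. ps ! Suc j"])
          (use d assms(1-6) in \<open>auto simp: J_def inj_on_def nth_eq_iff_index_eq\<close>)
      moreover have "card {v \<in> Y. E a v} \<le> card J1"
      proof (rule card_le_if_inj_on_rel[where r = "\<lambda>v j. ps ! Suc j = v"])
        fix v
        assume v: "v \<in> {v \<in> Y. E a v}"
        then have "v \<in> set ps"
          using ps(4) by simp
        then obtain i where i: "i < length ps" "ps ! i = v"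
          by (auto simp: in_set_conv_nth)
        have "i \<noteq> 0"
        proof
          assume "i = 0"
          then have "v = a"
            using i ps(2) by (cases ps) auto
          then show False
            using v ab(1) assms(5) by auto
        qed
        then obtain j where "i = Suc j"
          using not0_implies_Suc by blast
        then show "\<exists>j. j \<in> J1 \<and> ps ! Suc j = v"
          using i v unfolding J1_def J_def by blast
      qed (use finJ in \<open>auto simp: J1_def\<close>)
      moreover have "card {v \<in> X. E b v} \<le> card J2"
      proof (rule card_le_if_inj_on_rel[where r = "\<lambda>v j. ps ! j = v"])
        fix v
        assume v: "v \<in> {v \<in> X. E b v}"
        then have "v \<in> set ps"
          using ps(4) by simp
        then obtain j where j: "j < length ps" "ps ! j = v"
          by (auto simp: in_set_conv_nth)
        have "Suc j \<noteq> length ps"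
        proof
          assume "Suc j = length ps"
          then have "v = last ps"
            using j by (cases ps rule: rev_cases) auto
          then show False
            using ps(3) v ab(2) assms(5) by auto
        qed
        then have l: "Suc j < length ps"
          using j by auto
        have "E v (ps ! Suc j)"
          using s l j(2) unfolding successively_conv_nth by blast
        then have "ps ! Suc j \<in> Y"
          using less.prems(2)[of v "ps ! Suc j"] v assms(5) by blast
        then show "\<exists>j. j \<in> J2 \<and> ps ! j = v"
          using l j v sympD[OF less.prems(1), of b v] unfolding J2_def J_def by blast
      qed (use finJ in \<open>auto simp: J2_def\<close>)
      moreover have "k < card {v \<in> Y. E a v} + card {v \<in> X. E b v}"
        using less.prems(3) ab by blast
      ultimately have "card J < card J1 + card J2"
        using assms(1-6) by linarith
      have "J1 \<inter> J2 \<noteq> {}"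
      proof
        assume "J1 \<inter> J2 = {}"
        moreover have "finite J1" "finite J2" "J1 \<union> J2 \<subseteq> J"
          using finJ by (auto simp: J1_def J2_def)
        ultimately have "card J1 + card J2 \<le> card J"
          using card_mono[of J "J1 \<union> J2"] finJ by (simp add: card_Un_disjoint)
        then show False
          using \<open>card J < card J1 + card J2\<close> by linarith
      qed
      then have "\<exists>j. Suc j < length ps \<and> E a (ps ! Suc j) \<and> E (ps ! j) b"
        by (auto simp: J1_def J2_def J_def)
      then obtain j where j: "Suc j < length ps" "E a (ps ! Suc j)" "E (ps ! j) b"
        by blast
      define us where "us = take (Suc j) ps"
      define vs where "vs = drop (Suc j) ps"
      have uv: "ps = us @ vs" "us \<noteq> []" "vs \<noteq> []"
        using j by (auto simp: us_def vs_def)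
      have h: "last us = ps ! j" "hd vs = ps ! Suc j" "last vs = b" "hd us = a"
      proof -
        show "last us = ps ! j" "hd vs = ps ! Suc j"
          using j(1) by (simp_all add: us_def vs_def take_Suc_conv_app_nth hd_drop_conv_nth)
        show "last vs = b" "hd us = a"
          using j(1) ps(2,3) by (simp_all add: us_def vs_def hd_conv_nth)
      qed
      have "path E us" "path E vs"
        using ps(1) uv by (auto simp: path_def successively_append_iff)
      then have "cyc E (vs @ rev us)"
        using path_rev[OF _ less.prems(1), of us] h j uv d len assms(1-6) less.prems(1)
        by (intro cyc_join) (auto simp: hd_rev last_rev dest: sympD)
      moreover have "length (vs @ rev us) = 2 * k"
        using len uv by auto
      moreover have "set (vs @ rev us) \<subseteq> X \<union> Y"
        using ps uv by auto
      ultimately show ?thesis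
        by blast
    qed
  qed
qed

section \<open>Two-coloured complete bipartite graphs\<close>

definition opposite :: "'v set \<Rightarrow> 'v set \<Rightarrow> 'v \<Rightarrow> 'v \<Rightarrow> bool" where
  "opposite A B u v \<longleftrightarrow> u \<in> A \<and> v \<in> B \<or> u \<in> B \<and> v \<in> A"

text \<open>Only one colour class \<open>R\<close> is kept; the second colour is its complement in the complete bipartite graph, so
exchanging the colours means replacing \<open>R\<close> by \<open>other A B R\<close>.\<close>

definition other :: "'v set \<Rightarrow> 'v set \<Rightarrow> ('v \<Rightarrow> 'v \<Rightarrow> bool) \<Rightarrow> 'v \<Rightarrow> 'v \<Rightarrow> bool" where
  "other A B R u v \<longleftrightarrow> opposite A B u v \<and> \<not> R u v"

locale bicol =
  fixes A B :: "'v set" and R :: "'v \<Rightarrow> 'v \<Rightarrow> bool"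
  assumes finA: "finite A" and finB: "finite B" and disj: "A \<inter> B = {}"
    and R_sym: "R u v \<Longrightarrow> R v u"
    and R_bip: "R u v \<Longrightarrow> opposite A B u v"

begin

abbreviation "Bl \<equiv> other A B R"

lemma symp_R: "symp R"
  unfolding symp_def using R_sym by blast

lemma Bl_sym: "Bl u v \<Longrightarrow> Bl v u"
  using R_sym[of v u] by (auto simp: other_def opposite_def)

lemma BlI: "opposite A B u v \<Longrightarrow> \<not> R u v \<Longrightarrow> Bl u v"
  by (simp add: other_def)

lemma side_cases: "R u v \<Longrightarrow> u \<in> A \<Longrightarrow> v \<in> B" "R u v \<Longrightarrow> u \<in> B \<Longrightarrow> v \<in> A"
  using R_bip disj by (auto simp: opposite_def)

text \<open>Sides alternate along a red path. Both parts are proved together since removing the first vertex exchanges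
them.\<close>

lemma path_counts:
  assumes "path R xs"
  shows "hd xs \<in> A \<Longrightarrow> set xs \<subseteq> A \<union> B \<and> card (set xs \<inter> A) = (length xs + 1) div 2 \<and> card (set xs \<inter> B) = length xs div 2"
    and "hd xs \<in> B \<Longrightarrow> set xs \<subseteq> A \<union> B \<and> card (set xs \<inter> B) = (length xs + 1) div 2 \<and> card (set xs \<inter> A) = length xs div 2"
  using assms
proof (induction xs)
  case (Cons x xs)
  { case 1
    show ?case
    proof (cases "xs = []")
      case True
      then show ?thesis
        using 1 disj by auto
    next
      case False
      have p: "path R xs" "R x (hd xs)" "x \<notin> set xs"
        using 1(2) False by (auto simp: path_def successively_Cons)
      have "hd xs \<in> B"
        using p(2) 1(1) side_cases by auto
      moreover have "set (x # xs) \<inter> A = insert x (set xs \<inter> A)" "set (x # xs) \<inter> B = set xs \<inter> B"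
        using 1(1) disj by auto
      ultimately show ?thesis
        using Cons.IH(2) p 1(1) by auto
    qed
  next
    case 2
    show ?case
    proof (cases "xs = []")
      case True
      then show ?thesis
        using 2 disj by auto
    next
      case False
      have p: "path R xs" "R x (hd xs)" "x \<notin> set xs"
        using 2(2) False by (auto simp: path_def successively_Cons)
      have "hd xs \<in> A"
        using p(2) 2(1) side_cases by auto
      moreover have "set (x # xs) \<inter> B = insert x (set xs \<inter> B)" "set (x # xs) \<inter> A = set xs \<inter> A"
        using 2(1) disj by auto
      ultimately show ?thesis
        using Cons.IH(1) p 2(1) by auto
    qed }
qed (auto simp: path_def)

lemma cyc_counts:
  assumes "cyc R xs" "length xs = 2 * k"
  shows "set xs \<subseteq> A \<union> B" "card (set xs \<inter> A) = k" "card (set xs \<inter> B) = k"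
proof -
  have "hd xs \<in> A \<union> B"
    using assms R_bip by (auto simp: cyc_def opposite_def)
  then show "set xs \<subseteq> A \<union> B" "card (set xs \<inter> A) = k" "card (set xs \<inter> B) = k"
    using path_counts[OF cyc_path[OF assms(1)]] assms(2) by auto
qed

lemma cyc_sub: "cyc R xs \<Longrightarrow> set xs \<subseteq> A \<union> B"
proof -
  assume c: "cyc R xs"
  then have "hd xs \<in> A \<union> B"
    using R_bip by (auto simp: cyc_def opposite_def)
  then show ?thesis
    using path_counts[OF cyc_path[OF c]] by blast
qed

text \<open>Rotating the cycle by one vertex moves its start to the other side, and the two ways of counting the vertices
of one side agree only for even length.\<close>

lemma cyc_even: "cyc R xs \<Longrightarrow> even (length xs)"
proof -
  assume c: "cyc R xs"
  then obtain x y ys where xs: "xs = x # y # ys"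
    by (cases xs; cases "tl xs") (auto simp: cyc_def)
  have c': "cyc R (y # ys @ [x])"
    using cyc_swap[of R "[x]" "y # ys"] c xs by simp
  have xy: "R x y"
    using c xs by (auto simp: cyc_def)
  note p = path_counts[OF cyc_path[OF c]] and p' = path_counts[OF cyc_path[OF c']]
  have s: "set (y # ys @ [x]) = set xs" "length (y # ys @ [x]) = length xs"
    using xs by auto
  have e: "(k + 1) div 2 = k div 2 \<Longrightarrow> even k" for k :: nat
    by presburger
  show ?thesis
  proof (cases "x \<in> A")
    case True
    then have "y \<in> B"
      using xy side_cases by blast
    then have "card (set xs \<inter> A) = length xs div 2"
      using p'(2) unfolding s by simp
    moreover have "card (set xs \<inter> A) = (length xs + 1) div 2"
      using p(1) True xs by simp
    ultimately show ?thesis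
      using e by metis
  next
    case False
    then have "x \<in> B" "y \<in> A"
      using xy R_bip[OF xy] unfolding opposite_def by blast+
    then have "card (set xs \<inter> B) = length xs div 2"
      using p'(1) unfolding s by simp
    moreover have "card (set xs \<inter> B) = (length xs + 1) div 2"
      using p(2) \<open>x \<in> B\<close> xs by simp
    ultimately show ?thesis
      using e by metis
  qed
qed

lemma length_bound: "set xs \<subseteq> A \<union> B \<Longrightarrow> distinct xs \<Longrightarrow> length xs \<le> card (A \<union> B)"
  using finA finB by (metis card_mono distinct_card finite_Un)

lemma longest_cycle:
  assumes "cyc R ys"
  obtains K c where "cyc R K" "length K = 2 * c" "\<And>xs. cyc R xs \<Longrightarrow> length xs \<le> 2 * c"
proof -
  have "\<exists>K. cyc R K \<and> (\<forall>xs. cyc R xs \<longrightarrow> length xs \<le> length K)"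
  proof (rule ex_has_greatest_nat[where P = "cyc R", OF assms])
    show "\<forall>xs. cyc R xs \<longrightarrow> length xs < card (A \<union> B) + 1"
      using length_bound cyc_sub by (auto simp: cyc_def less_Suc_eq_le)
  qed
  then obtain K where K: "cyc R K" "\<And>xs. cyc R xs \<Longrightarrow> length xs \<le> length K"
    by blast
  then obtain c where "length K = 2 * c"
    using cyc_even by (meson evenE)
  then show thesis
    using that K by metis
qed

lemma complete_red: "(\<And>x y. x \<in> X \<Longrightarrow> y \<in> Y \<Longrightarrow> R x y) \<Longrightarrow> complete R X Y"
  unfolding complete_def using R_sym by blast

lemma complete_blue: "X \<subseteq> A \<Longrightarrow> Y \<subseteq> B \<Longrightarrow> (\<And>x y. x \<in> X \<Longrightarrow> y \<in> Y \<Longrightarrow> \<not> R x y) \<Longrightarrow> complete Bl X Y"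
  unfolding complete_def using Bl_sym by (metis BlI opposite_def subset_iff)

text \<open>Two disjoint blue edges between the sides \<open>X1\<close> and \<open>X2\<close> of two blue blocks: the cycle goes through each block
from one end of a connecting edge to the other, so the vertices that it uses in \<open>Xi\<close> exceed those in \<open>Yi\<close> by one.
The last four bounds say that the total length can be split accordingly.\<close>

lemma two_blocks_same:
  assumes comp: "complete Bl X1 Y1" "complete Bl X2 Y2"
    and fin: "finite X1" "finite Y1" "finite X2" "finite Y2"
    and dis: "X1 \<inter> Y1 = {}" "X2 \<inter> Y2 = {}" "(X1 \<union> Y1) \<inter> (X2 \<union> Y2) = {}"
    and e: "x1 \<in> X1" "x1' \<in> X1" "x1 \<noteq> x1'" "x2 \<in> X2" "x2' \<in> X2" "x2 \<noteq> x2'" "Bl x1 x2" "Bl x1' x2'"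
    and t: "3 \<le> t" "1 \<le> card Y1" "1 \<le> card Y2" "t + 1 \<le> card X1 + card X2" "t \<le> card X1 + card Y2"
      "t \<le> card Y1 + card X2" "t \<le> card Y1 + card Y2 + 1"
  shows "has_cyc Bl (2 * t)"
proof -
  have "card {x1, x1'} \<le> card X1" "card {x2, x2'} \<le> card X2"
    by (rule card_mono; use e fin in simp)+
  moreover have "card {x1, x1'} = 2" "card {x2, x2'} = 2"
    using e(3,6) by simp_all
  ultimately have c: "2 \<le> card X1" "2 \<le> card X2"
    by simp_all
  obtain i j where ij: "i + j = t - 1" "1 \<le> i" "i \<le> min (card X1 - 1) (card Y1)" "1 \<le> j" "j \<le> min (card X2 - 1) (card Y2)"
  proof -
    have "\<exists>i j. i + j = t - 1 \<and> 1 \<le> i \<and> i \<le> min (card X1 - 1) (card Y1) \<and> 1 \<le> j \<and> j \<le> min (card X2 - 1) (card Y2)"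
      by (rule sum_split) (use c t in auto)
    then show thesis
      using that by blast
  qed
  have lt: "i < card X1" "i \<le> card Y1" "j < card X2" "j \<le> card Y2"
    using ij c by auto
  obtain us where us: "path Bl us" "hd us = x1" "last us = x1'" "set us \<subseteq> X1 \<union> Y1" "length us = 2 * i + 1"
    using complete_path_same[OF comp(1) fin(1,2) dis(1) e(1,2,3) ij(2) lt(1,2)] by blast
  obtain vs where vs: "path Bl vs" "hd vs = x2'" "last vs = x2" "set vs \<subseteq> X2 \<union> Y2" "length vs = 2 * j + 1"
    using complete_path_same[OF comp(2) fin(3,4) dis(2) e(5,4) e(6)[symmetric] ij(4) lt(3,4)] by blast
  have d: "set us \<inter> set vs = {}"
    using us(4) vs(4) dis(3) by blast
  have "cyc Bl (us @ vs)"
    by (rule cyc_join[OF us(1) vs(1) d]) (use us(2,3,5) vs(2,3,5) e(8) Bl_sym[OF e(7)] ij in simp_all)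
  moreover have "length (us @ vs) = 2 * t"
    using us vs ij t by auto
  ultimately show ?thesis
    by (rule has_cycI)
qed

text \<open>The same with one connecting edge between \<open>X1\<close> and \<open>X2\<close> and one between \<open>Y1\<close> and \<open>Y2\<close>; now each block is
passed from one side to the other and is used evenly.\<close>

lemma two_blocks_opposite:
  assumes comp: "complete Bl X1 Y1" "complete Bl X2 Y2"
    and fin: "finite X1" "finite Y1" "finite X2" "finite Y2"
    and dis: "X1 \<inter> Y1 = {}" "X2 \<inter> Y2 = {}" "(X1 \<union> Y1) \<inter> (X2 \<union> Y2) = {}"
    and e: "x1 \<in> X1" "y1 \<in> Y1" "x2 \<in> X2" "y2 \<in> Y2" "Bl x1 x2" "Bl y1 y2"
    and t: "2 \<le> t" "t \<le> card X1 + card X2" "t \<le> card X1 + card Y2" "t \<le> card Y1 + card X2" "t \<le> card Y1 + card Y2"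
  shows "has_cyc Bl (2 * t)"
proof -
  have c: "1 \<le> card X1" "1 \<le> card Y1" "1 \<le> card X2" "1 \<le> card Y2"
    using e fin by (auto simp: Suc_le_eq card_gt_0_iff)
  obtain i j where ij: "i + j = t" "1 \<le> i" "i \<le> min (card X1) (card Y1)" "1 \<le> j" "j \<le> min (card X2) (card Y2)"
  proof -
    have "\<exists>i j. i + j = t \<and> 1 \<le> i \<and> i \<le> min (card X1) (card Y1) \<and> 1 \<le> j \<and> j \<le> min (card X2) (card Y2)"
      by (rule sum_split) (use c t in auto)
    then show thesis
      using that by blast
  qed
  obtain us where us: "path Bl us" "hd us = x1" "last us = y1" "set us \<subseteq> X1 \<union> Y1" "length us = 2 * i"
    using complete_path_opposite[OF comp(1) fin(1,2) dis(1) e(1,2) ij(2)] ij(3) by auto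
  obtain vs where vs: "path Bl vs" "hd vs = y2" "last vs = x2" "set vs \<subseteq> Y2 \<union> X2" "length vs = 2 * j"
    using complete_path_opposite[OF complete_sym[OF comp(2)] fin(4,3) _ e(4,3) ij(4)] ij(5) dis by auto
  have d: "set us \<inter> set vs = {}"
    using us(4) vs(4) dis(3) by blast
  have "cyc Bl (us @ vs)"
    by (rule cyc_join[OF us(1) vs(1) d]) (use us(2,3,5) vs(2,3,5) e(6) Bl_sym[OF e(5)] ij t in simp_all)
  moreover have "length (us @ vs) = 2 * t"
    using us vs ij by auto
  ultimately show ?thesis
    by (rule has_cycI)
qed

text \<open>One extra vertex with two neighbours in \<open>Y\<close> replaces a missing vertex of \<open>X\<close>.\<close>

lemma complete_plus_one:
  assumes comp: "complete Bl X Y" and fin: "finite X" "finite Y" and dis: "X \<inter> Y = {}"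
    and a: "a \<notin> X \<union> Y" "y1 \<in> Y" "y2 \<in> Y" "y1 \<noteq> y2" "Bl a y1" "Bl a y2"
    and t: "2 \<le> t" "t \<le> card X + 1" "t \<le> card Y"
  shows "has_cyc Bl (2 * t)"
proof -
  have t': "1 \<le> t - 1" "t - 1 < card Y" "t - 1 \<le> card X"
    using t by arith+
  have dis': "Y \<inter> X = {}"
    using dis by blast
  obtain us where us: "path Bl us" "hd us = y1" "last us = y2" "set us \<subseteq> Y \<union> X" "length us = 2 * (t - 1) + 1"
    using complete_path_same[OF complete_sym[OF comp] fin(2,1) dis' a(2,3,4) t'] by blast
  have "cyc Bl ([a] @ us)"
    using us a Bl_sym[OF a(6)] t by (intro cyc_join) auto
  then show ?thesis
    using us t by (intro has_cycI) auto
qed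

text \<open>Two extra vertices \<open>v\<close> and \<open>a\<close> with a common neighbour \<open>y1\<close> and further distinct neighbours \<open>y2\<close> and \<open>y3\<close>
replace two missing vertices of \<open>X\<close>.\<close>

lemma complete_plus_two:
  assumes comp: "complete Bl X Y" and fin: "finite X" "finite Y" and dis: "X \<inter> Y = {}"
    and a: "a \<notin> X \<union> Y" "v \<notin> X \<union> Y" "a \<noteq> v" "y1 \<in> Y" "y2 \<in> Y" "y3 \<in> Y" "y1 \<noteq> y2" "y3 \<noteq> y1" "y3 \<noteq> y2"
      "Bl v y1" "Bl v y2" "Bl a y1" "Bl a y3"
    and t: "3 \<le> t" "t \<le> card X + 2" "t \<le> card Y"
  shows "has_cyc Bl (2 * t)"
proof -
  have c: "complete Bl (Y - {y1}) X"
    using comp by (auto simp: complete_def)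
  have t': "1 \<le> t - 2" "t - 2 < card (Y - {y1})" "t - 2 \<le> card X"
    using t a(4) fin by auto
  have y: "finite (Y - {y1})" "(Y - {y1}) \<inter> X = {}" "y3 \<in> Y - {y1}" "y2 \<in> Y - {y1}"
    using dis a fin by auto
  obtain us where us: "path Bl us" "hd us = y3" "last us = y2" "set us \<subseteq> (Y - {y1}) \<union> X" "length us = 2 * (t - 2) + 1"
    using complete_path_same[OF c y(1) fin(1) y(2-4) a(9) t'] by blast
  have "path Bl [v, y1, a]"
    using a Bl_sym[OF a(12)] by (auto simp: path_def)
  then have "cyc Bl ([v, y1, a] @ us)"
    using us a Bl_sym[OF a(11)] dis t by (intro cyc_join) auto
  then show ?thesis
    using us t by (intro has_cycI) auto
qed

end

lemma bicol_flip: "bicol A B R \<Longrightarrow> bicol B A R"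
  unfolding bicol_def opposite_def by blast

lemma other_flip: "other B A R = other A B R"
  by (auto simp: other_def opposite_def fun_eq_iff)

lemma bicol_other: "bicol A B R \<Longrightarrow> bicol A B (other A B R)"
  unfolding bicol_def other_def opposite_def by blast

lemma other_other: "bicol A B R \<Longrightarrow> other A B (other A B R) = R"
  unfolding bicol_def other_def fun_eq_iff by blast

context bicol
begin

lemma red_plus_one:
  assumes "complete R X Y" "finite X" "finite Y" "X \<inter> Y = {}"
    and "a \<notin> X \<union> Y" "y1 \<in> Y" "y2 \<in> Y" "y1 \<noteq> y2" "R a y1" "R a y2"
    and "2 \<le> t" "t \<le> card X + 1" "t \<le> card Y"
  shows "has_cyc R (2 * t)"
proof -
  interpret o: bicol A B Bl
    using bicol_other bicol_axioms by blast
  show ?thesis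
    using o.complete_plus_one[unfolded other_other[OF bicol_axioms]] assms by blast
qed

end

definition restr :: "'v set \<Rightarrow> 'v set \<Rightarrow> ('v \<Rightarrow> 'v \<Rightarrow> bool) \<Rightarrow> 'v \<Rightarrow> 'v \<Rightarrow> bool" where
  "restr A B R u v \<longleftrightarrow> opposite A B u v \<and> R u v"

lemma bicol_restr:
  assumes "bicol A B R" "A' \<subseteq> A" "B' \<subseteq> B"
  shows "bicol A' B' (restr A' B' R)"
proof -
  interpret bicol A B R
    by (rule assms)
  show ?thesis
    by unfold_locales
      (use assms finA finB disj R_sym in \<open>auto simp: restr_def opposite_def intro: finite_subset\<close>)
qed

lemma has_cyc_other_restr:
  assumes "has_cyc (other A' B' (restr A' B' R)) k" "A' \<subseteq> A" "B' \<subseteq> B"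
  shows "has_cyc (other A B R) k"
proof -
  have "other A B R u v" if "other A' B' (restr A' B' R) u v" for u v
    using that assms(2,3) unfolding other_def restr_def opposite_def by blast
  then show ?thesis
    using assms(1) cyc_mono[of "other A' B' (restr A' B' R)" _ "other A B R"] unfolding has_cyc_def by blast
qed

section \<open>A red cycle whose predecessor length is missing\<close>

text \<open>If \<open>f\<close> never holds at distance \<open>\<kappa>\<close>, then the first condition, applied at \<open>i\<close> and at \<open>i + \<kappa>\<close>, makes \<open>f\<close>
change value at every step of two; such a pattern has period four and violates the second condition.\<close>

lemma rigid:
  fixes f :: "int \<Rightarrow> bool"
  assumes C1: "\<And>i. f i \<or> f (i + 2)" and C2: "\<And>i. f i \<or> f (i + 1) \<or> f (i + 4)"
  shows "\<exists>i. f i \<and> f (i + \<kappa>)"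
proof (rule ccontr)
  assume "\<not> ?thesis"
  then have no: "\<not> f i \<or> \<not> f (i + \<kappa>)" for i
    by blast
  have flip: "f (i + 2) \<longleftrightarrow> \<not> f i" for i
    using C1[of i] C1[of "i + \<kappa>"] no[of i] no[of "i + 2"] by (auto simp: algebra_simps)
  have per: "f (i + 4) \<longleftrightarrow> f i" for i
    using flip[of i] flip[of "i + 2"] by (auto simp: algebra_simps)
  obtain i where i: "\<not> f i"
    using flip[of 0] by blast
  have "f (i + 1)"
    using C2[of i] i per[of i] by auto
  then have "\<not> f (i + 3)"
    using flip[of "i + 1"] by (auto simp: algebra_simps)
  moreover have "\<not> f (i + 7)"
    using calculation per[of "i + 3"] by (auto simp: algebra_simps)
  moreover have "\<not> f (i + 4)"
    using i per[of i] by auto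
  ultimately show False
    using C2[of "i + 3"] by (auto simp: algebra_simps)
qed

locale shortcut_free = bicol A B R for A B :: "'v set" and R +
  fixes K :: "'v list" and L :: nat
  assumes K: "cyc R K" and lenK: "length K = 2 * L" and L6: "6 \<le> L"
    and no_short: "\<not> has_cyc R (2 * L - 2)"

begin

text \<open>The vertices of the cycle indexed by all integers, with period \<open>2L\<close>.\<close>

definition g :: "int \<Rightarrow> 'v" where
  "g i = K ! nat (i mod (2 * int L))"

abbreviation "bb x y \<equiv> Bl (g x) (g y)"

lemma dK: "distinct K" and sK: "successively R K" and clK: "R (last K) (hd K)"
  using K by (auto simp: cyc_def)

lemma nat_mod_less: "nat (i mod (2 * int L)) < 2 * L"
  using L6 by (simp add: nat_less_iff)

lemma g_eq_iff: "g i = g j \<longleftrightarrow> 2 * int L dvd i - j"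
proof -
  have "g i = g j \<longleftrightarrow> nat (i mod (2 * int L)) = nat (j mod (2 * int L))"
    unfolding g_def using dK lenK nat_mod_less by (auto simp: nth_eq_iff_index_eq)
  also have "\<dots> \<longleftrightarrow> i mod (2 * int L) = j mod (2 * int L)"
    using L6 by (simp add: nat_eq_iff)
  finally show ?thesis
    by (simp add: mod_eq_dvd_iff)
qed

lemma g_cong: "2 * int L dvd i - j \<Longrightarrow> g i = g j"
  by (simp add: g_eq_iff)

lemma R_step: "R (g i) (g (i + 1))"
proof -
  define r where "r = nat (i mod (2 * int L))"
  have r: "r < 2 * L"
    using nat_mod_less r_def by simp
  have i: "g i = K ! r"
    by (simp add: g_def r_def)
  have e: "g (i + 1) = g (int r + 1)"
    using L6 by (intro g_cong) (simp add: r_def mod_eq_dvd_iff[symmetric] mod_simps)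
  show ?thesis
  proof (cases "Suc r = 2 * L")
    case True
    then have "g (int r + 1) = K ! 0"
      by (simp add: g_def flip: True) (metis True int_ops(4) mod_self nat_0 of_nat_mult of_nat_numeral)
    then show ?thesis
      using i e clK lenK True by (metis diff_Suc_1 hd_conv_nth last_conv_nth length_0_conv nat.distinct(1))
  next
    case False
    then have "Suc r < 2 * L"
      using r by simp
    then have "g (int r + 1) = K ! Suc r"
      by (simp add: g_def nat_add_distrib)
    then show ?thesis
      using i e sK lenK \<open>Suc r < 2 * L\<close> by (auto simp: successively_conv_nth)
  qed
qed

lemma side_step: "g i \<in> A \<union> B" "g (i + 1) \<in> A \<longleftrightarrow> g i \<notin> A"
  using R_bip[OF R_step[of i]] disj by (auto simp: opposite_def)

lemma side_nat: "g (i + int n) \<in> A \<longleftrightarrow> (if even n then g i \<in> A else g i \<notin> A)"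
proof (induction n)
  case (Suc n)
  have "g (i + int (Suc n)) \<in> A \<longleftrightarrow> g (i + int n) \<notin> A"
    using side_step(2)[of "i + int n"] by (simp add: algebra_simps)
  then show ?case
    using Suc by auto
qed auto

lemma opp_odd:
  assumes "odd (j - i)"
  shows "opposite A B (g i) (g j)"
proof -
  have "g j \<in> A \<longleftrightarrow> g i \<notin> A"
  proof (cases "i \<le> j")
    case True
    then show ?thesis
      using side_nat[of i "nat (j - i)"] assms by (simp add: even_nat_iff)
  next
    case False
    then show ?thesis
      using side_nat[of j "nat (i - j)"] assms by (simp add: even_nat_iff)
  qed
  then show ?thesis
    using side_step(1)[of i] side_step(1)[of j] disj by (auto simp: opposite_def)
qed

lemma bb_sym: "bb x y \<Longrightarrow> bb y x"
  by (rule Bl_sym)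

lemma R_sub: "R (g (i + 1)) (g i)"
  using R_step R_sym by blast

text \<open>Every red cycle through all but two of the vertices of \<open>K\<close> is excluded. The lemma takes such a cycle as the list
of its offsets from a base vertex.\<close>

lemma red_offsets:
  assumes "distinct ts" "set ts \<subseteq> {..<2 * L}"
    and "successively (\<lambda>s t. R (g (i + int s)) (g (i + int t))) ts"
    and "R (g (i + int (last ts))) (g (i + int (hd ts)))" "length ts = 2 * L - 2"
  shows False
proof -
  have "ts \<noteq> []"
    using assms(5) L6 by auto
  have "inj_on (\<lambda>t. g (i + int t)) {..<2 * L}"
  proof (rule inj_onI)
    fix s t :: nat
    assume st: "s \<in> {..<2 * L}" "t \<in> {..<2 * L}" "g (i + int s) = g (i + int t)"
    then have "2 * int L dvd int s - int t"
      by (simp add: g_eq_iff)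
    moreover have "\<bar>int s - int t\<bar> < 2 * int L"
      using st by auto
    ultimately show "s = t"
      using dvd_imp_le_int[of "int s - int t" "2 * int L"] by fastforce
  qed
  then have "inj_on (\<lambda>t. g (i + int t)) (set ts)"
    using assms(2) inj_on_subset by blast
  then have "cyc R (map (\<lambda>t. g (i + int t)) ts)"
    using assms \<open>ts \<noteq> []\<close> L6 by (auto simp: cyc_def distinct_map successively_map last_map hd_map)
  then show False
    using no_short assms(5) by (auto intro: has_cycI)
qed

lemma red_upt: "successively (\<lambda>s t. R (g (i + int s)) (g (i + int t))) [a..<b]"
proof -
  have "R (g (i + int t)) (g (i + int (Suc t)))" for t
    using R_step[of "i + int t"] by (simp add: algebra_simps)
  then have "R (g (i + int (a + t))) (g (i + int (a + Suc t)))" for t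
    by (simp only: add_Suc_right)
  then show ?thesis
    unfolding successively_conv_nth by (simp only: length_upt nth_upt) auto
qed

lemma red_close: "R (g (i + int (2 * L - 1))) (g i)"
proof -
  have "g i = g (i + int (2 * L - 1) + 1)"
    using L6 by (intro g_cong) (simp add: of_nat_diff)
  then show ?thesis
    using R_step by metis
qed

text \<open>A red chord from \<open>i\<close> to \<open>i + 3\<close> would bypass exactly two vertices.\<close>

lemma step3: "bb i (i + 3)"
proof (rule BlI[OF opp_odd])
  show "\<not> R (g i) (g (i + 3))"
  proof
    assume r: "R (g i) (g (i + 3))"
    show False
    proof (rule red_offsets[of "0 # [3..<2 * L]" i])
      show "successively (\<lambda>s t. R (g (i + int s)) (g (i + int t))) (0 # [3..<2 * L])"
        using red_upt r L6 by (auto simp: successively_Cons)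
    qed (use red_close[of i] L6 in auto)
  qed
qed auto

text \<open>The chords that bypass four vertices need not be blue, but the red ones are sparse: see the next lemmas.\<close>

definition jump :: "int \<Rightarrow> bool" where
  "jump i \<longleftrightarrow> bb i (i + 5)"

lemma not_jump: "\<not> jump i \<longleftrightarrow> R (g i) (g (i + 5))"
  using opp_odd[of "i + 5" i] by (auto simp: jump_def other_def)

text \<open>If the chords at \<open>i\<close> and \<open>i + 2\<close> were both red, the cycle \<open>i, i + 5, i + 4, i + 3, i + 2, i + 7, ...\<close> would
miss only \<open>i + 1\<close> and \<open>i + 6\<close>.\<close>

lemma jump_or_2: "jump i \<or> jump (i + 2)"
proof (rule ccontr)
  assume "\<not> ?thesis"
  then have r: "R (g i) (g (i + 5))" "R (g (i + 2)) (g (i + 7))"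
    using not_jump[of i] not_jump[of "i + 2"] by (auto simp: algebra_simps)
  show False
  proof (rule red_offsets[of "[0, 5, 4, 3, 2] @ [7..<2 * L]" i])
    show "successively (\<lambda>s t. R (g (i + int s)) (g (i + int t))) ([0, 5, 4, 3, 2] @ [7..<2 * L])"
      using red_upt r L6 R_sub[of "i + 4"] R_sub[of "i + 3"] R_sub[of "i + 2"]
      by (auto simp: successively_append_iff successively_Cons add.commute)
  qed (use red_close[of i] L6 in auto)
qed

text \<open>With three red chords at \<open>i\<close>, \<open>i + 1\<close> and \<open>i + 4\<close>, the cycle \<open>i, i + 5, i + 6, i + 1, ..., i + 4, i + 9, ...\<close>
would miss only \<open>i + 7\<close> and \<open>i + 8\<close>.\<close>

lemma jump_or_1_4: "jump i \<or> jump (i + 1) \<or> jump (i + 4)"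
proof (rule ccontr)
  assume "\<not> ?thesis"
  then have r: "R (g i) (g (i + 5))" "R (g (i + 1)) (g (i + 6))" "R (g (i + 4)) (g (i + 9))"
    using not_jump[of i] not_jump[of "i + 1"] not_jump[of "i + 4"] by (auto simp: algebra_simps)
  show False
  proof (rule red_offsets[of "[0, 5, 6, 1, 2, 3, 4] @ [9..<2 * L]" i])
    show "successively (\<lambda>s t. R (g (i + int s)) (g (i + int t))) ([0, 5, 6, 1, 2, 3, 4] @ [9..<2 * L])"
      using red_upt r R_sym[OF r(2)] L6 R_step[of "i + 5"] R_step[of "i + 1"] R_step[of "i + 2"] R_step[of "i + 3"]
      by (auto simp: successively_append_iff successively_Cons add.commute)
  qed (use red_close[of i] L6 in auto)
qed

lemma two_jumps: "\<exists>i. jump i \<and> jump (i + \<kappa>)"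
  using rigid[of jump \<kappa>] jump_or_2 jump_or_1_4 by blast

lemma blue_cycle:
  assumes "distinct (map g xs)" "successively bb xs" "bb (last xs) (hd xs)" "length xs = 2 * k" "2 \<le> k"
  shows "has_cyc Bl (2 * k)"
proof -
  have "xs \<noteq> []"
    using assms by auto
  then have "cyc Bl (map g xs)"
    using assms by (auto simp: cyc_def successively_map last_map hd_map)
  then show ?thesis
    using assms by (auto intro: has_cycI)
qed

lemma step3_down: "bb i (i - 3)"
  using bb_sym[OF step3[of "i - 3"]] by simp

definition up :: "int \<Rightarrow> nat \<Rightarrow> int list" where
  "up a k = map (\<lambda>t. a + 3 * int t) [0..<k]"

definition down :: "int \<Rightarrow> nat \<Rightarrow> int list" where
  "down a k = map (\<lambda>t. a - 3 * int t) [0..<k]"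

lemma length_up [simp]: "length (up a k) = k" and length_down [simp]: "length (down a k) = k"
  by (auto simp: up_def down_def)

lemma up_Nil [simp]: "up a k = [] \<longleftrightarrow> k = 0" and down_Nil [simp]: "down a k = [] \<longleftrightarrow> k = 0"
  by (auto simp: up_def down_def)

lemma hd_up [simp]: "0 < k \<Longrightarrow> hd (up a k) = a" and hd_down [simp]: "0 < k \<Longrightarrow> hd (down a k) = a"
  by (auto simp: up_def down_def hd_map)

lemma last_up [simp]: "0 < k \<Longrightarrow> last (up a k) = a + 3 * (int k - 1)"
  and last_down [simp]: "0 < k \<Longrightarrow> last (down a k) = a - 3 * (int k - 1)"
  by (auto simp: up_def down_def last_map of_nat_diff)

lemma up_E: "x \<in> set (up a k) \<Longrightarrow> \<exists>t. 0 \<le> t \<and> t < int k \<and> x = a + 3 * t"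
  unfolding up_def by force

lemma down_E: "x \<in> set (down a k) \<Longrightarrow> \<exists>t. 0 \<le> t \<and> t < int k \<and> x = a - 3 * t"
  unfolding down_def by force

lemma up_blue: "successively bb (up a k)"
proof -
  have "bb (a + 3 * int t) (a + 3 * int (Suc t))" for t
    using step3[of "a + 3 * int t"] by (simp add: algebra_simps)
  then show ?thesis
    by (auto simp: up_def successively_conv_nth)
qed

lemma down_blue: "successively bb (down a k)"
proof -
  have "bb (a - 3 * int t) (a - 3 * int (Suc t))" for t
    using step3_down[of "a - 3 * int t"] by (simp add: algebra_simps)
  then show ?thesis
    by (auto simp: down_def successively_conv_nth)
qed

lemma small_dvd: "2 * int L dvd d \<Longrightarrow> \<bar>d\<bar> < 2 * int L \<Longrightarrow> d = 0"
  using dvd_imp_le_int[of d "2 * int L"] by auto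

text \<open>If 3 does not divide \<open>L\<close>, steps of three run through the whole cycle, so that they form one blue Hamiltonian
cycle of the vertex set of \<open>K\<close>; the index along it is \<open>t\<close> in \<open>a + 3 t\<close>.\<close>

lemma dvd3_cancel:
  assumes "\<not> 3 dvd L" "2 * int L dvd 3 * d"
  shows "2 * int L dvd d"
proof -
  obtain c where c: "3 * d = 2 * int L * c"
    using assms(2) by (auto simp: dvd_def)
  define q where "q = int L div 3"
  have "int L = 3 * q + 1 \<or> int L = 3 * q + 2"
    using assms(1) unfolding q_def by presburger
  then have "3 * (d - 2 * q * c) = 2 * c \<or> 3 * (d - 2 * q * c) = 4 * c"
    using c by (auto simp: algebra_simps)
  then have "3 dvd c"
    by presburger
  then show ?thesis
    using c by (auto simp: dvd_def)
qed

lemma blue_by_index: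
  assumes "\<not> 3 dvd L" "distinct ts" "\<And>s t. s \<in> set ts \<Longrightarrow> t \<in> set ts \<Longrightarrow> \<bar>s - t\<bar> < 2 * int L"
    and "successively (\<lambda>s t. bb (a + 3 * s) (a + 3 * t)) ts" "bb (a + 3 * last ts) (a + 3 * hd ts)"
    and "length ts = 2 * k" "2 \<le> k"
  shows "has_cyc Bl (2 * k)"
proof (rule blue_cycle)
  have ne: "ts \<noteq> []"
    using assms by auto
  have "inj_on (\<lambda>t. g (a + 3 * t)) (set ts)"
  proof (rule inj_onI)
    fix s t
    assume st: "s \<in> set ts" "t \<in> set ts" "g (a + 3 * s) = g (a + 3 * t)"
    then have "2 * int L dvd 3 * (s - t)"
      by (simp add: g_eq_iff right_diff_distrib)
    then have "2 * int L dvd s - t"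
      using assms(1) dvd3_cancel by blast
    then show "s = t"
      using small_dvd assms(3)[OF st(1,2)] by fastforce
  qed
  then show "distinct (map g (map (\<lambda>t. a + 3 * t) ts))"
    using assms(2) by (simp add: distinct_map comp_def)
  show "successively bb (map (\<lambda>t. a + 3 * t) ts)"
    using assms(4) by (simp add: successively_map)
  show "bb (last (map (\<lambda>t. a + 3 * t) ts)) (hd (map (\<lambda>t. a + 3 * t) ts))"
    using assms(5) ne by (simp add: last_map hd_map)
qed (use assms in auto)

lemma upto_blue: "successively (\<lambda>s t. bb (a + 3 * s) (a + 3 * t)) [i..j]"
proof -
  have "bb (a + 3 * s) (a + 3 * (s + 1))" for s
    using step3[of "a + 3 * s"] by (simp add: algebra_simps)
  then have "bb (a + 3 * (i + int t)) (a + 3 * (i + int (Suc t)))" for t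
    by (simp only: of_nat_Suc add.assoc[symmetric] add.commute[of 1])
  then show ?thesis
    unfolding successively_conv_nth by (auto simp: nth_upto simp del: of_nat_Suc)
qed

lemma rev_upto_blue: "successively (\<lambda>s t. bb (a + 3 * s) (a + 3 * t)) (rev [i..j])"
  using upto_blue[of a i j] by (auto intro: successively_mono dest: bb_sym)

lemma hd_upto: "i \<le> j \<Longrightarrow> hd [i..j] = i" and last_upto: "i \<le> j \<Longrightarrow> last [i..j] = j" for i j :: int
  by (subst upto_rec1, simp, simp) (subst upto_rec2, simp, simp)

text \<open>Two chords of equal span \<open>\<delta>\<close> of the blue Hamiltonian cycle, at distance \<open>k < \<delta>\<close>, cross. They form one cycle with
the two arcs of length \<open>k\<close> between their ends, and one with the two remaining arcs.\<close>

lemma parallel_chords: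
  fixes \<delta> k :: int
  assumes "\<not> 3 dvd L" "1 \<le> k" "k < \<delta>" "2 * \<delta> \<le> 2 * int L"
    and e: "bb a (a + 3 * \<delta>)" "bb (a + 3 * k) (a + 3 * (k + \<delta>))"
  shows "has_cyc Bl (2 * nat (k + 1))" "has_cyc Bl (2 * nat (int L - k + 1))"
proof -
  show "has_cyc Bl (2 * nat (k + 1))"
  proof (rule blue_by_index[of "[0..k] @ rev [\<delta>..k + \<delta>]" a])
    show "\<bar>s - t\<bar> < 2 * int L" if "s \<in> set ([0..k] @ rev [\<delta>..k + \<delta>])" "t \<in> set ([0..k] @ rev [\<delta>..k + \<delta>])" for s t
    proof -
      have "0 \<le> s" "s \<le> k + \<delta>" "0 \<le> t" "t \<le> k + \<delta>"
        using that assms(2,3) by auto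
      then show ?thesis
        using assms(2,3,4) by linarith
    qed
    show "successively (\<lambda>s t. bb (a + 3 * s) (a + 3 * t)) ([0..k] @ rev [\<delta>..k + \<delta>])"
      unfolding successively_append_iff using assms(2,3) e(2)
      by (simp only: upto_blue rev_upto_blue last_upto hd_rev) simp
    show "bb (a + 3 * last ([0..k] @ rev [\<delta>..k + \<delta>])) (a + 3 * hd ([0..k] @ rev [\<delta>..k + \<delta>]))"
      using assms(2,3) bb_sym[OF e(1)] by (simp add: hd_upto last_rev)
  qed (use assms(1-4) in auto)
  have p: "g (a + 3 * (2 * int L)) = g a"
    by (intro g_cong) auto
  show "has_cyc Bl (2 * nat (int L - k + 1))"
  proof (rule blue_by_index[of "rev [k..\<delta>] @ [k + \<delta>..2 * int L]" a])
    show "\<bar>s - t\<bar> < 2 * int L" if "s \<in> set (rev [k..\<delta>] @ [k + \<delta>..2 * int L])" "t \<in> set (rev [k..\<delta>] @ [k + \<delta>..2 * int L])" for s t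
    proof -
      have "k \<le> s" "s \<le> 2 * int L" "k \<le> t" "t \<le> 2 * int L"
        using that assms(2-4) by auto
      then show ?thesis
        using assms(2) by linarith
    qed
    show "successively (\<lambda>s t. bb (a + 3 * s) (a + 3 * t)) (rev [k..\<delta>] @ [k + \<delta>..2 * int L])"
      unfolding successively_append_iff using assms(2-4) e(2)
      by (simp only: upto_blue rev_upto_blue hd_upto last_rev) simp
    show "bb (a + 3 * last (rev [k..\<delta>] @ [k + \<delta>..2 * int L])) (a + 3 * hd (rev [k..\<delta>] @ [k + \<delta>..2 * int L]))"
      using assms(2-4) e(1) p by (simp add: last_upto hd_rev)
  qed (use assms(1-4) in auto)
qed

text \<open>For \<open>k \<ge> \<delta>\<close> the chords do not cross, and both can be used to shorten the Hamiltonian cycle.\<close>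

lemma nested_free_chords:
  fixes \<delta> k :: int
  assumes "\<not> 3 dvd L" "2 \<le> \<delta>" "\<delta> \<le> k" "k + \<delta> < 2 * int L"
    and e: "bb a (a + 3 * \<delta>)" "bb (a + 3 * k) (a + 3 * (k + \<delta>))"
  shows "has_cyc Bl (2 * nat (int L - \<delta> + 1))"
proof -
  have p: "g (a + 3 * (2 * int L)) = g a"
    by (intro g_cong) auto
  have c: "bb (a + 3 * (2 * int L - 1)) a"
    using step3[of "a + 3 * (2 * int L - 1)"] p by (simp add: algebra_simps)
  let ?ts = "[0] @ [\<delta>..k] @ [k + \<delta>..2 * int L - 1]"
  show ?thesis
  proof (rule blue_by_index[of ?ts a])
    show "\<bar>s - t\<bar> < 2 * int L" if "s \<in> set ?ts" "t \<in> set ?ts" for s t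
    proof -
      have "0 \<le> s" "s \<le> 2 * int L - 1" "0 \<le> t" "t \<le> 2 * int L - 1"
        using that assms(2-4) by auto
      then show ?thesis
        by linarith
    qed
    show "successively (\<lambda>s t. bb (a + 3 * s) (a + 3 * t)) ?ts"
      unfolding successively_append_iff using assms(2-4) e
      by (simp only: upto_blue hd_upto last_upto) (simp add: hd_upto hd_append)
    show "bb (a + 3 * last ?ts) (a + 3 * hd ?ts)"
      using assms(2-4) c by (simp add: last_upto)
  qed (use assms(1-4) in auto)
qed

lemma jump_shift: "2 * int L dvd i - j \<Longrightarrow> jump i \<longleftrightarrow> jump j"
proof -
  assume "2 * int L dvd i - j"
  moreover from this have "2 * int L dvd (i + 5) - (j + 5)"
    by simp
  ultimately show ?thesis
    unfolding jump_def using g_cong by metis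
qed

text \<open>Along the blue Hamiltonian cycle of steps of three, the chord from \<open>i\<close> to \<open>i + 5\<close> has span
\<open>(2 L + 5) div 3\<close> or \<open>(2 L - 5) div 3\<close>, whichever is an integer. By \<open>two_jumps\<close> there are two such blue chords at
any desired distance, so \<open>parallel_chords\<close> applies with the distance \<open>m - 1\<close> or \<open>L - m + 1\<close>. Both distances can
be too large only for \<open>L = 7\<close> and \<open>L = 10\<close>; there the two chords may be taken not to cross.\<close>

lemma descent_not3:
  assumes "\<not> 3 dvd L" "5 \<le> m" "m \<le> L - 1"
  shows "has_cyc Bl (2 * m)"
proof -
  have two: ?thesis if k: "k = int m - 1 \<or> k = int L - int m + 1" and \<delta>: "k < \<delta>" "2 * \<delta> \<le> 2 * int L"
    and e: "bb a (a + 3 * \<delta>)" "bb (a + 3 * k) (a + 3 * (k + \<delta>))" for a k \<delta>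
  proof -
    have "1 \<le> k"
      using k assms L6 by auto
    have "nat (k + 1) = m \<or> nat (int L - k + 1) = m"
      using k by auto
    then show ?thesis
      using parallel_chords[OF assms(1) \<open>1 \<le> k\<close> \<delta> e] by auto
  qed
  have "L mod 3 = 1 \<or> L mod 3 = 2"
    using assms(1) by presburger
  then show ?thesis
  proof
    assume "L mod 3 = 2"
    then have "\<exists>d. 2 * int L + 5 = 3 * d"
      by presburger
    then obtain \<delta> where \<delta>: "2 * int L + 5 = 3 * \<delta>"
      by blast
    define k where "k = (if int m - 1 < \<delta> then int m - 1 else int L - int m + 1)"
    have k: "k = int m - 1 \<or> k = int L - int m + 1" "k < \<delta>"
      using \<delta> L6 by (auto simp: k_def)
    obtain i where i: "jump i" "jump (i + 3 * k)"
      using two_jumps by blast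
    have "g (i + 5) = g (i + 3 * \<delta>)" "g (i + 3 * k + 5) = g (i + 3 * (k + \<delta>))"
    proof -
      have "i + 5 - (i + 3 * \<delta>) = - (2 * int L)" "i + 3 * k + 5 - (i + 3 * (k + \<delta>)) = - (2 * int L)"
        using \<delta> by (auto simp: algebra_simps)
      then show "g (i + 5) = g (i + 3 * \<delta>)" "g (i + 3 * k + 5) = g (i + 3 * (k + \<delta>))"
        unfolding g_eq_iff by simp_all
    qed
    then show ?thesis
      using two[OF k(1,2), of i] i \<delta> L6 by (auto simp: jump_def)
  next
    assume "L mod 3 = 1"
    then have "\<exists>d. 2 * int L - 5 = 3 * d"
      by presburger
    then obtain \<delta> where \<delta>: "2 * int L - 5 = 3 * \<delta>"
      by blast
    have chord: "bb (i + 5 + 3 * k) (i + 5 + 3 * (k + \<delta>))" if "jump (i + 3 * k)" for i k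
    proof -
      have "g (i + 3 * k) = g (i + 5 + 3 * (k + \<delta>))"
      proof -
        have "i + 3 * k - (i + 5 + 3 * (k + \<delta>)) = - (2 * int L)"
          using \<delta> by (auto simp: algebra_simps)
        then show ?thesis
          unfolding g_eq_iff by simp
      qed
      then show ?thesis
        using that bb_sym by (simp add: jump_def algebra_simps)
    qed
    show ?thesis
    proof (cases "int m - 1 < \<delta> \<or> int L - int m + 1 < \<delta>")
      case True
      define k where "k = (if int m - 1 < \<delta> then int m - 1 else int L - int m + 1)"
      have k: "k = int m - 1 \<or> k = int L - int m + 1" "k < \<delta>"
        using True by (auto simp: k_def)
      obtain i where i: "jump i" "jump (i + 3 * k)"
        using two_jumps by blast
      then show ?thesis
        using two[OF k(1,2), of "i + 5"] chord[of i 0] chord[of i k] \<delta> by auto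
    next
      case False
      then have "L \<le> 10"
        using \<delta> by linarith
      then have L: "L = 7 \<or> L = 10"
        using L6 \<open>L mod 3 = 1\<close> by presburger
      then have m: "m = nat (int L - \<delta> + 1)"
        using False \<delta> assms by auto
      have far: ?thesis if "jump i" "jump (i + 3 * k)" "\<delta> \<le> k" "k + \<delta> < 2 * int L" for i k
        using nested_free_chords[OF assms(1) _ that(3,4), of "i + 5"] chord[of i 0] chord[of i k] that m L \<delta>
        by auto
      obtain i where i: "jump i"
        using two_jumps by blast
      from L show ?thesis
      proof
        assume L7: "L = 7"
        have "jump (i + 7) \<longleftrightarrow> jump (i + 21)"
          by (rule jump_shift) (simp add: L7)
        moreover have "jump (i + 7) \<or> jump (i + 9)"
          using jump_or_2[of "i + 7"] by (simp add: algebra_simps)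
        ultimately have "jump (i + 3 * 7) \<or> jump (i + 3 * 3)"
          by simp
        then show ?thesis
          using far[OF i, of 7] far[OF i, of 3] \<delta> L7 by linarith
      next
        assume L10: "L = 10"
        have "jump (i + 13) \<longleftrightarrow> jump (i + 33)"
          by (rule jump_shift) (simp add: L10)
        moreover have "jump (i + 13) \<or> jump (i + 15)"
          using jump_or_2[of "i + 13"] by (simp add: algebra_simps)
        ultimately have "jump (i + 3 * 11) \<or> jump (i + 3 * 5)"
          by simp
        then show ?thesis
          using far[OF i, of 11] far[OF i, of 5] \<delta> L10 by linarith
      qed
    qed
  qed
qed

lemma track_distinct_up:
  assumes "k \<le> 2 * q" "L = 3 * q"
  shows "distinct (map g (up a k))" "distinct (map g (down a k))"
proof -
  have *: "s = t" if "s < k" "t < k" "2 * int L dvd 3 * int s - 3 * int t" for s t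
    using small_dvd[OF that(3)] that assms by auto
  show "distinct (map g (up a k))"
    unfolding up_def distinct_map map_map comp_def
    using * by (auto simp: inj_on_def g_eq_iff)
  show "distinct (map g (down a k))"
    unfolding down_def distinct_map map_map comp_def
    using * by (auto simp: inj_on_def g_eq_iff dvd_diff_commute)
qed

text \<open>If 3 divides \<open>L\<close>, the steps of three split the cycle into three blue cycles, one for each residue modulo 3,
called tracks below.\<close>

lemma tracks_disjoint:
  assumes "L = 3 * q" "\<forall>x\<in>set xs. 3 dvd x - c" "\<forall>y\<in>set ys. 3 dvd y - c'" "\<not> 3 dvd c - c'"
  shows "set (map g xs) \<inter> set (map g ys) = {}"
proof -
  have "g x \<noteq> g y" if "x \<in> set xs" "y \<in> set ys" for x y
  proof
    assume "g x = g y"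
    then have "2 * int L dvd x - y"
      unfolding g_eq_iff .
    then have "6 * int q dvd x - y"
      using assms(1) by simp
    moreover have "3 dvd 6 * int q"
      by presburger
    ultimately have "3 dvd x - y"
      using dvd_trans by blast
    then show False
      using bspec[OF assms(2) that(1)] bspec[OF assms(3) that(2)] assms(4) by presburger
  qed
  then show ?thesis
    by auto
qed

lemma up_dvd: "\<forall>x\<in>set (up a k). 3 dvd x - a" and down_dvd: "\<forall>x\<in>set (down a k). 3 dvd x - a"
  by (auto dest!: up_E down_E)

text \<open>A chord of span five leads from one track to another. Two such chords at distance \<open>3 (k - 1)\<close> join arcs of \<open>k\<close>
vertices on the two tracks.\<close>

lemma two_tracks:
  assumes "L = 3 * q" "2 \<le> k" "k \<le> 2 * q" "jump i" "jump (i + 3 * (int k - 1))"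
  shows "has_cyc Bl (2 * k)"
proof (rule blue_cycle[of "up i k @ down (i + 3 * (int k - 1) + 5) k"])
  have "set (map g (up i k)) \<inter> set (map g (down (i + 3 * (int k - 1) + 5) k)) = {}"
    by (rule tracks_disjoint[OF assms(1) up_dvd down_dvd]) presburger+
  then show "distinct (map g (up i k @ down (i + 3 * (int k - 1) + 5) k))"
    using track_distinct_up[OF assms(3,1)] by simp
  show "successively bb (up i k @ down (i + 3 * (int k - 1) + 5) k)"
    unfolding successively_append_iff using assms(2,5) by (simp add: up_blue down_blue jump_def)
  show "bb (last (up i k @ down (i + 3 * (int k - 1) + 5) k)) (hd (up i k @ down (i + 3 * (int k - 1) + 5) k))"
    using assms(2) bb_sym[OF assms(4)[unfolded jump_def]] by (simp add: hd_append ac_simps)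
qed (use assms in auto)

text \<open>Three chords of span five connect the tracks cyclically, with one arc on each track. The arc on the first track
may run in either direction, the others run upwards.\<close>

lemma three_tracks:
  assumes q: "L = 3 * q"
    and arcs: "xs = up (z + 5) i \<or> xs = down (z + 5) i" "1 \<le> i" "i \<le> 2 * q" "g (last xs) = g x"
      "1 \<le> j" "j \<le> 2 * q" "g (x + 5 + 3 * (int j - 1)) = g y"
      "1 \<le> k" "k \<le> 2 * q" "g (y + 5 + 3 * (int k - 1)) = g z"
    and mod: "3 dvd x - (z + 5)" "3 dvd y - (x + 5)"
    and fs: "jump x" "jump y" "jump z" and len: "i + j + k = 2 * m"
  shows "has_cyc Bl (2 * m)"
proof -
  let ?ys = "up (x + 5) j" and ?zs = "up (y + 5) k"
  have lx: "length xs = i"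
    using arcs by auto
  have hx: "hd xs = z + 5"
    using arcs by auto
  have xsE: "\<forall>w\<in>set xs. 3 dvd w - (z + 5)"
    using arcs(1) up_dvd down_dvd by blast
  have "\<not> 3 dvd (z + 5) - (x + 5)" "\<not> 3 dvd (z + 5) - (y + 5)" "\<not> 3 dvd (x + 5) - (y + 5)"
    using mod by presburger+
  then have "set (map g xs) \<inter> set (map g ?ys) = {} \<and> set (map g xs) \<inter> set (map g ?zs) = {} \<and>
      set (map g ?ys) \<inter> set (map g ?zs) = {}"
    using tracks_disjoint[OF q xsE up_dvd] tracks_disjoint[OF q up_dvd up_dvd] by blast
  then have d: "distinct (map g (xs @ ?ys @ ?zs))"
    using track_distinct_up[OF _ q] arcs by auto
  have "successively bb xs"
    using arcs(1) up_blue down_blue by auto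
  moreover have "bb (last xs) (x + 5)"
    using fs(1) arcs(4) by (simp add: jump_def)
  moreover have "bb (x + 5 + 3 * (int j - 1)) (y + 5)"
    using fs(2) arcs(7) by (simp add: jump_def)
  ultimately have s: "successively bb (xs @ ?ys @ ?zs)"
    using arcs lx up_blue by (auto simp: successively_append_iff)
  have "bb (last (xs @ ?ys @ ?zs)) (hd (xs @ ?ys @ ?zs))"
    using fs(3) arcs hx lx by (auto simp: jump_def hd_append)
  then show ?thesis
    using blue_cycle[OF d s] len lx arcs by auto
qed

text \<open>When no three chords with the right arcs are available, four chords are used instead: the cycle traverses most
of a first track backwards, then part of a second one, all of the third one, and closes through two further
vertices \<open>z + 2\<close> and \<open>z + 5\<close> of the second track.\<close>

lemma merge_tracks:
  assumes q: "L = 3 * q" and \<mu>: "int q = \<mu> + 2 + int d" "0 \<le> \<mu>" and len: "m + nat \<mu> + 1 = 3 * q"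
    and fs: "jump z" "jump (z + 3 * \<mu> + 6)" "jump (z - 1)" "jump (z + 2)"
  shows "has_cyc Bl (2 * m)"
proof -
  define a b where "a = nat (2 * int q - \<mu> - 1)" and "b = nat (2 * int q - \<mu> - 3)"
  have a: "int a = 2 * int q - \<mu> - 1" "0 < a" and b: "int b = 2 * int q - \<mu> - 3" "0 < b"
    using \<mu> by (auto simp: a_def b_def)
  have per: "g (w + 6 * int q) = g w" for w
    by (rule g_cong) (simp add: q)
  let ?xs = "down z a" and ?ys = "up (z + 3 * \<mu> + 11) b" and ?zs = "down (z + 4) (2 * q)" and ?ws = "[z + 2, z + 5]"
  have lx: "g (last ?xs) = g (z + 3 * \<mu> + 6)"
  proof -
    have "last ?xs + 6 * int q = z + 3 * \<mu> + 6"
      using a by simp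
    then show ?thesis
      using per by metis
  qed
  have ly: "g (last ?ys) = g (z - 1)"
  proof -
    have "last ?ys = z - 1 + 6 * int q"
      using b by simp
    then show ?thesis
      using per by metis
  qed
  have lz: "g (last ?zs) = g (z + 7)"
  proof -
    have "last ?zs + 6 * int q = z + 7"
      using \<mu> by simp
    then show ?thesis
      using per by metis
  qed
  have ws: "\<forall>w\<in>set ?ws. 3 dvd w - (z + 2)"
    by auto
  have "\<not> 3 dvd z - (z + 3 * \<mu> + 11)" "\<not> 3 dvd z - (z + 4)" "\<not> 3 dvd z - (z + 2)"
      "\<not> 3 dvd (z + 3 * \<mu> + 11) - (z + 4)" "\<not> 3 dvd (z + 4) - (z + 2)"
    by presburger+
  then have "set (map g ?xs) \<inter> set (map g ?ys) = {} \<and> set (map g ?xs) \<inter> set (map g ?zs) = {} \<and>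
      set (map g ?xs) \<inter> set (map g ?ws) = {} \<and> set (map g ?ys) \<inter> set (map g ?zs) = {} \<and>
      set (map g ?zs) \<inter> set (map g ?ws) = {}"
    using tracks_disjoint[OF q down_dvd up_dvd] tracks_disjoint[OF q down_dvd down_dvd]
      tracks_disjoint[OF q down_dvd ws] tracks_disjoint[OF q up_dvd down_dvd] by blast
  moreover have "set (map g ?ys) \<inter> set (map g ?ws) = {}"
  proof -
    have "g (z + 3 * \<mu> + 11 + 3 * t) \<noteq> g (z + 2)" "g (z + 3 * \<mu> + 11 + 3 * t) \<noteq> g (z + 5)"
      if "0 \<le> t" "t < int b" for t
    proof -
      have ne: "g u \<noteq> g v" if "0 < u - v" "u - v < 2 * int L" for u v
        using small_dvd[of "u - v"] that unfolding g_eq_iff by auto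
      have "2 * int L = 6 * int q"
        using q by simp
      then show "g (z + 3 * \<mu> + 11 + 3 * t) \<noteq> g (z + 2)" "g (z + 3 * \<mu> + 11 + 3 * t) \<noteq> g (z + 5)"
        using ne[of "z + 3 * \<mu> + 11 + 3 * t" "z + 2"] ne[of "z + 3 * \<mu> + 11 + 3 * t" "z + 5"] that \<mu>(2) b(1)
        by linarith+
    qed
    then have "g u \<noteq> g (z + 2) \<and> g u \<noteq> g (z + 5)" if "u \<in> set ?ys" for u
      using up_E[OF that] by blast
    then have "g (z + 2) \<notin> set (map g ?ys)" "g (z + 5) \<notin> set (map g ?ys)"
      unfolding set_map by (metis imageE)+
    then show ?thesis
      by simp
  qed
  moreover have "g (z + 2) \<noteq> g (z + 5)"
    using small_dvd[of "(z + 2) - (z + 5)"] L6 unfolding g_eq_iff by linarith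
  ultimately have d: "distinct (map g (?xs @ ?ys @ ?zs @ ?ws))"
    using track_distinct_up[OF _ q, of a] track_distinct_up[OF _ q, of b] track_distinct_up[OF _ q, of "2 * q"] a b \<mu>(2)
    by (simp add: Int_Un_distrib)
  have "bb (last ?xs) (z + 3 * \<mu> + 11)"
    using fs(2) lx by (simp add: jump_def algebra_simps)
  moreover have "bb (last ?ys) (z + 4)"
    using fs(3) ly by (simp add: jump_def add.commute)
  moreover have "bb (last ?zs) (z + 2)"
    using bb_sym[OF fs(4)[unfolded jump_def]] lz by (simp add: algebra_simps)
  moreover have "bb (z + 2) (z + 5)"
    using step3[of "z + 2"] by (simp add: algebra_simps)
  ultimately have "bb (last ?xs) (hd ?ys)" "bb (last ?ys) (hd ?zs)" "bb (last ?zs) (hd ?ws)" "successively bb ?ws"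
    using b L6 q by (simp_all del: last_up last_down)
  moreover have "?ys \<noteq> []" "?zs \<noteq> []"
    using b L6 q by auto
  ultimately have s: "successively bb (?xs @ ?ys @ ?zs @ ?ws)"
    unfolding successively_append_iff using up_blue down_blue by (simp only: hd_append2) simp
  have "bb (last (?xs @ ?ys @ ?zs @ ?ws)) (hd (?xs @ ?ys @ ?zs @ ?ws))"
    using bb_sym[OF fs(1)[unfolded jump_def]] a by (simp add: hd_append)
  moreover have "length (?xs @ ?ys @ ?zs @ ?ws) = 2 * m"
    using a b \<mu> len by simp
  ultimately show ?thesis
    using blue_cycle[OF d s, of m] \<mu> len by simp
qed

text \<open>Up to \<open>m = 2 q\<close> two tracks suffice. Beyond that, with \<open>\<mu> = L - 1 - m\<close>, two blue chords at a suitable distance are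
fixed. Every blue chord that completes them as in \<open>three_tracks\<close> finishes the proof; so all those chords are red,
and \<open>jump_or_2\<close> then makes the four chords needed for \<open>merge_tracks\<close> blue.\<close>

lemma descent_3:
  assumes "3 dvd L" "5 \<le> m" "m \<le> L - 1"
  shows "has_cyc Bl (2 * m)"
proof -
  obtain q where q: "L = 3 * q"
    using assms(1) by blast
  have q2: "2 \<le> q"
    using L6 q by simp
  show ?thesis
  proof (cases "m \<le> 2 * q")
    case True
    obtain i where "jump i" "jump (i + 3 * (int m - 1))"
      using two_jumps by blast
    then show ?thesis
      using two_tracks[OF q _ True] assms by auto
  next
    case False
    define \<mu> where "\<mu> = 3 * int q - 1 - int m"
    define d where "d = nat (int q - \<mu> - 2)"
    have \<mu>: "int q = \<mu> + 2 + int d" "0 \<le> \<mu>"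
      using False assms q by (auto simp: \<mu>_def d_def)
    have len: "m + nat \<mu> + 1 = 3 * q"
      using \<mu> by (simp add: \<mu>_def)
    have per: "g (w + 6 * int q) = g w" for w
      by (rule g_cong) (simp add: q)
    show ?thesis
    proof (rule ccontr)
      assume no: "\<not> has_cyc Bl (2 * m)"
      show False
      proof (cases "\<mu> = 0")
        case True
        obtain z where z: "jump z" "jump (z + 2)"
          using two_jumps by blast
        have y: "\<not> jump (z + 4 - 3 * j)" if j: "0 \<le> j" "j \<le> 2" for j
        proof
          assume fy: "jump (z + 4 - 3 * j)"
          have "has_cyc Bl (2 * m)"
          proof (rule three_tracks[OF q, of "up (z + 5) (2 * q)" z "2 * q" "z + 2" "2 * q - nat j" "z + 4 - 3 * j" "2 * q - 2 + nat j"])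
            show "g (last (up (z + 5) (2 * q))) = g (z + 2)"
              using per[of "z + 2"] q2 by (simp add: algebra_simps)
            show "g (z + 2 + 5 + 3 * (int (2 * q - nat j) - 1)) = g (z + 4 - 3 * j)"
              using per[of "z + 4 - 3 * j"] q2 j by (simp add: algebra_simps of_nat_diff)
            show "g (z + 4 - 3 * j + 5 + 3 * (int (2 * q - 2 + nat j) - 1)) = g z"
              using per[of z] q2 j by (simp add: algebra_simps of_nat_diff)
          qed (use z fy q2 j True len in \<open>auto simp: algebra_simps\<close>)
          then show False
            using no by blast
        qed
        have "jump (z + 6)" "jump (z - 1)"
          using y[of 0] y[of 1] jump_or_2[of "z + 4"] jump_or_2[of "z - 1"] by (auto simp: algebra_simps)
        then show False
          using merge_tracks[OF q \<mu> len z(1) _ _ z(2)] True no by simp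
      next
        case False
        then have \<mu>1: "1 \<le> \<mu>"
          using \<mu> by simp
        obtain z where z: "jump z" "jump (z + (5 + 3 * \<mu>))"
          using two_jumps by blast
        have y: "\<not> jump (z + 7 + 3 * \<mu> - 3 * j)" if j: "0 \<le> j" "j \<le> \<mu> + 3" for j
        proof
          assume fy: "jump (z + 7 + 3 * \<mu> - 3 * j)"
          have "has_cyc Bl (2 * m)"
          proof (rule three_tracks[OF q, of "down (z + 5) (nat (2 * int q - \<mu> + 1))" z "nat (2 * int q - \<mu> + 1)"
                "z + (5 + 3 * \<mu>)" "nat (2 * int q - j)" "z + 7 + 3 * \<mu> - 3 * j" "nat (2 * int q - 3 - \<mu> + j)"])
            show "g (last (down (z + 5) (nat (2 * int q - \<mu> + 1)))) = g (z + (5 + 3 * \<mu>))"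
              using per[of "z + 5 - 3 * (2 * int q - \<mu>)"] \<mu> by (simp add: algebra_simps)
            show "g (z + (5 + 3 * \<mu>) + 5 + 3 * (int (nat (2 * int q - j)) - 1)) = g (z + 7 + 3 * \<mu> - 3 * j)"
              using per[of "z + 7 + 3 * \<mu> - 3 * j"] \<mu> j by (simp add: algebra_simps)
            show "g (z + 7 + 3 * \<mu> - 3 * j + 5 + 3 * (int (nat (2 * int q - 3 - \<mu> + j)) - 1)) = g z"
              using per[of z] \<mu> j by (simp add: algebra_simps)
          qed (use z fy \<mu> \<mu>1 j len in \<open>auto simp: algebra_simps\<close>)
          then show False
            using no by blast
        qed
        have "\<not> jump (z + 4 + 3 * \<mu>)" "\<not> jump (z + 1)" "\<not> jump (z + 4)"
          using y[of 1] y[of "\<mu> + 2"] y[of "\<mu> + 1"] \<mu> by (simp_all add: algebra_simps)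
        then have "jump (z + 3 * \<mu> + 6)" "jump (z - 1)" "jump (z + 2)"
          using jump_or_2[of "z + 4 + 3 * \<mu>"] jump_or_2[of "z - 1"] jump_or_2[of "z + 2"] by (simp_all add: algebra_simps)
        then show False
          using merge_tracks[OF q \<mu> len z(1)] no by simp
      qed
    qed
  qed
qed

theorem descent:
  assumes "5 \<le> m" "m \<le> L - 1"
  shows "has_cyc Bl (2 * m)"
  using descent_3 descent_not3 assms by blast

end

text \<open>A red cycle of length at least \<open>2 n\<close> without one of length exactly \<open>2 n\<close>: the shortest red cycle longer than
\<open>2 n\<close> satisfies the assumptions of \<open>descent\<close>.\<close>

lemma skipped_length:
  assumes bic: "bicol A B R" and xs: "cyc R xs" "2 * n \<le> length xs" and no: "\<not> has_cyc R (2 * n)" and m: "5 \<le> m" "m \<le> n"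
  shows "has_cyc (other A B R) (2 * m)"
proof -
  interpret b: bicol A B R
    by (rule bic)
  have ex: "\<exists>L. n < L \<and> has_cyc R (2 * L)"
  proof -
    obtain L where L: "length xs = 2 * L"
      using b.cyc_even[OF xs(1)] by (elim evenE)
    then have "has_cyc R (2 * L)" "n \<le> L"
      using xs by (auto simp: has_cyc_def)
    then show ?thesis
      using no by (intro exI[of _ L]) (auto simp: le_less)
  qed
  \<comment> \<open>\<open>L\<close> is least, so the next shorter even length is \<open>2 n\<close> or does not occur.\<close>
  define L where "L = (LEAST L. n < L \<and> has_cyc R (2 * L))"
  have L: "n < L" "has_cyc R (2 * L)"
    using LeastI_ex[OF ex] unfolding L_def by blast+
  have min: "\<not> (n < k \<and> has_cyc R (2 * k))" if "k < L" for k
    using not_less_Least that unfolding L_def by blast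
  obtain K where K: "cyc R K" "length K = 2 * L"
    using L(2) by (auto simp: has_cyc_def)
  have "\<not> has_cyc R (2 * (L - 1))"
    using min[of "L - 1"] L(1) no by (cases "L - 1 = n") auto
  moreover have "2 * (L - 1) = 2 * L - 2"
    by simp
  ultimately have "\<not> has_cyc R (2 * L - 2)"
    by metis
  then interpret shortcut_free A B R K L
    by unfold_locales (use K L m in auto)
  show ?thesis
    by (rule descent) (use m L in auto)
qed

section \<open>A longest red cycle\<close>

text \<open>The vertices outside the longest red cycle \<open>K\<close> number \<open>M\<close> on each side. Two lengths of blue cycles are excluded,
in one of two regimes: either they coincide and \<open>K\<close> is at least as long, or \<open>K\<close> is slightly shorter than both and
\<open>M\<close> exceeds \<open>c\<close> by two. In the second regime \<open>\<tau>\<close> is the first length that is longer than \<open>K\<close>.\<close>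

locale longest = bicol A B R for A B :: "'v set" and R +
  fixes K :: "'v list" and c M \<tau> :: nat
  assumes K: "cyc R K" and lenK: "length K = 2 * c"
    and longest: "cyc R xs \<Longrightarrow> length xs \<le> 2 * c"
    and cardA: "card A = c + M" and cardB: "card B = c + M"
    and c3: "3 \<le> c" and M5: "5 \<le> M"
    and no_blue_\<tau>: "\<not> has_cyc Bl (2 * \<tau>)" and no_blue_M: "\<not> has_cyc Bl (2 * M)"
    and regime: "\<tau> = M \<and> M \<le> c \<or> M = \<tau> + 1 \<and> M = c + 2"

lemma longest_flip: "longest A B R K c M \<tau> \<Longrightarrow> longest B A R K c M \<tau>"
  unfolding longest_def longest_axioms_def using bicol_flip by (auto simp: other_flip)

context longest
begin

text \<open>The cyclic orders of \<open>K\<close>: rotations of \<open>K\<close> let any vertex or any pair of consecutive vertices come first.\<close>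

definition isK :: "'v list \<Rightarrow> bool" where
  "isK xs \<longleftrightarrow> cyc R xs \<and> set xs = set K"

lemma isK_K: "isK K"
  using K by (simp add: isK_def)

lemma isK_length: "isK xs \<Longrightarrow> length xs = 2 * c"
  using K lenK unfolding isK_def cyc_def by (metis distinct_card)

lemma isK_rotate: "isK (xs @ ys) \<Longrightarrow> isK (ys @ xs)"
  using cyc_swap by (auto simp: isK_def)

lemma isK_rotate1: "isK (x # xs) \<Longrightarrow> isK (xs @ [x])"
  using isK_rotate[of "[x]" xs] by simp

lemma isK_drop: "isK (x # y # xs) \<Longrightarrow> isK (y # xs @ [x])"
  using isK_rotate1[of x "y # xs"] by simp

lemma isK_at: "x \<in> set K \<Longrightarrow> \<exists>xs. isK (x # xs)"
  by (metis append_Cons isK_K isK_rotate split_list)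

lemma isK_before: "x \<in> set K \<Longrightarrow> \<exists>xs. isK (xs @ [x])"
  using isK_at isK_rotate1 by blast

lemma isK_two: "x \<in> set K \<Longrightarrow> y \<in> set K \<Longrightarrow> x \<noteq> y \<Longrightarrow> \<exists>xs ys. isK (x # xs @ y # ys)"
proof -
  assume a: "x \<in> set K" "y \<in> set K" "x \<noteq> y"
  obtain zs where zs: "isK (x # zs)"
    using isK_at a by blast
  then have "y \<in> set zs"
    using a by (auto simp: isK_def)
  then show ?thesis
    using zs by (metis split_list)
qed

lemma isK_set: "isK xs \<Longrightarrow> set xs = set K"
  by (simp add: isK_def)

lemma isK_dist: "isK xs \<Longrightarrow> distinct xs"
  by (simp add: isK_def cyc_def)

lemma isK_adj: "isK (x # y # ys) \<Longrightarrow> R x y"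
  using cyc_adjacent[of R "[]"] by (auto simp: isK_def)

lemma K_sub: "set K \<subseteq> A \<union> B" and K_A: "card (set K \<inter> A) = c" and K_B: "card (set K \<inter> B) = c"
  using cyc_counts[OF K lenK] by auto

lemma out_A: "card (A - set K) = M" and out_B: "card (B - set K) = M"
  using K_A K_B cardA cardB finA finB card_Diff_subset_Int[of A "set K"] card_Diff_subset_Int[of B "set K"]
  by (auto simp: Int_commute)

lemma longest_has: "has_cyc R (2 * k) \<Longrightarrow> k \<le> c"
  unfolding has_cyc_def by (metis longest nat_mult_le_cancel1 zero_less_numeral)

text \<open>Replacing an arc of \<open>K\<close> by an outside path cannot lengthen \<open>K\<close>.\<close>

lemma detour:
  assumes "isK (x # xs @ y # ys)" "path R ws" "set ws \<inter> set K = {}" "R x (hd ws)" "R (last ws) y"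
  shows "length ws \<le> length xs"
proof -
  have c: "cyc R ((x # xs) @ (y # ys))"
    using assms by (simp add: isK_def)
  have p: "path R (y # ys)" "R (last (y # ys)) x"
    using cyc_split[OF c] by auto
  have s: "set (x # xs @ y # ys) = set K"
    using assms(1) by (rule isK_set)
  have "path R (x # ws)"
    using assms s by (intro path_Cons) auto
  then have "cyc R ((x # ws) @ (y # ys))"
    using p assms s c by (intro cyc_join) (auto simp: path_def cyc_def Suc_le_eq)
  then have "length ((x # ws) @ (y # ys)) \<le> 2 * c"
    by (rule longest)
  then show ?thesis
    using isK_length[OF assms(1)] by simp
qed

text \<open>The cycle \<open>p0, f, p2\<close>, back along \<open>K\<close> to \<open>p1\<close>, then \<open>h, p3\<close> and on along \<open>K\<close> would contain both \<open>f\<close> and \<open>h\<close>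
in addition to all of \<open>K\<close>.\<close>

lemma crossing:
  assumes "isK (p0 # p1 # xs @ p2 # p3 # ys)" "f \<notin> set K" "h \<notin> set K" "f \<noteq> h"
    and "R f p0" "R f p2" "R h p1" "R h p3"
  shows False
proof -
  have c: "cyc R ((p0 # p1 # xs) @ (p2 # p3 # ys))" "cyc R ((p1 # xs @ [p2]) @ (p3 # ys @ [p0]))"
    using assms isK_rotate1[OF assms(1)] by (simp_all add: isK_def)
  have s: "set (p0 # p1 # xs @ p2 # p3 # ys) = set K"
    using assms(1) by (rule isK_set)
  have d: "distinct (p0 # p1 # xs @ p2 # p3 # ys)"
    using assms(1) by (rule isK_dist)
  have n: "p0 # p1 # xs \<noteq> []" "p2 # p3 # ys \<noteq> []"
    by auto
  have p: "path R (p1 # xs)" "R (last (p1 # xs)) p2" "path R (p3 # ys)" "R (last (p3 # ys)) p0"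
    using cyc_split[OF c(1) n] by (auto simp: path_def successively_Cons)
  have f: "R p0 f" "R p1 h" "R p2 (last (p1 # xs))"
    using R_sym assms p by blast+
  have "path R [p0, f, p2]"
    using assms(2-5) assms(6) f d s by (auto simp: path_def)
  moreover have "path R (rev (p1 # xs))"
    using path_rev[OF p(1) symp_R] .
  moreover have "R (last [p0, f, p2]) (hd (rev (p1 # xs)))"
    using f(3) by (simp only: hd_rev) simp
  moreover have "set [p0, f, p2] \<inter> set (rev (p1 # xs)) = {}"
    using d s assms(2) by auto
  ultimately have "path R ([p0, f, p2] @ rev (p1 # xs))"
    using path_append by blast
  then have "path R (([p0, f, p2] @ rev (p1 # xs)) @ [h])"
    by (rule path_append) (use f(2) s assms(2-4) in auto)
  then have "cyc R ((([p0, f, p2] @ rev (p1 # xs)) @ [h]) @ (p3 # ys))"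
    by (rule cyc_join) (use p(3,4) d s assms(2-4,8) in auto)
  then have "length ((([p0, f, p2] @ rev (p1 # xs)) @ [h]) @ (p3 # ys)) \<le> 2 * c"
    by (rule longest)
  then show False
    using isK_length[OF assms(1)] by simp
qed

end

section \<open>A red component outside the longest cycle\<close>

text \<open>\<open>U\<close> is a red component of the graph outside \<open>K\<close>; connectedness is recorded in the form in which it is used, by
paths inside \<open>U\<close>.\<close>

locale component = longest A B R K c M \<tau> for A B :: "'v set" and R K c M \<tau> +
  fixes U :: "'v set"
  assumes U_sub: "U \<subseteq> A \<union> B - set K"
    and U_closed: "u \<in> U \<Longrightarrow> R u v \<Longrightarrow> v \<notin> set K \<Longrightarrow> v \<in> U"
    and U_conn: "u \<in> U \<Longrightarrow> w \<in> U \<Longrightarrow> \<exists>ws. path R ws \<and> hd ws = u \<and> last ws = w \<and> set ws \<subseteq> U"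
    and U_card: "M \<le> card U"

lemma component_flip: "component A B R K c M \<tau> U \<Longrightarrow> component B A R K c M \<tau> U"
  unfolding component_def component_axioms_def using longest_flip by (auto simp: Un_commute)

context component
begin

text \<open>The vertices where \<open>K\<close> is attached to \<open>U\<close>. A red neighbour in \<open>U\<close> of such a vertex is called a foot of it.\<close>

definition T :: "'v set" where
  "T = {z \<in> set K. \<exists>u\<in>U. R z u}"

text \<open>\<open>P\<close> and \<open>Q\<close> are the sides of \<open>U\<close>, while \<open>P'\<close> and \<open>Q'\<close> collect the outside vertices beyond \<open>U\<close>. \<open>FA\<close> and \<open>FB\<close> are the
free vertices of \<open>K\<close>, those without a foot. All edges from \<open>P\<close> to \<open>GB\<close> and from \<open>Q\<close> to \<open>GA\<close> are blue; these are the
two blue blocks.\<close>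

abbreviation "P \<equiv> U \<inter> A"
abbreviation "Q \<equiv> U \<inter> B"
abbreviation "P' \<equiv> A - set K - U"
abbreviation "Q' \<equiv> B - set K - U"
abbreviation "FA \<equiv> (set K - T) \<inter> A"
abbreviation "FB \<equiv> (set K - T) \<inter> B"
abbreviation "GA \<equiv> FA \<union> P'"
abbreviation "GB \<equiv> FB \<union> Q'"

lemma flip: "component B A R K c M \<tau> U"
  using component_flip component_axioms by blast

lemma finU: "finite U"
  using U_sub finA finB by (meson finite_Diff finite_Un finite_subset)

lemma finite_parts: "finite P" "finite Q" "finite P'" "finite Q'" "finite FA" "finite FB" "finite GA" "finite GB"
  using finA finB by auto

lemma T_sub: "T \<subseteq> set K"
  by (auto simp: T_def)

lemma card_PQ: "card P + card P' = M" "card Q + card Q' = M" "card P + card Q = card U"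
proof -
  have "A - set K = P \<union> P'" "B - set K = Q \<union> Q'" "U = P \<union> Q"
    using U_sub by auto
  moreover have "P \<inter> P' = {}" "Q \<inter> Q' = {}" "P \<inter> Q = {}"
    using disj by auto
  ultimately show "card P + card P' = M" "card Q + card Q' = M" "card P + card Q = card U"
    using out_A out_B finite_parts card_Un_disjoint[of P P'] card_Un_disjoint[of Q Q'] card_Un_disjoint[of P Q]
    by simp_all
qed

lemma card_G: "card GA = card FA + card P'" "card GB = card FB + card Q'"
  by (rule card_Un_disjoint; use finite_parts in auto)+

lemma card_T: "card (T \<inter> A) + card FA = c" "card (T \<inter> B) + card FB = c"
proof -
  have e: "set K \<inter> A = (T \<inter> A) \<union> FA" "set K \<inter> B = (T \<inter> B) \<union> FB"
    using T_sub by auto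
  have "card ((T \<inter> A) \<union> FA) = card (T \<inter> A) + card FA" "card ((T \<inter> B) \<union> FB) = card (T \<inter> B) + card FB"
    by (rule card_Un_disjoint; use finA finB in auto)+
  then show "card (T \<inter> A) + card FA = c" "card (T \<inter> B) + card FB = c"
    using K_A K_B e by simp_all
qed

lemma P_GB: "complete Bl P GB" and Q_GA: "complete Bl Q GA"
proof -
  have nP: "\<not> R x y" if "x \<in> P" "y \<in> GB" for x y
    using that U_closed[of x y] R_sym[of x y] by (auto simp: T_def)
  show "complete Bl P GB"
  proof -
    have "Bl x y" if "x \<in> P" "y \<in> GB" for x y
      using nP[OF that] that K_sub by (auto simp: other_def opposite_def)
    then show ?thesis
      unfolding complete_def using Bl_sym by blast
  qed
  have nQ: "\<not> R x y" if "x \<in> Q" "y \<in> GA" for x y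
    using that U_closed[of x y] R_sym[of x y] by (auto simp: T_def)
  show "complete Bl Q GA"
  proof -
    have "Bl x y" if "x \<in> Q" "y \<in> GA" for x y
      using nQ[OF that] that K_sub by (auto simp: other_def opposite_def)
    then show ?thesis
      unfolding complete_def using Bl_sym by blast
  qed
qed

text \<open>\<open>U\<close> has more than one vertex and is connected.\<close>

lemma U_nbr: "x \<in> U \<Longrightarrow> \<exists>y\<in>U. R x y"
proof -
  assume x: "x \<in> U"
  have "card (U - {x}) \<noteq> 0"
    using x U_card M5 finU by simp
  then obtain w where w: "w \<in> U" "w \<noteq> x"
    by (metis DiffE card.empty equals0I singletonI)
  then obtain ws where ws: "path R ws" "hd ws = x" "last ws = w" "set ws \<subseteq> U"
    using U_conn x by blast
  then obtain y zs where "ws = x # y # zs"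
    using w by (cases ws; cases "tl ws") (auto simp: path_def)
  then show ?thesis
    using ws by (auto simp: path_def)
qed

lemma P_nbr: "x \<in> P \<Longrightarrow> \<exists>y\<in>Q. R x y"
  using U_nbr side_cases by blast

lemma Q_nbr: "x \<in> Q \<Longrightarrow> \<exists>y\<in>P. R x y"
  using U_nbr side_cases by blast

lemma PQ_ne: "1 \<le> card P" "1 \<le> card Q"
proof -
  obtain x where "x \<in> U"
    using U_card M5 by fastforce
  then obtain y where "R x y" "x \<in> U" "y \<in> U"
    using U_nbr by blast
  then have "P \<noteq> {}" "Q \<noteq> {}"
    using R_bip[of x y] by (auto simp: opposite_def)
  then show "1 \<le> card P" "1 \<le> card Q"
    using finite_parts by (simp_all add: Suc_le_eq card_gt_0_iff)
qed

lemma foot_P: "z \<in> B \<Longrightarrow> u \<in> U \<Longrightarrow> R z u \<Longrightarrow> u \<in> P"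
  using side_cases by blast

lemma foot_Q: "z \<in> A \<Longrightarrow> u \<in> U \<Longrightarrow> R z u \<Longrightarrow> u \<in> Q"
  using side_cases by blast

text \<open>A path inside \<open>U\<close> between the feet of two consecutive vertices could be inserted between them.\<close>

lemma T_adj: "isK (x # y # ys) \<Longrightarrow> x \<in> T \<Longrightarrow> y \<notin> T"
proof
  assume a: "isK (x # y # ys)" "x \<in> T" "y \<in> T"
  obtain u w where uw: "u \<in> U" "R x u" "w \<in> U" "R y w"
    using a by (auto simp: T_def)
  obtain ws where ws: "path R ws" "hd ws = u" "last ws = w" "set ws \<subseteq> U"
    using U_conn uw by blast
  have "length ws \<le> length ([] :: 'v list)"
    by (rule detour[of x "[]" y ys]) (use a ws uw R_sym U_sub in auto)
  then show False
    using ws by (auto simp: path_def)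
qed

text \<open>Two vertices of \<open>K\<close> at distance two leave room for a single vertex only, so all their feet coincide.\<close>

lemma T_near: "isK (x # y # z # ys) \<Longrightarrow> u \<in> U \<Longrightarrow> R x u \<Longrightarrow> w \<in> U \<Longrightarrow> R z w \<Longrightarrow> u = w"
proof (rule ccontr)
  assume a: "isK (x # y # z # ys)" "u \<in> U" "R x u" "w \<in> U" "R z w" "u \<noteq> w"
  obtain ws where ws: "path R ws" "hd ws = u" "last ws = w" "set ws \<subseteq> U"
    using U_conn a by blast
  have "length ws \<le> length [y]"
    by (rule detour[of x "[y]" z ys]) (use a ws R_sym U_sub in auto)
  then have "ws = [hd ws]"
    using ws by (cases ws) (auto simp: path_def)
  then show False
    using ws a by (metis last.simps)
qed

lemma FB_next: "isK (x # y # ys) \<Longrightarrow> x \<in> T \<Longrightarrow> x \<in> A \<Longrightarrow> y \<in> FB"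
  using T_adj[of x y ys] isK_adj[of x y ys] side_cases isK_set[of "x # y # ys"] by auto

lemma FA_next: "isK (x # y # ys) \<Longrightarrow> x \<in> T \<Longrightarrow> x \<in> B \<Longrightarrow> y \<in> FA"
  using T_adj[of x y ys] isK_adj[of x y ys] side_cases isK_set[of "x # y # ys"] by auto

text \<open>The common foot of \<open>x\<close> and \<open>z\<close> and one of \<open>a\<close>, \<open>b\<close>, whichever lies on the other side, give a forbidden crossing.\<close>

lemma no_gap_two:
  assumes k: "isK (x # y # z # t # ys)" and T: "x \<in> T" "z \<in> T" and ab: "a \<in> P'" "b \<in> Q'"
    and ra: "\<And>s. s \<in> FB \<Longrightarrow> s \<in> {y, t} \<Longrightarrow> R a s" and rb: "\<And>s. s \<in> FA \<Longrightarrow> s \<in> {y, t} \<Longrightarrow> R b s"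
  shows False
proof -
  have k2: "isK (z # t # ys @ [x, y])"
    using isK_rotate[of "[x, y]" "z # t # ys"] k by simp
  obtain u u' where u: "u \<in> U" "R x u" "u' \<in> U" "R z u'"
    using T by (auto simp: T_def)
  then have "u = u'"
    using T_near[OF k] by blast
  note u = u[folded this]
  have uK: "u \<notin> set K" "u \<noteq> a" "u \<noteq> b" and rf: "R u x" "R u z"
    using u U_sub ab R_sym[of x u] R_sym[of z u] by blast+
  show False
  proof (cases "x \<in> A")
    case True
    then have "z \<in> A"
      using side_cases u R_sym[OF u(4)] by blast
    then have "R a y" "R a t"
      using FB_next[OF k T(1) True] FB_next[OF k2 T(2)] ra by blast+
    then show False
      using crossing[of x y "[]" z t ys u a] k uK ab rf by auto
  next
    case False
    then have x: "x \<in> B"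
      using R_bip[OF u(2)] unfolding opposite_def by blast
    then have "z \<in> B"
      using side_cases u R_sym[OF u(4)] by blast
    then have "R b y" "R b t"
      using FA_next[OF k T(1) x] FA_next[OF k2 T(2)] rb by blast+
    then show False
      using crossing[of x y "[]" z t ys u b] k uK ab rf by auto
  qed
qed

text \<open>The exceptional vertex \<open>w\<close> is placed last, and there is room since \<open>K\<close> has at least six vertices.\<close>

lemma window: "\<exists>p0 p1 p2 p3 p4 ys. isK (p0 # p1 # p2 # p3 # p4 # ys) \<and> w \<notin> {p0, p1, p2, p3, p4}"
proof -
  have "\<exists>xs. isK xs \<and> (\<exists>ys zs. xs = ys @ zs \<and> 5 \<le> length ys \<and> w \<notin> set ys)"
  proof (cases "w \<in> set K")
    case True
    then obtain xs where xs: "isK (xs @ [w])"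
      using isK_before by blast
    then show ?thesis
      using isK_length[OF xs] isK_dist[OF xs] c3 by (intro exI[of _ "xs @ [w]"] conjI exI[of _ xs] exI[of _ "[w]"]) auto
  next
    case False
    then show ?thesis
      using isK_K isK_length[OF isK_K] c3 by (intro exI[of _ K] conjI exI[of _ K] exI[of _ "[]"]) auto
  qed
  then obtain ys zs where y: "isK (ys @ zs)" "5 \<le> length ys" "w \<notin> set ys"
    by blast
  obtain p0 p1 p2 p3 p4 rs where "ys = p0 # p1 # p2 # p3 # p4 # rs"
    using y(2) by (auto simp: numeral_eq_Suc Suc_le_length_iff)
  then show ?thesis
    using y by (intro exI[of _ p0] exI[of _ p1] exI[of _ p2] exI[of _ p3] exI[of _ p4] exI[of _ "rs @ zs"]) auto
qed

lemma windowA: "\<exists>p0 p1 p2 p3 ys. isK (p0 # p1 # p2 # p3 # ys) \<and> w \<notin> {p0, p1, p2, p3} \<and> p0 \<in> A \<and> p1 \<in> B \<and> p2 \<in> A \<and> p3 \<in> B"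
proof -
  obtain p0 p1 p2 p3 p4 ys where k: "isK (p0 # p1 # p2 # p3 # p4 # ys)" "w \<notin> {p0, p1, p2, p3, p4}"
    using window[of w] by blast
  have k1: "isK (p1 # p2 # p3 # p4 # (ys @ [p0]))"
    using isK_rotate1[OF k(1)] by simp
  have k2: "isK (p2 # p3 # p4 # (ys @ [p0, p1]))"
    using isK_rotate1[OF k1] by simp
  have k3: "isK (p3 # p4 # (ys @ [p0, p1, p2]))"
    using isK_rotate1[OF k2] by simp
  have r: "R p0 p1" "R p1 p2" "R p2 p3" "R p3 p4"
    using isK_adj[OF k(1)] isK_adj[OF k1] isK_adj[OF k2] isK_adj[OF k3] .
  show ?thesis
  proof (cases "p0 \<in> A")
    case True
    then have "p1 \<in> B" "p2 \<in> A" "p3 \<in> B"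
      using r side_cases by blast+
    then show ?thesis
      using k True by blast
  next
    case False
    then have "p1 \<in> A"
      using R_bip[OF r(1)] unfolding opposite_def by blast
    moreover from this have "p2 \<in> B" "p3 \<in> A" "p4 \<in> B"
      using r side_cases by blast+
    ultimately show ?thesis
      using k1 k(2) by blast
  qed
qed

lemma windowB: "\<exists>p0 p1 p2 p3 ys. isK (p0 # p1 # p2 # p3 # ys) \<and> w \<notin> {p0, p1, p2, p3} \<and> p0 \<in> B \<and> p1 \<in> A \<and> p2 \<in> B \<and> p3 \<in> A"
proof -
  interpret f: component B A R K c M \<tau> U
    by (rule flip)
  show ?thesis
    using f.windowA .
qed

text \<open>A red edge \<open>ab\<close> outside \<open>K\<close> and \<open>U\<close> whose ends are red to all free vertices but one: two consecutive free vertices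
would let \<open>ab\<close> be inserted into \<open>K\<close>. Hence free vertices and vertices of \<open>T\<close> alternate, against \<open>no_gap_two\<close>.\<close>

lemma no_insertion:
  assumes ab: "a \<in> P'" "b \<in> Q'" "R a b"
    and a: "\<And>z. z \<in> FB \<Longrightarrow> z \<noteq> w \<Longrightarrow> R a z" and b: "\<And>z. z \<in> FA \<Longrightarrow> z \<noteq> w \<Longrightarrow> R b z"
  shows False
proof -
  \<comment> \<open>Two consecutive free vertices: \<open>ab\<close> fits between them.\<close>
  have ins: False if k: "isK (x # y # ys)" and F: "x \<notin> T" "y \<notin> T" "x \<noteq> w" "y \<noteq> w" for x y ys
  proof -
    have xy: "x \<in> set K" "y \<in> set K"
      using isK_set[OF k] by auto
    have r: "R x y"
      using isK_adj k by blast
    consider "x \<in> A" "y \<in> B" | "x \<in> B" "y \<in> A"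
      using r R_bip[OF r] by (auto simp: opposite_def)
    then show False
    proof cases
      case 1
      have "length [b, a] \<le> length ([] :: 'v list)"
        by (rule detour[of x "[]" y ys])
          (use k ab xy 1 F a[of y] b[of x] R_sym[OF ab(3)] R_sym[of b x] disj in \<open>auto simp: path_def\<close>)
      then show False
        by simp
    next
      case 2
      have "length [a, b] \<le> length ([] :: 'v list)"
        by (rule detour[of x "[]" y ys])
          (use k ab xy 2 F a[of x] b[of y] R_sym[of a x] disj in \<open>auto simp: path_def\<close>)
      then show False
        by simp
    qed
  qed
  \<comment> \<open>So \<open>T\<close> recurs after two steps.\<close>
  have alt: False if k: "isK (x # y # z # v # ys)" and F: "x \<in> T" "y \<noteq> w" "z \<noteq> w" "v \<noteq> w" for x y z v ys
  proof -
    have y: "y \<notin> T"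
      using T_adj k F by blast
    have k2: "isK (y # z # (v # ys @ [x]))"
      using isK_rotate1[OF k] by simp
    have z: "z \<in> T"
      using ins[OF k2] y F by blast
    show False
      by (rule no_gap_two[OF k F(1) z ab(1,2)]) (use a b F in blast)+
  qed
  obtain p0 p1 p2 p3 p4 ys where k: "isK (p0 # p1 # p2 # p3 # p4 # ys)" and w: "w \<notin> {p0, p1, p2, p3, p4}"
    using window[of w] by blast
  have k2: "isK (p1 # p2 # p3 # p4 # (ys @ [p0]))"
    using isK_rotate1[OF k] by simp
  show False
    using alt[OF k] alt[OF k2] ins[OF k] w by blast
qed

lemma T_adj': "isK (us @ x # y # vs) \<Longrightarrow> \<not> (x \<in> T \<and> y \<in> T)"
  using isK_rotate[of us "x # y # vs"] T_adj[of x y "vs @ us"] by auto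

lemma card_F: "card FA + card FB + length (filter (\<lambda>x. x \<in> T) xs) = 2 * c" if "isK xs" for xs
proof -
  have "T \<inter> A \<union> T \<inter> B = set (filter (\<lambda>x. x \<in> T) xs)"
    using T_sub isK_set[OF that] K_sub by auto
  moreover have "card (T \<inter> A \<union> T \<inter> B) = card (T \<inter> A) + card (T \<inter> B)"
    by (rule card_Un_disjoint) (use finA finB disj in auto)
  moreover have "card (set (filter (\<lambda>x. x \<in> T) xs)) = length (filter (\<lambda>x. x \<in> T) xs)"
    using isK_dist[OF that] by (intro distinct_card) simp
  ultimately have "length (filter (\<lambda>x. x \<in> T) xs) = card (T \<inter> A) + card (T \<inter> B)"
    by metis
  then show ?thesis
    using card_T by linarith
qed

lemma T_half:
  assumes "isK (us @ xs)"
  shows "length (filter (\<lambda>x. x \<in> T) xs) \<le> (length xs + 1) div 2"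
proof (rule filter_length_half, rule successivelyI_split)
  fix ps x y qs
  assume "xs = ps @ x # y # qs"
  then show "\<not> (x \<in> T \<and> y \<in> T)"
    using T_adj'[of "us @ ps" x y qs] assms by simp
qed

text \<open>By \<open>T_adj\<close>, at least one of any two consecutive vertices of \<open>K\<close> is free.\<close>

lemma F_half: "c \<le> card FA + card FB"
  using card_F[OF isK_K] T_half[of "[]" K] isK_K lenK by simp

lemma F_more: "c + 1 \<le> card FA + card FB" if "isK (x # y # ys)" "x \<notin> T" "y \<notin> T"
  using card_F[OF that(1)] T_half[of "[x, y]" ys] that isK_length[OF that(1)] by simp

text \<open>If exactly half of \<open>K\<close> is free, free vertices alternate with vertices of \<open>T\<close>, just as the two sides do.\<close>

lemma T_one_side:
  assumes "card FA + card FB = c"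
  shows "T \<inter> A = {} \<or> T \<inter> B = {}"
proof (rule ccontr)
  assume ne: "\<not> ?thesis"
  have "successively (\<lambda>x y. (x \<in> T) \<noteq> (y \<in> T) \<and> (x \<in> A) \<noteq> (y \<in> A)) K"
  proof (rule successivelyI_split)
    fix us x y vs
    assume e: "K = us @ x # y # vs"
    then have k: "isK (x # y # vs @ us)"
      using isK_K isK_rotate[of us "x # y # vs"] by simp
    have "(x \<in> A) \<noteq> (y \<in> A)"
      using R_bip[OF isK_adj[OF k]] disj unfolding opposite_def by blast
    moreover have "\<not> (x \<notin> T \<and> y \<notin> T)"
      using F_more[OF k] assms by linarith
    ultimately show "(x \<in> T) \<noteq> (y \<in> T) \<and> (x \<in> A) \<noteq> (y \<in> A)"
      using T_adj[OF k] by blast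
  qed
  note alt = alternating_sets[OF this]
  obtain z z' where z: "z \<in> T" "z \<in> A" "z' \<in> T" "z' \<in> B"
    using ne by blast
  then have "z' \<notin> A"
    using disj by blast
  then show False
    using alt[of z] alt[of z'] z T_sub by blast
qed

text \<open>A vertex of \<open>T\<close> has two free neighbours on \<open>K\<close>, one on either side.\<close>

lemma TA_empty: "card FB \<le> 1 \<Longrightarrow> T \<inter> A = {}"
proof (rule ccontr)
  assume f: "card FB \<le> 1" and "T \<inter> A \<noteq> {}"
  then obtain z where z: "z \<in> T" "z \<in> A"
    by blast
  then obtain xs where k: "isK (xs @ [z])"
    using isK_before T_sub by blast
  then obtain x y zs where xs: "xs = x # y # zs"
    using isK_length[OF k] c3 by (cases xs; cases "tl xs") auto
  obtain x' xs' where xs': "x # y # zs = xs' @ [x']"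
    by (metis append_butlast_last_id list.distinct(1))
  have k1: "isK (z # x # y # zs)"
    using isK_rotate[OF k] xs by simp
  have k2: "isK (x' # z # xs')"
    using isK_rotate[of xs' "[x', z]"] k xs xs' by simp
  have x: "x \<in> FB"
    using FB_next[OF k1] z by blast
  have "R x' z"
    using isK_adj[OF k2] .
  then have "x' \<in> B"
    using z side_cases R_sym by blast
  moreover have "x' \<notin> T"
    using T_adj[OF k2] z by blast
  ultimately have x': "x' \<in> FB"
    using isK_set[OF k2] by auto
  have "x \<noteq> x'"
  proof
    assume "x = x'"
    then have "distinct (xs' @ [x])" "xs' = [] \<or> hd xs' = x"
      using isK_dist[OF k1] xs' by (auto simp del: distinct_append simp: Cons_eq_append_conv)
    then have "xs' = []"
      by (cases xs') auto
    then show False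
      using xs' by simp
  qed
  then show False
    using f x x' card_le_Suc0_iff_eq[OF finite_parts(6)] by auto
qed

section \<open>Feet of the longest cycle in the component\<close>

text \<open>If paths inside \<open>U\<close> between any two vertices of \<open>P\<close> are long, then an arc of \<open>K\<close> joining vertices with different
feet contains many free vertices. When another vertex of \<open>T\<close> lies in the arc, its foot differs from one of the two
given feet, so a shorter arc serves; otherwise the interior is entirely free on this side and \<open>detour\<close> bounds
its length from below.\<close>

lemma gap:
  assumes path: "\<And>a a'. a \<in> P \<Longrightarrow> a' \<in> P \<Longrightarrow> a \<noteq> a' \<Longrightarrow>
      \<exists>ws. path R ws \<and> hd ws = a \<and> last ws = a' \<and> set ws \<subseteq> U \<and> 2 * r + 1 \<le> length ws"
    and "isK (x # xs @ y # ys)" "x \<in> B" "y \<in> B" "u \<in> U" "R x u" "w \<in> U" "R y w" "u \<noteq> w"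
  shows "r \<le> card (FB \<inter> set xs)"
  using assms(2-)
proof (induction "length xs" arbitrary: x xs y ys u w rule: less_induct)
  case less
  show ?case
  proof (cases "set xs \<inter> B \<inter> T = {}")
    case True
    obtain ws where ws: "path R ws" "hd ws = u" "last ws = w" "set ws \<subseteq> U" "2 * r + 1 \<le> length ws"
      using path[of u w] less.prems foot_P by blast
    have "length ws \<le> length xs"
      by (rule detour[OF less.prems(1) ws(1)]) (use ws less.prems R_sym[of y w] U_sub in auto)
    then have l: "2 * r + 1 \<le> length xs"
      using ws by linarith
    have "cyc R ((x # xs) @ (y # ys))"
      using less.prems(1) by (simp add: isK_def)
    then have "path R (x # xs)"
      using cyc_split by blast
    then have p: "path R xs" "R x (hd xs)"
      using l by (auto simp: path_def successively_Cons)
    have "hd xs \<in> A"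
      using p(2) less.prems(2) side_cases by blast
    then have "card (set xs \<inter> B) = length xs div 2"
      using path_counts(1)[OF p(1)] by blast
    moreover have "FB \<inter> set xs = set xs \<inter> B"
      using True isK_set[OF less.prems(1)] by auto
    ultimately show ?thesis
      using l by simp
  next
    case False
    then obtain z v where z: "z \<in> set xs" "z \<in> B" "v \<in> U" "R z v"
      by (auto simp: T_def)
    obtain xs1 xs2 where xs: "xs = xs1 @ z # xs2"
      using z(1) split_list by metis
    have f: "finite (FB \<inter> set xs)"
      by simp
    show ?thesis
    proof (cases "v = u")
      case False
      have "r \<le> card (FB \<inter> set xs1)"
        by (rule less.hyps[of xs1 x z "xs2 @ y # ys" u v]) (use less.prems z False xs in auto)
      also have "\<dots> \<le> card (FB \<inter> set xs)"
        by (rule card_mono[OF f]) (use xs in auto)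
      finally show ?thesis .
    next
      case True
      have "isK (z # xs2 @ y # (ys @ x # xs1))"
        using isK_rotate[of "x # xs1" "z # xs2 @ y # ys"] less.prems(1) xs by simp
      then have "r \<le> card (FB \<inter> set xs2)"
        by (rule less.hyps[rotated, of z xs2 y "ys @ x # xs1" v w]) (use less.prems z True xs in auto)
      also have "\<dots> \<le> card (FB \<inter> set xs)"
        by (rule card_mono[OF f]) (use xs in auto)
      finally show ?thesis .
    qed
  qed
qed

text \<open>Both arcs between the two vertices count.\<close>

lemma two_gaps:
  assumes path: "\<And>a a'. a \<in> P \<Longrightarrow> a' \<in> P \<Longrightarrow> a \<noteq> a' \<Longrightarrow>
      \<exists>ws. path R ws \<and> hd ws = a \<and> last ws = a' \<and> set ws \<subseteq> U \<and> 2 * r + 1 \<le> length ws"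
    and x: "x \<in> set K \<inter> B" "y \<in> set K \<inter> B" "x \<noteq> y" "u \<in> U" "R x u" "w \<in> U" "R y w" "u \<noteq> w"
  shows "2 * r \<le> card FB"
proof -
  obtain xs ys where k: "isK (x # xs @ y # ys)"
    using isK_two x by blast
  then have k': "isK (y # ys @ x # xs)"
    using isK_rotate[of "x # xs" "y # ys"] by simp
  have "r \<le> card (FB \<inter> set xs)"
    by (rule gap[OF path k, of u w]) (use x in auto)
  moreover have "r \<le> card (FB \<inter> set ys)"
    by (rule gap[OF path k', of w u]) (use x in auto)
  moreover have "card (FB \<inter> set xs) + card (FB \<inter> set ys) \<le> card FB"
  proof -
    have "card (FB \<inter> set xs) + card (FB \<inter> set ys) = card ((FB \<inter> set xs) \<union> (FB \<inter> set ys))"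
      by (rule card_Un_disjoint[symmetric]) (use isK_dist[OF k] in auto)
    also have "\<dots> \<le> card FB"
      by (rule card_mono) (use finite_parts in auto)
    finally show ?thesis .
  qed
  ultimately show ?thesis
    by linarith
qed

text \<open>If different vertices never have different feet, then all feet coincide, except that a single vertex of \<open>T\<close> may
have several feet.\<close>

lemma feet_cases:
  assumes "\<And>x y u w. x \<in> set K \<inter> B \<Longrightarrow> y \<in> set K \<inter> B \<Longrightarrow> x \<noteq> y \<Longrightarrow> u \<in> U \<Longrightarrow> R x u \<Longrightarrow> w \<in> U \<Longrightarrow> R y w \<Longrightarrow> u = w"
  obtains (single) a where "a \<in> P" "\<And>z u. z \<in> set K \<inter> B \<Longrightarrow> u \<in> U \<Longrightarrow> R z u \<Longrightarrow> u = a"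
  | (double) z a a' where "T \<inter> B = {z}" "a \<in> U" "a' \<in> U" "a \<noteq> a'" "R z a" "R z a'"
proof -
  consider (none) "T \<inter> B = {}" | (one) z where "T \<inter> B = {z}" | (two) z z' where "z \<in> T \<inter> B" "z' \<in> T \<inter> B" "z \<noteq> z'"
    by blast
  then show thesis
  proof cases
    case none
    obtain a where "a \<in> P"
      using PQ_ne(1) by (metis card.empty equals0I not_one_le_zero)
    then show thesis
      using single none by (auto simp: T_def)
  next
    case one
    show thesis
    proof (cases "\<exists>a a'. a \<in> U \<and> a' \<in> U \<and> a \<noteq> a' \<and> R z a \<and> R z a'")
      case True
      then show thesis
        using double one by blast
    next
      case False
      obtain a where a: "a \<in> U" "R z a" "z \<in> B"
        using one by (auto simp: T_def)
      then have "a \<in> P"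
        using foot_P by blast
      moreover have "u = a" if "y \<in> set K \<inter> B" "u \<in> U" "R y u" for y u
      proof -
        have "y = z"
          using that one by (auto simp: T_def)
        then show ?thesis
          using False a that by blast
      qed
      ultimately show thesis
        using single by blast
    qed
  next
    case two
    obtain a where a: "a \<in> U" "R z a"
      using two by (auto simp: T_def)
    obtain a' where a': "a' \<in> U" "R z' a'"
      using two by (auto simp: T_def)
    have e: "a' = a"
      using assms[of z z' a a'] two a a' T_sub by blast
    have "u = a" if "y \<in> set K \<inter> B" "u \<in> U" "R y u" for y u
    proof (cases "y = z")
      case True
      then show ?thesis
        using assms[of y z' u a'] that two a' e T_sub by blast
    next
      case False
      then show ?thesis
        using assms[of y z u a] that two a T_sub by blast
    qed
    moreover have "a \<in> P"
      using foot_P a two by blast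
    ultimately show thesis
      using single by blast
  qed
qed

text \<open>When \<open>a\<close> is the only foot, \<open>P\<close> without \<open>a\<close> is blue to every vertex of \<open>K\<close> in \<open>B\<close>, free or not.\<close>

lemma common_foot_blue:
  assumes "\<And>z u. z \<in> set K \<inter> B \<Longrightarrow> u \<in> U \<Longrightarrow> R z u \<Longrightarrow> u = a"
  shows "complete Bl (P - {a}) ((set K \<inter> B) \<union> Q')"
proof (rule complete_blue)
  show "\<not> R x y" if "x \<in> P - {a}" "y \<in> (set K \<inter> B) \<union> Q'" for x y
    using assms[of y x] that R_sym[of x y] U_closed[of x y] by blast
qed auto

lemma card_KQ': "card ((set K \<inter> B) \<union> Q') = c + card Q'"
  using card_Un_disjoint[of "set K \<inter> B" Q'] K_B finite_parts by auto

lemma no_red_complete: "complete R X Y \<Longrightarrow> X \<subseteq> A \<Longrightarrow> Y \<subseteq> B \<Longrightarrow> c + 1 \<le> card X \<Longrightarrow> c + 1 \<le> card Y \<Longrightarrow> False"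
  using complete_has_cyc[of R X Y "c + 1"] longest_has[of "c + 1"] c3 disj finite_subset[OF _ finA, of X]
    finite_subset[OF _ finB, of Y] by fastforce

lemma no_blue_complete: "complete Bl X Y \<Longrightarrow> X \<inter> Y = {} \<Longrightarrow> finite X \<Longrightarrow> finite Y \<Longrightarrow> \<tau> \<le> card X \<Longrightarrow> \<tau> \<le> card Y \<Longrightarrow> False"
  using complete_has_cyc[of Bl X Y \<tau>] no_blue_\<tau> regime M5 by linarith

section \<open>Blue edges between the two blocks\<close>

lemma blocks_disjoint: "P \<inter> GB = {}" "Q \<inter> GA = {}" "GB \<inter> P = {}" "GA \<inter> Q = {}"
  "(P \<union> GB) \<inter> (Q \<union> GA) = {}" "(GB \<union> P) \<inter> (GA \<union> Q) = {}"
  using disj U_sub by auto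

text \<open>The two blue blocks of a component, connected by two disjoint blue edges. The three lemmas differ in which sides
of the blocks the edges join.\<close>

lemma two_PQ_edges:
  assumes "x \<in> P" "x' \<in> P" "x \<noteq> x'" "y \<in> Q" "y' \<in> Q" "y \<noteq> y'" "Bl x y" "Bl x' y'"
    and "3 \<le> t" "t \<le> M" "1 \<le> card GA" "1 \<le> card GB" "t + 1 \<le> card U" "t \<le> card GA + card GB + 1"
  shows "has_cyc Bl (2 * t)"
  by (rule two_blocks_same[OF P_GB Q_GA finite_parts(1,8,2,7) blocks_disjoint(1,2,5) assms(1-8,9)])
    (use assms card_PQ card_G in linarith)+

lemma two_GG_edges:
  assumes "x \<in> GA" "x' \<in> GA" "x \<noteq> x'" "y \<in> GB" "y' \<in> GB" "y \<noteq> y'" "Bl x y" "Bl x' y'"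
    and "3 \<le> t" "t \<le> M" "t + 1 \<le> card GA + card GB" "t \<le> card U + 1"
  shows "has_cyc Bl (2 * t)"
  by (rule two_blocks_same[OF complete_sym[OF P_GB] complete_sym[OF Q_GA] finite_parts(8,1,7,2) blocks_disjoint(3,4,6) assms(4-6,1-3)
        Bl_sym[OF assms(7)] Bl_sym[OF assms(8)] assms(9)])
    (use assms card_PQ card_G PQ_ne in linarith)+

lemma PQ_and_GG_edges:
  assumes "x \<in> P" "y \<in> Q" "x' \<in> GA" "y' \<in> GB" "Bl x y" "Bl x' y'"
    and "2 \<le> t" "t \<le> M" "t \<le> card U" "t \<le> card GA + card GB"
  shows "has_cyc Bl (2 * t)"
  by (rule two_blocks_opposite[OF P_GB Q_GA finite_parts(1,8,2,7) blocks_disjoint(1,2,5) assms(1,4,2,3,5) Bl_sym[OF assms(6)] assms(7)])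
    (use assms card_PQ card_G in linarith)+

text \<open>The blue edges between the two blocks form a star with centre \<open>v\<close>.\<close>

definition star :: "'v \<Rightarrow> bool" where
  "star v \<longleftrightarrow> (\<forall>x\<in>P. \<forall>y\<in>Q. x \<noteq> v \<longrightarrow> y \<noteq> v \<longrightarrow> R x y) \<and> (\<forall>x\<in>GA. \<forall>y\<in>GB. x \<noteq> v \<longrightarrow> y \<noteq> v \<longrightarrow> R x y)"

lemma starPQ: "star v \<Longrightarrow> x \<in> P \<Longrightarrow> y \<in> Q \<Longrightarrow> x \<noteq> v \<Longrightarrow> y \<noteq> v \<Longrightarrow> R x y"
  by (simp add: star_def)

lemma starG: "star v \<Longrightarrow> x \<in> GA \<Longrightarrow> y \<in> GB \<Longrightarrow> x \<noteq> v \<Longrightarrow> y \<noteq> v \<Longrightarrow> R x y"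
  by (simp add: star_def)

text \<open>The situation is symmetric in the two sides; this transfers lemmas about one side to the other.\<close>

lemma star_flip: "component.star B A R K U = component.star A B R K U"
proof -
  interpret f: component B A R K c M \<tau> U
    by (rule flip)
  show ?thesis
    unfolding fun_eq_iff star_def f.star_def using R_sym by blast
qed

text \<open>Otherwise an edge between \<open>P'\<close> and \<open>Q'\<close> that avoids \<open>v\<close> would satisfy \<open>no_insertion\<close>.\<close>

lemma star_dichotomy:
  assumes "star v"
  shows "P' \<subseteq> {v} \<or> Q' \<subseteq> {v}"
proof (rule ccontr)
  assume "\<not> ?thesis"
  then obtain a b where ab: "a \<in> P'" "a \<noteq> v" "b \<in> Q'" "b \<noteq> v"
    by blast
  show False
  proof (rule no_insertion[OF ab(1,3)])
    show "R a b"
      using starG[OF assms, of a b] ab by simp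
    show "R a z" if "z \<in> FB" "z \<noteq> v" for z
      using starG[OF assms, of a z] ab that by simp
    show "R b z" if "z \<in> FA" "z \<noteq> v" for z
      using starG[OF assms, of z b] R_sym[of z b] ab that by simp
  qed
qed

lemma path3:
  assumes "x \<in> P" "y \<in> P" "x \<noteq> y"
  shows "\<exists>ws. path R ws \<and> hd ws = x \<and> last ws = y \<and> set ws \<subseteq> U \<and> 3 \<le> length ws"
proof -
  obtain ws where ws: "path R ws" "hd ws = x" "last ws = y" "set ws \<subseteq> U"
    using U_conn assms by blast
  have "\<not> R x y"
    using assms side_cases(1)[of x y] disj by blast
  then obtain a b d zs where "ws = a # b # d # zs"
    using ws assms by (cases ws; cases "tl ws"; cases "tl (tl ws)") (auto simp: path_def)
  then show ?thesis
    using ws by (intro exI[of _ ws]) auto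
qed

text \<open>Apart from \<open>v\<close>, the component is red complete bipartite, so paths between two vertices of \<open>P\<close> can be made almost as
long as the sides permit. If \<open>v\<close> itself is an end, the path starts with one of its red edges.\<close>

lemma long_path:
  assumes star: "\<And>x y. x \<in> P \<Longrightarrow> y \<in> Q \<Longrightarrow> x \<noteq> v \<Longrightarrow> y \<noteq> v \<Longrightarrow> R x y"
    and q: "card Q \<le> 2 * (card P - 2)"
    and xy: "x \<in> P" "y \<in> P" "x \<noteq> y"
  shows "\<exists>ws. path R ws \<and> hd ws = x \<and> last ws = y \<and> set ws \<subseteq> U \<and> 2 * ((card Q + 1) div 2) + 1 \<le> length ws"
proof -
  let ?r = "(card Q + 1) div 2"
  have ar: "k \<le> 2 \<Longrightarrow> 2 * ((k + 1) div 2) + 1 \<le> 3" "3 \<le> k \<Longrightarrow> 1 \<le> (k + 1) div 2 \<and> (k + 1) div 2 \<le> k - 1"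
    "3 \<le> k \<Longrightarrow> k \<le> 2 * (l - 2) \<Longrightarrow> (k + 1) div 2 \<le> l - 2 \<and> 3 \<le> l" for k l :: nat
    by presburger+
  have one: "\<exists>ws. path R ws \<and> hd ws = x \<and> last ws = y \<and> set ws \<subseteq> U \<and> 2 * ?r + 1 \<le> length ws"
    if xy: "x \<in> P" "y \<in> P" "x \<noteq> y" and yv: "y \<noteq> v" for x y
  proof -
    consider "card Q \<le> 2" | "3 \<le> card Q" "v \<in> Q" | "3 \<le> card Q" "v \<notin> Q" "x \<noteq> v" | "3 \<le> card Q" "v \<notin> Q" "x = v"
      by linarith
    then show ?thesis
    proof cases
      case 1
      then have "2 * ((card Q + 1) div 2) + 1 \<le> 3"
        by (rule ar(1))
      then show ?thesis
        using path3[OF xy] le_trans by blast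
    next
      case 2
      have "complete R P (Q - {v})"
        by (rule complete_red) (use star 2 disj in blast)
      moreover have "?r \<le> card (Q - {v})"
        using ar(2)[OF 2(1)] 2 finite_parts(2) by simp
      moreover have "1 \<le> ?r" "?r < card P"
        using ar(2)[OF 2(1)] ar(3)[OF 2(1) q] by linarith+
      moreover have "P \<inter> (Q - {v}) = {}"
        using disj by blast
      ultimately obtain ws where "path R ws" "hd ws = x" "last ws = y" "set ws \<subseteq> P \<union> (Q - {v})" "length ws = 2 * ?r + 1"
        using complete_path_same[of R P "Q - {v}" x y ?r] xy finite_parts by blast
      then show ?thesis
        by (intro exI[of _ ws]) auto
    next
      case 3
      have "complete R (P - {v}) Q"
        by (rule complete_red) (use star 3 in blast)
      moreover have "?r < card (P - {v})"
        using ar(3)[OF 3(1) q] card_Diff_single_ge[OF finite_parts(1), of v] by linarith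
      moreover have "1 \<le> ?r" "?r \<le> card Q"
        using ar(2)[OF 3(1)] by linarith+
      moreover have "(P - {v}) \<inter> Q = {}"
        using disj by blast
      ultimately obtain ws where "path R ws" "hd ws = x" "last ws = y" "set ws \<subseteq> (P - {v}) \<union> Q" "length ws = 2 * ?r + 1"
        using complete_path_same[of R "P - {v}" Q x y ?r] xy yv 3 finite_parts by blast
      then show ?thesis
        by (intro exI[of _ ws]) auto
    next
      case 4
      obtain b where b: "b \<in> Q" "R x b"
        using P_nbr xy by blast
      have "complete R Q (P - {v})"
        by (rule complete_sym, rule complete_red) (use star 4 in blast)
      moreover have "?r \<le> card (P - {v})"
        using ar(3)[OF 4(1) q] card_Diff_single_ge[OF finite_parts(1), of v] by linarith
      moreover have "1 \<le> ?r" "?r \<le> card Q"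
        using ar(2)[OF 4(1)] by linarith+
      moreover have "Q \<inter> (P - {v}) = {}"
        using disj by blast
      ultimately obtain ws where ws: "path R ws" "hd ws = b" "last ws = y" "set ws \<subseteq> Q \<union> (P - {v})" "length ws = 2 * ?r"
        using complete_path_opposite[of R Q "P - {v}" b y ?r] xy yv b finite_parts by blast
      then have "path R (x # ws)"
        using path_Cons[OF ws(1), of x] b 4 by blast
      moreover have "last (x # ws) = y"
        using ws by (auto simp: path_def)
      ultimately show ?thesis
        using ws xy by (intro exI[of _ "x # ws"]) auto
    qed
  qed
  show ?thesis
  proof (cases "y = v")
    case False
    then show ?thesis
      using one xy by blast
  next
    case True
    then obtain ws where ws: "path R ws" "hd ws = y" "last ws = x" "set ws \<subseteq> U" "2 * ?r + 1 \<le> length ws"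
      using one[of y x] xy by blast
    then show ?thesis
      using path_rev[OF ws(1) symp_R] by (intro exI[of _ "rev ws"]) (auto simp: hd_rev last_rev)
  qed
qed

text \<open>If \<open>GB\<close> is empty, then \<open>Q\<close> has all \<open>M\<close> vertices and every vertex of \<open>K\<close> in \<open>B\<close> is attached to \<open>U\<close>; hence
\<open>Q\<close> is blue to all of \<open>K\<close> in \<open>A\<close>. This block is large enough unless \<open>M = c + 2\<close> and \<open>P\<close> also has \<open>M\<close> vertices. In that
case there is a common foot \<open>a\<close>, since no arc of \<open>K\<close> contains a free vertex of \<open>B\<close>, and the blue blocks \<open>P - {a}\<close> and
\<open>Q\<close> each with one side of \<open>K\<close> lead to a blue cycle or to a red complete bipartite graph that is too large.\<close>

lemma GB_ne: "GB \<noteq> {}"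
proof
  assume e: "GB = {}"
  then have q: "card Q = M"
    using card_PQ by (metis Un_empty add.right_neutral card.empty)
  have fb: "card FB = 0" "card (T \<inter> B) = c"
    using e card_T by (metis Un_empty card.empty, metis Un_empty add.right_neutral card.empty)
  have TB: "z \<in> T" if "z \<in> set K \<inter> B" for z
    using e that by blast
  have TA: "z \<notin> T" if "z \<in> set K \<inter> A" for z
  proof -
    obtain xs where k: "isK (z # xs)"
      using isK_at \<open>z \<in> set K \<inter> A\<close> by blast
    then obtain y ys where xs: "xs = y # ys"
      using isK_length[OF k] c3 by (cases xs) auto
    have "y \<in> B"
      using isK_adj k xs that side_cases by blast
    then have "y \<in> T"
      using TB[of y] isK_set[OF k] xs by auto
    then show ?thesis
      using T_adj k xs by blast
  qed
  then have fa: "FA = set K \<inter> A"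
    by blast
  then have ga: "card GA = c + card P'"
    using card_G K_A by simp
  show False
  proof (cases "\<tau> \<le> card GA")
    case True
    then show False
      using no_blue_complete[OF Q_GA blocks_disjoint(2) finite_parts(2,7)] q regime by linarith
  next
    case False
    then have r: "M = c + 2" "\<tau> = c + 1" and p: "card P = M"
      using regime ga card_PQ by linarith+
    have distinct_feet: False
      if "x \<in> set K \<inter> B" "y \<in> set K \<inter> B" "x \<noteq> y" "u \<in> U" "R x u" "w \<in> U" "R y w" "u \<noteq> w" for x y u w
      using two_gaps[of 1 x y u w] path3 that fb by simp
    obtain a where a: "a \<in> P" "\<And>z u. z \<in> set K \<inter> B \<Longrightarrow> u \<in> U \<Longrightarrow> R z u \<Longrightarrow> u = a"
    proof (rule feet_cases)
      fix z
      assume "T \<inter> B = {z}"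
      then show thesis
        using fb c3 by simp
    qed (use distinct_feet in blast)+
    have b1: "complete Bl (P - {a}) (set K \<inter> B)"
    proof (rule complete_blue)
      show "\<not> R x y" if "x \<in> P - {a}" "y \<in> set K \<inter> B" for x y
        using a(2)[of y x] that R_sym[of x y] by blast
    qed auto
    have b2: "complete Bl Q (set K \<inter> A)"
      using Q_GA fa by (auto intro: complete_mono)
    have cards: "card (P - {a}) = c + 1"
      using a p r by simp
    \<comment> \<open>Two disjoint blue edges between \<open>P - {a}\<close> and \<open>Q\<close> would connect the two blocks.\<close>
    have same: False if "x \<in> P - {a}" "x' \<in> P - {a}" "x \<noteq> x'" "y \<in> Q" "y' \<in> Q" "y \<noteq> y'" "Bl x y" "Bl x' y'" for x x' y y'
    proof -
      have "has_cyc Bl (2 * \<tau>)"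
        by (rule two_blocks_same[OF b1 b2 _ _ _ _ _ _ _ that])
          (use finite_parts disj U_sub cards K_A K_B q r c3 in auto)
      then show False
        using no_blue_\<tau> by simp
    qed
    have "\<exists>v. \<forall>x y. x \<in> P - {a} \<and> y \<in> Q \<and> Bl x y \<longrightarrow> x = v \<or> y = v"
      by (rule star_of_no_two_disjoint) (use same in blast)
    then obtain v where "x = v \<or> y = v" if "x \<in> P - {a}" "y \<in> Q" "Bl x y" for x y
      by blast
    then have v: "R x y" if "x \<in> P - {a}" "y \<in> Q" "x \<noteq> v" "y \<noteq> v" for x y
      using that BlI[of x y] unfolding opposite_def by blast
    show False
    proof (cases "v \<in> P - {a}")
      case False
      have "complete R (P - {a}) (Q - {v})"
        by (rule complete_red) (use v False in blast)
      then show False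
        using no_red_complete[of "P - {a}" "Q - {v}"] cards q r card_Diff_single_ge[OF finite_parts(2), of v] by auto
    next
      case True
      have vQ: "v \<notin> Q"
        using True disj by blast
      have red: "complete R (P - {a} - {v}) Q"
        by (rule complete_red) (use v vQ in blast)
      have cv: "card (P - {a} - {v}) = c"
        using cards True by simp
      have "3 \<le> card Q"
        using q M5 by linarith
      \<comment> \<open>Two red ones among them would give a red cycle longer than \<open>K\<close>, so both edges are blue.\<close>
      then obtain y1 y2 where y: "y1 \<in> Q" "y2 \<in> Q" "y1 \<noteq> y2" "R v y1 = R v y2"
        using two_agree_of_three by metis
      have nr: "\<not> R v y1"
      proof
        assume "R v y1"
        then have "has_cyc R (2 * (c + 1))"
          by (intro red_plus_one[OF red _ finite_parts(2) _ _ y(1-3)]) (use y(4) finA disj vQ cv q r c3 in auto)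
        then show False
          using longest_has by fastforce
      qed
      have bl: "Bl v y1" "Bl v y2"
        using y nr True by (auto intro!: BlI simp: opposite_def)
      have "has_cyc Bl (2 * \<tau>)"
        by (rule complete_plus_one[OF complete_sym[OF b2] _ finite_parts(2) _ _ y(1-3) bl])
          (use disj True U_sub K_A q r c3 in auto)
      then show False
        using no_blue_\<tau> by simp
    qed
  qed
qed

lemma GA_ne: "GA \<noteq> {}"
proof -
  interpret f: component B A R K c M \<tau> U
    by (rule flip)
  show ?thesis
    using f.GB_ne .
qed

lemma G_ge_1: "1 \<le> card GA" "1 \<le> card GB"
  using GA_ne GB_ne finite_parts by (simp_all add: Suc_le_eq card_gt_0_iff)

text \<open>For a component of exactly \<open>M\<close> vertices, \<open>P\<close> and \<open>Q'\<close> have equal size, so each of them is a single vertex and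
\<open>Q' = {v}\<close>. Either \<open>v\<close> enlarges the blue block of \<open>Q\<close>, or it is red to almost all free vertices of \<open>A\<close> and \<open>no_insertion\<close> applies;
if there are no such free vertices, a crossing through a common foot does the same.\<close>

lemma small_side:
  assumes star: "star v" and u: "card U = M" and Q': "Q' \<subseteq> {v}"
  shows False
proof -
  have q1: "card Q' = card P"
    using card_PQ u by linarith
  have "card Q' \<le> 1"
    using Q' card_mono[of "{v}" Q'] by simp
  then have p1: "card P = 1" "card Q' = 1" "card Q + 1 = M" "card P' + 1 = M"
    using q1 PQ_ne card_PQ by linarith+
  obtain b where "b \<in> Q'"
    using p1(2) card_ge_1E[of Q'] by auto
  then have v: "v \<in> Q'" "v \<in> B"
    using Q' by blast+
  show False
  proof (cases "FA = {}")
    case True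
    obtain p0 p1 p2 p3 ys where k: "isK (p0 # p1 # p2 # p3 # ys)" and ab: "p0 \<in> A" "p1 \<in> B" "p2 \<in> A" "p3 \<in> B"
      using windowA[of v] by blast
    have k1: "isK (p2 # p3 # (ys @ [p0, p1]))"
      using isK_rotate[of "[p0, p1]" "p2 # p3 # ys"] k by simp
    have sK: "p0 \<in> set K" "p2 \<in> set K"
      using isK_set[OF k] by auto
    then have t: "p0 \<in> T" "p2 \<in> T"
      using True ab by blast+
    then have f: "p1 \<in> FB" "p3 \<in> FB"
      using FB_next[OF k] FB_next[OF k1] ab by blast+
    obtain w w' where w: "w \<in> U" "R p0 w" "w' \<in> U" "R p2 w'"
      using t by (auto simp: T_def)
    then have "w = w'"
      using T_near[OF k] by blast
    note w = w[folded this]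
    obtain a where a: "a \<in> P'"
      using p1 M5 card_ge_1E[of P'] by auto
    have "a \<noteq> v"
      using a v disj by blast
    then have r: "R a p1" "R a p3"
      using starG[OF star, of a p1] starG[OF star, of a p3] a f v by auto
    show False
      using crossing[of p0 p1 "[]" p2 p3 ys w a] k w r a U_sub R_sym[of p0 w] R_sym[of p2 w] by auto
  next
    case False
    then have f1: "1 \<le> card FA"
      using finite_parts by (simp add: Suc_le_eq card_gt_0_iff)
    consider (two) y1 y2 where "y1 \<in> GA" "y2 \<in> GA" "y1 \<noteq> y2" "Bl v y1" "Bl v y2"
      | (one) w where "\<And>z. z \<in> GA \<Longrightarrow> Bl v z \<Longrightarrow> z = w"
      by blast
    then show False
    proof cases
      case two
      have "v \<notin> Q \<union> GA"
        using v disj by blast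
      then have "has_cyc Bl (2 * M)"
        by (rule complete_plus_one[OF Q_GA finite_parts(2,7) blocks_disjoint(2) _ two]) (use p1 f1 card_G M5 in linarith)+
      then show False
        using no_blue_M by simp
    next
      case one
      have red: "R v z" if "z \<in> FA" "z \<noteq> w" for z
        using one[of z] BlI[of v z] that v unfolding opposite_def by blast
      have red': "R v z" if "z \<in> P'" "z \<noteq> w" for z
        using one[of z] BlI[of v z] that v unfolding opposite_def by blast
      obtain a where a: "a \<in> P'" "a \<noteq> w"
        using card_ge_2_avoid[of P' w] p1 M5 by auto
      have "a \<noteq> v"
        using a v disj by blast
      then have ra: "R a z" if "z \<in> FB" for z
        using starG[OF star, of a z] a that v by auto
      show False
        using no_insertion[OF a(1) v(1) R_sym[OF red'[OF a]], of w] ra red by blast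
    qed
  qed
qed

text \<open>With exactly \<open>M\<close> vertices in \<open>U\<close>, one blue edge inside \<open>U\<close> together with one between \<open>GA\<close> and \<open>GB\<close> is enough for a
blue cycle of length \<open>2 M\<close>, and so are two disjoint ones between \<open>GA\<close> and \<open>GB\<close>.\<close>

lemma small_component: "card U \<noteq> M"
proof
  assume u: "card U = M"
  have cg: "M \<le> card GA + card GB"
    using F_half card_G card_PQ u regime by linarith
  have ne: "1 \<le> card P'" "1 \<le> card Q'"
    using card_PQ u PQ_ne by linarith+
  \<comment> \<open>A star is impossible by \<open>small_side\<close>, applied on either side.\<close>
  have side: False if "star v" for v
  proof -
    interpret f: component B A R K c M \<tau> U
      by (rule flip)
    show False
      using star_dichotomy[OF that] small_side[OF that u] f.small_side[OF _ u, of v] that star_flip by metis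
  qed
  show False
  proof (cases "\<exists>x\<in>GA. \<exists>y\<in>GB. Bl x y")
    case False
    then have r: "R x y" if "x \<in> GA" "y \<in> GB" for x y
      using that BlI[of x y] unfolding opposite_def by blast
    obtain a b where ab: "a \<in> P'" "b \<in> Q'"
      using ne card_ge_1E by metis
    show False
      using no_insertion[OF ab, of undefined] r R_sym ab by blast
  next
    case True
    then obtain x' y' where e: "x' \<in> GA" "y' \<in> GB" "Bl x' y'"
      by blast
    have pq: "R x y" if "x \<in> P" "y \<in> Q" for x y
    proof (rule ccontr)
      assume "\<not> R x y"
      then have "Bl x y"
        using that BlI[of x y] unfolding opposite_def by blast
      then have "has_cyc Bl (2 * M)"
        by (rule PQ_and_GG_edges[OF that e(1,2) _ e(3)]) (use M5 u cg in linarith)+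
      then show False
        using no_blue_M by simp
    qed
    have "\<exists>v. \<forall>x y. x \<in> GA \<and> y \<in> GB \<and> Bl x y \<longrightarrow> x = v \<or> y = v"
    proof (rule star_of_no_two_disjoint)
      show "x = z \<or> y = w" if "x \<in> GA \<and> y \<in> GB \<and> Bl x y" "z \<in> GA \<and> w \<in> GB \<and> Bl z w" for x y z w
      proof (rule ccontr)
        assume "\<not> ?thesis"
        then have "has_cyc Bl (2 * M)"
          using that by (intro two_GG_edges[of x z y w M]) (use M5 u F_half card_G card_PQ regime in linarith)+
        then show False
          using no_blue_M by simp
      qed
    qed
    then obtain v where "x = v \<or> y = v" if "x \<in> GA" "y \<in> GB" "Bl x y" for x y
      by blast
    then have "R x y" if "x \<in> GA" "y \<in> GB" "x \<noteq> v" "y \<noteq> v" for x y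
      using that BlI[of x y] unfolding opposite_def by blast
    then have "star v"
      using pq unfolding star_def by blast
    then show False
      by (rule side)
  qed
qed

section \<open>All connecting blue edges meet one vertex\<close>

text \<open>In the regime \<open>M = c + 2\<close> even a red complete bipartite graph with sides \<open>c + 1\<close> is too large. As \<open>P\<close> has all \<open>M\<close> vertices,
this leaves only the case that \<open>v\<close> belongs to \<open>Q\<close> and \<open>Q\<close> has \<open>c + 1\<close> vertices; then paths in \<open>U\<close> between two vertices of
\<open>P\<close> are longer than \<open>K\<close>, so that there is a common foot.\<close>

lemma critical_Q_bound:
  assumes r: "M = c + 2" and p: "card P = M"
    and star: "\<And>x y. x \<in> P \<Longrightarrow> y \<in> Q \<Longrightarrow> x \<noteq> v \<Longrightarrow> y \<noteq> v \<Longrightarrow> R x y"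
  shows "card Q + 2 \<le> M"
proof (rule ccontr)
  assume "\<not> ?thesis"
  then have q: "c + 1 \<le> card Q"
    using r by linarith
  have \<tau>: "\<tau> = c + 1"
    using regime r by linarith
  \<comment> \<open>Otherwise \<open>P - {v}\<close> and \<open>Q\<close> span a red complete bipartite graph with sides \<open>c + 1\<close>.\<close>
  have vQ: "v \<in> Q"
  proof (rule ccontr)
    assume "v \<notin> Q"
    then have "complete R (P - {v}) Q"
      by (intro complete_red) (use star in blast)
    then show False
      using no_red_complete[of "P - {v}" Q] q r p card_Diff_single_ge[OF finite_parts(1), of v] by auto
  qed
  then have vP: "v \<notin> P"
    using disj by blast
  have red: "complete R P (Q - {v})"
    by (rule complete_red) (use star vP in blast)
  have qv: "card (Q - {v}) + 1 = card Q"
    using vQ finite_parts(2) q by simp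
  then have q: "card Q = c + 1" "card (Q - {v}) = c" "card Q' = 1"
    using no_red_complete[OF red] q r p card_PQ by fastforce+
  have path: "\<exists>ws. path R ws \<and> hd ws = a \<and> last ws = a' \<and> set ws \<subseteq> U \<and> length ws = 2 * c + 1"
    if aa: "a \<in> P" "a' \<in> P" "a \<noteq> a'" for a a'
  proof -
    have "finite (Q - {v})" "P \<inter> (Q - {v}) = {}"
      using finite_parts disj by auto
    moreover have "1 \<le> c" "c < card P" "c \<le> card (Q - {v})"
      using c3 q p r by linarith+
    ultimately obtain ws where "path R ws" "hd ws = a" "last ws = a'" "set ws \<subseteq> P \<union> (Q - {v})" "length ws = 2 * c + 1"
      using complete_path_same[OF red finite_parts(1) _ _ aa, of c] by blast
    then show ?thesis
      by (intro exI[of _ ws]) auto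
  qed
  have pairs: False
    if xy: "x \<in> set K \<inter> B" "y \<in> set K \<inter> B" "x \<noteq> y" "u \<in> U" "R x u" "w \<in> U" "R y w" "u \<noteq> w" for x y u w
  proof -
    obtain xs ys where k: "isK (x # xs @ y # ys)"
      using isK_two xy by blast
    obtain ws where ws: "path R ws" "hd ws = u" "last ws = w" "set ws \<subseteq> U" "length ws = 2 * c + 1"
      using path[of u w] xy foot_P by blast
    have "length ws \<le> length xs"
      by (rule detour[OF k ws(1)]) (use ws xy R_sym[of y w] U_sub in auto)
    then show False
      using isK_length[OF k] ws by simp
  qed
  show False
  proof (rule feet_cases)
    fix a
    assume a: "a \<in> P" "\<And>z u. z \<in> set K \<inter> B \<Longrightarrow> u \<in> U \<Longrightarrow> R z u \<Longrightarrow> u = a"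
    show False
      by (rule no_blue_complete[OF common_foot_blue[OF a(2)]])
        (use finA finB disj U_sub a(1) p r \<tau> q card_KQ' finite_parts in auto)
  next
    fix z a a'
    assume z: "T \<inter> B = {z}" "a \<in> U" "a' \<in> U" "a \<noteq> a'" "R z a" "R z a'"
    have zB: "z \<in> B" "z \<in> set K"
      using z(1) T_sub by blast+
    then obtain ws where ws: "path R ws" "hd ws = a" "last ws = a'" "set ws \<subseteq> U" "length ws = 2 * c + 1"
      using path[of a a'] z foot_P by blast
    have "z \<notin> set ws"
      using ws zB U_sub by blast
    then have "path R (z # ws)"
      using path_Cons ws z by metis
    then have "cyc R (z # ws)"
      using ws z R_sym[of z a'] c3 by (intro cyc_closeI) (auto simp: path_def)
    then show False
      using longest ws(5) by fastforce
  qed (use pairs in blast)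
qed

text \<open>If \<open>b\<close> is the exceptional vertex \<open>v\<close>, its only red neighbour may be \<open>a\<close>; this is why two candidates for the other
end are needed.\<close>

lemma path_to_Q:
  assumes star: "\<And>x y. x \<in> P \<Longrightarrow> y \<in> Q \<Longrightarrow> x \<noteq> v \<Longrightarrow> y \<noteq> v \<Longrightarrow> R x y"
    and p: "card P = M" and q: "card Q = M"
    and ab: "a \<in> P" "a' \<in> P" "a \<noteq> a'" "b \<in> Q"
  shows "\<exists>x\<in>{a, a'}. \<exists>ws. path R ws \<and> hd ws = x \<and> last ws = b \<and> set ws \<subseteq> U \<and> 2 * (M - 1) \<le> length ws"
proof (cases "b = v")
  case False
  obtain x where x: "x \<in> {a, a'}" "x \<noteq> v"
    using ab by blast
  have "complete R (P - {v}) (Q - {v})"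
    by (rule complete_red) (use star in blast)
  moreover have "M - 1 \<le> card (P - {v})" "M - 1 \<le> card (Q - {v})" "1 \<le> M - 1"
    using p q card_Diff_single_ge[OF finite_parts(1), of v] card_Diff_single_ge[OF finite_parts(2), of v] M5 by auto
  moreover have "(P - {v}) \<inter> (Q - {v}) = {}" "x \<in> P - {v}" "b \<in> Q - {v}"
    using disj x ab False by blast+
  ultimately obtain ws where "path R ws" "hd ws = x" "last ws = b" "set ws \<subseteq> (P - {v}) \<union> (Q - {v})" "length ws = 2 * (M - 1)"
    using complete_path_opposite[of R "P - {v}" "Q - {v}" x b "M - 1"] finite_parts by blast
  then show ?thesis
    using x by (intro bexI[of _ x] exI[of _ ws]) auto
next
  case True
  then have vP: "v \<notin> P"
    using ab disj by blast
  obtain a1 where a1: "a1 \<in> P" "R b a1"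
    using Q_nbr ab by blast
  obtain x where x: "x \<in> {a, a'}" "x \<noteq> a1"
    using ab by blast
  have "complete R P (Q - {v})"
    by (rule complete_red) (use star vP in blast)
  moreover have "M - 1 < card P" "M - 1 \<le> card (Q - {v})" "1 \<le> M - 1"
    using p q card_Diff_single_ge[OF finite_parts(2), of v] M5 by auto
  moreover have "P \<inter> (Q - {v}) = {}" "x \<in> P"
    using disj x ab by blast+
  ultimately obtain ws where ws: "path R ws" "hd ws = x" "last ws = a1" "set ws \<subseteq> P \<union> (Q - {v})" "length ws = 2 * (M - 1) + 1"
    using complete_path_same[of R P "Q - {v}" x a1 "M - 1"] a1(1) x(2) finite_parts by blast
  have "b \<notin> set ws"
    using ws True ab disj by blast
  then have "path R (ws @ [b])"
    using ws a1 R_sym[of b a1] by (intro path_append) auto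
  moreover have "hd (ws @ [b]) = x"
    using ws by (auto simp: path_def)
  ultimately show ?thesis
    using x ws ab by (intro bexI[of _ x] exI[of _ "ws @ [b]"]) auto
qed

text \<open>\<open>P\<close> is large enough for a blue cycle of length \<open>2 \<tau>\<close>, so \<open>GB\<close> is small and many vertices of \<open>B\<close> on \<open>K\<close> have feet.
Different feet would need more free vertices of \<open>B\<close> than there are (\<open>two_gaps\<close>). So by \<open>feet_cases\<close> either one vertex
has all the feet, which happens only when everything is of the same size, or there is a common foot \<open>a\<close>; then
\<open>P - {a}\<close> with all of \<open>K\<close> on the other side is a blue block, and \<open>a\<close> is the extra vertex that makes it large enough.\<close>

lemma full_side:
  assumes star: "star v" and p: "\<tau> \<le> card P" and r2: "M = c + 2 \<Longrightarrow> card Q + 2 \<le> M"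
  shows False
proof -
  have rg: "\<tau> = M \<and> M \<le> c \<and> card P = M \<or> \<tau> = c + 1 \<and> M = c + 2 \<and> card Q + 2 \<le> M"
    using regime r2 p card_PQ(1) by linarith
  have "\<not> \<tau> \<le> card GB"
    using no_blue_complete[OF P_GB blocks_disjoint(1) finite_parts(1,8) p] by blast
  then have gb: "card GB + 1 \<le> \<tau>"
    by linarith
  then have fb: "card FB + 1 \<le> card Q" "M = c + 2 \<Longrightarrow> card FB + 2 \<le> card Q"
    using rg card_G(2) card_PQ(2) by linarith+
  have pairs: False
    if xy: "x \<in> set K \<inter> B" "y \<in> set K \<inter> B" "x \<noteq> y" "u \<in> U" "R x u" "w \<in> U" "R y w" "u \<noteq> w" for x y u w
  proof -
    have "card Q \<le> 2 * (card P - 2)"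
      using rg p card_PQ(2) M5 by linarith
    then have "2 * ((card Q + 1) div 2) \<le> card FB"
      using two_gaps[OF _ xy, of "(card Q + 1) div 2"] long_path[OF starPQ[OF star]] by blast
    moreover have "k \<le> 2 * ((k + 1) div 2)" for k :: nat
      by presburger
    ultimately show False
      using fb(1) by (metis Suc_eq_plus1 le_trans not_less_eq_eq order_refl)
  qed
  show False
  proof (rule feet_cases)
    fix z a a'
    assume z: "T \<inter> B = {z}" "a \<in> U" "a' \<in> U" "a \<noteq> a'" "R z a" "R z a'"
    have zB: "z \<in> B" "z \<in> set K"
      using z(1) T_sub by blast+
    have "card FB + 1 = c"
      using card_T(2) z(1) by simp
    then have q: "card Q = M" "card P = M" "c = M" "\<tau> = M"
      using fb rg card_PQ(2) by linarith+
    show False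
    proof (cases "T \<inter> A = {}")
      case True
      then have "c \<le> card GA"
        using card_T(1) card_G(1) by simp
      then show False
        using no_blue_complete[OF Q_GA blocks_disjoint(2) finite_parts(2,7)] q by simp
    next
      case False
      then obtain z' b where z': "z' \<in> set K" "z' \<in> A" "b \<in> U" "R z' b"
        by (auto simp: T_def)
      obtain x ws where x: "x \<in> {a, a'}" and ws: "path R ws" "hd ws = x" "last ws = b" "set ws \<subseteq> U" "2 * (M - 1) \<le> length ws"
      proof -
        have "a \<in> P" "a' \<in> P" "b \<in> Q"
          using foot_P zB z foot_Q z' by blast+
        then have "\<exists>x\<in>{a, a'}. \<exists>ws. path R ws \<and> hd ws = x \<and> last ws = b \<and> set ws \<subseteq> U \<and> 2 * (M - 1) \<le> length ws"
          by (intro path_to_Q[OF starPQ[OF star] q(2,1) _ _ z(4)])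
        then show thesis
          using that by (elim bexE exE conjE)
      qed
      have zx: "R z x"
        using x z by blast
      obtain xs ys where k: "isK (z # xs @ z' # ys)"
        using isK_two[of z z'] zB z' disj by blast
      have k': "isK (z' # ys @ z # xs)"
        using isK_rotate[of "z # xs" "z' # ys"] k by simp
      have "length ws \<le> length xs"
        by (rule detour[OF k ws(1)]) (use ws zx z' R_sym[of z' b] U_sub in auto)
      moreover have "length (rev ws) \<le> length ys"
        by (rule detour[OF k' path_rev[OF ws(1) symp_R]])
          (use ws zx z' R_sym[of z x] U_sub in \<open>auto simp: hd_rev last_rev\<close>)
      ultimately show False
        using isK_length[OF k] ws(5) q M5 by simp
    qed
  next
    fix a
    assume a: "a \<in> P" "\<And>z u. z \<in> set K \<inter> B \<Longrightarrow> u \<in> U \<Longrightarrow> R z u \<Longrightarrow> u = a"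
    have bl: "complete Bl (P - {a}) ((set K \<inter> B) \<union> Q')"
      by (rule common_foot_blue) (rule a(2))
    have dj: "(P - {a}) \<inter> ((set K \<inter> B) \<union> Q') = {}" "a \<notin> (P - {a}) \<union> ((set K \<inter> B) \<union> Q')"
      using disj a by auto
    have fn: "finite (P - {a})" "finite ((set K \<inter> B) \<union> Q')"
      using finite_parts finB by auto
    have ca: "card (P - {a}) + 1 = card P"
      using a finite_parts(1) PQ_ne(1) by simp
    have GBsub: "GB \<subseteq> (set K \<inter> B) \<union> Q'"
      by auto
    \<comment> \<open>Otherwise \<open>a\<close> with two of its neighbours in \<open>GB\<close> enlarges the block of \<open>P - {a}\<close>.\<close>
    have gb1: "card GB \<le> 1"
    proof (rule ccontr)
      assume "\<not> ?thesis"
      then obtain y1 y2 where y: "y1 \<in> GB" "y2 \<in> GB" "y1 \<noteq> y2"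
        using card_ge_2E[of GB] by auto
      have "has_cyc Bl (2 * \<tau>)"
      proof (rule complete_plus_one[OF bl fn dj _ _ y(3)])
        show "y1 \<in> (set K \<inter> B) \<union> Q'" "y2 \<in> (set K \<inter> B) \<union> Q'"
          using y GBsub by blast+
        show "Bl a y1" "Bl a y2"
          using P_GB a(1) y unfolding complete_def by blast+
      qed (use rg p ca card_KQ' card_PQ M5 in linarith)+
      then show False
        using no_blue_\<tau> by simp
    qed
    then have fb1: "card FB + card Q' \<le> 1"
      using card_G(2) by simp
    have rg: "\<tau> = M" "M \<le> c" "card P = M"
      using rg fb1 card_PQ(2) by linarith+
    have TA: "T \<inter> A = {}"
      using TA_empty fb1 by simp
    then have FA: "FA = set K \<inter> A"
      by blast
    then have ga: "c \<le> card GA"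
      using card_T(1) card_G(1) TA by simp
    \<comment> \<open>Now \<open>Q\<close> is blue to all of \<open>K\<close> on the side \<open>A\<close>, so one vertex must be missing from \<open>Q\<close>.\<close>
    have "\<not> M \<le> card Q"
      using no_blue_complete[OF Q_GA blocks_disjoint(2) finite_parts(2,7)] ga rg by auto
    then have q: "card Q + 1 = M" "card Q' = 1" "card FB = 0"
      using fb1 card_PQ(2) by linarith+
    then obtain b where b: "b \<in> Q'"
      using card_ge_1E[of Q'] by auto
    have FB: "FB = {}"
      using q(3) finite_parts(6) by simp
    consider (two) y1 y2 where "y1 \<in> GA" "y2 \<in> GA" "y1 \<noteq> y2" "Bl b y1" "Bl b y2"
      | (one) w where "\<And>y. y \<in> GA \<Longrightarrow> Bl b y \<Longrightarrow> y = w"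
      by blast
    then show False
    proof cases
      case two
      have "b \<notin> Q \<union> GA"
        using b disj by blast
      then have "has_cyc Bl (2 * M)"
        by (rule complete_plus_one[OF Q_GA finite_parts(2,7) blocks_disjoint(2) _ two]) (use q rg ga M5 in linarith)+
      then show False
        using no_blue_M by simp
    next
      case one
      have red: "R b y" if "y \<in> FA" "y \<noteq> w" for y
        using one[of y] BlI[of b y] that b unfolding opposite_def by blast
      \<comment> \<open>All vertices of \<open>B\<close> on \<open>K\<close> are red to \<open>a\<close>, those of \<open>A\<close> except \<open>w\<close> are red to \<open>b\<close>.\<close>
      obtain p0 p1 p2 p3 ys where k: "isK (p0 # p1 # p2 # p3 # ys)" and w: "w \<notin> {p0, p1, p2, p3}"
        and ab: "p0 \<in> B" "p1 \<in> A" "p2 \<in> B" "p3 \<in> A"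
        using windowB[of w] by blast
      have sK: "p0 \<in> set K" "p1 \<in> set K" "p2 \<in> set K" "p3 \<in> set K"
        using isK_set[OF k] by auto
      have "R a y" if y: "y \<in> set K" "y \<in> B" for y
      proof -
        have "y \<in> T"
          using y FB by blast
        then obtain u where "u \<in> U" "R y u"
          by (auto simp: T_def)
        then show ?thesis
          using a(2)[of y u] y R_sym[of y u] by blast
      qed
      then have ra: "R a p0" "R a p2"
        using sK ab by blast+
      have rb: "R b p1" "R b p3"
        using red FA sK ab w by blast+
      show False
        using crossing[of p0 p1 "[]" p2 p3 ys a b] k ra rb a(1) b U_sub by auto
    qed
  qed (use pairs in blast)
qed

text \<open>Two pairs of consecutive free vertices in the same orientation allow a crossing with \<open>a\<close> and \<open>b\<close>.\<close>

lemma no_two_free_pairs: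
  assumes k: "isK (x # y # xs @ z # t # ys)" and F: "x \<notin> T" "y \<notin> T" "z \<notin> T" "t \<notin> T" and xz: "x \<in> A \<longleftrightarrow> z \<in> A"
    and ab: "a \<in> P'" "b \<in> Q'"
    and ra: "\<And>s. s \<in> FB \<Longrightarrow> R a s" and rb: "\<And>s. s \<in> FA \<Longrightarrow> R b s"
  shows False
proof -
  have k2: "isK (z # t # ys @ x # y # xs)"
    using isK_rotate[of "x # y # xs" "z # t # ys"] k by simp
  have adj: "R x y" "R z t"
    using isK_adj[OF k] isK_adj[OF k2] .
  have sK: "x \<in> set K" "y \<in> set K" "z \<in> set K" "t \<in> set K"
    using isK_set[OF k] by auto
  have out: "a \<notin> set K" "b \<notin> set K" "a \<noteq> b"
    using ab disj by blast+
  show False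
  proof (cases "x \<in> A")
    case True
    then have "y \<in> B" "t \<in> B" "z \<in> A"
      using adj xz side_cases by blast+
    then have "R b x" "R b z" "R a y" "R a t"
      using True F sK ra rb by blast+
    then show False
      using crossing[OF k out(2,1)] out by blast
  next
    case False
    then have "x \<in> B" "z \<in> B"
      using xz R_bip[OF adj(1)] R_bip[OF adj(2)] unfolding opposite_def by blast+
    moreover from this have "y \<in> A" "t \<in> A"
      using adj side_cases by blast+
    ultimately have "R a x" "R a z" "R b y" "R b t"
      using F sK ra rb by blast+
    then show False
      using crossing[OF k out(1,2)] out by blast
  qed
qed

text \<open>Here \<open>a\<close> and \<open>b\<close> are red to all free vertices but perhaps not to each other. By \<open>no_gap_two\<close> and \<open>T_adj\<close> any two
vertices of \<open>T\<close> are at distance at least three, so there are consecutive free vertices; put such a pair at positions 0 and 1. By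
\<open>no_two_free_pairs\<close> each of the pairs at 2, 4 and 6 meets \<open>T\<close>, which is impossible at distances of at least three.\<close>

lemma no_universal_pair:
  assumes c4: "5 \<le> c" and ab: "a \<in> P'" "b \<in> Q'"
    and ra: "\<And>s. s \<in> FB \<Longrightarrow> R a s" and rb: "\<And>s. s \<in> FA \<Longrightarrow> R b s"
  shows False
proof -
  have gap2: False if "isK (x # y # z # t # ys)" "x \<in> T" "z \<in> T" for x y z t ys
    by (rule no_gap_two[OF that ab]) (use ra rb in blast)+
  note free2 = no_two_free_pairs[OF _ _ _ _ _ _ ab ra rb]
  have "\<exists>x y ys. isK (x # y # ys) \<and> x \<notin> T \<and> y \<notin> T"
  proof (rule ccontr)
    assume n: "\<not> ?thesis"
    obtain p0 p1 p2 p3 p4 ys where k: "isK (p0 # p1 # p2 # p3 # p4 # ys)"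
      using window[of undefined] by blast
    note k1 = isK_drop[OF k, simplified]
    note k2 = isK_drop[OF k1, simplified]
    note k3 = isK_drop[OF k2, simplified]
    show False
    proof (cases "p0 \<in> T")
      case True
      then have "p1 \<notin> T"
        using T_adj[OF k] by blast
      then have "p2 \<in> T"
        using n k1 by blast
      then show False
        using gap2[OF k True] by blast
    next
      case False
      then have p1: "p1 \<in> T"
        using n k by blast
      then have "p2 \<notin> T"
        using T_adj[OF k1] by blast
      then have "p3 \<in> T"
        using n k2 by blast
      then show False
        using gap2[OF k1 p1] by blast
    qed
  qed
  then obtain p0 p1 xs where k0: "isK (p0 # p1 # xs)" and F: "p0 \<notin> T" "p1 \<notin> T"
    by blast
  have "8 \<le> length xs"
    using isK_length[OF k0] c4 by simp
  then obtain p2 p3 p4 p5 p6 p7 p8 ys where xs: "xs = p2 # p3 # p4 # p5 # p6 # p7 # p8 # ys"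
    by (auto simp: numeral_eq_Suc Suc_le_length_iff)
  note k = k0[unfolded xs]
  note k1 = isK_drop[OF k, simplified]
  note k2 = isK_drop[OF k1, simplified]
  note k3 = isK_drop[OF k2, simplified]
  note k4 = isK_drop[OF k3, simplified]
  note k5 = isK_drop[OF k4, simplified]
  have flip_side: "(x \<in> A) \<noteq> (y \<in> A)" if "R x y" for x y
    using R_bip[OF that] disj unfolding opposite_def by blast
  have side: "p0 \<in> A \<longleftrightarrow> p2 \<in> A" "p2 \<in> A \<longleftrightarrow> p4 \<in> A" "p4 \<in> A \<longleftrightarrow> p6 \<in> A"
    using flip_side[OF isK_adj[OF k]] flip_side[OF isK_adj[OF k1]] flip_side[OF isK_adj[OF k2]]
      flip_side[OF isK_adj[OF k3]] flip_side[OF isK_adj[OF k4]] flip_side[OF isK_adj[OF k5]] by blast+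
  have 1: "p2 \<in> T \<or> p3 \<in> T"
    using free2[of p0 p1 "[]" p2 p3 "p4 # p5 # p6 # p7 # p8 # ys"] k F side by auto
  have 2: "p4 \<in> T \<or> p5 \<in> T"
    using free2[of p0 p1 "[p2, p3]" p4 p5 "p6 # p7 # p8 # ys"] k F side by auto
  have 3: "p6 \<in> T \<or> p7 \<in> T"
    using free2[of p0 p1 "[p2, p3, p4, p5]" p6 p7 "p8 # ys"] k F side by auto
  show False
    using 1 2 3 T_adj[OF k3] T_adj[OF k5] gap2[OF k2] gap2[OF k3] gap2[OF k4] gap2[OF k5] by blast
qed

text \<open>All connecting blue edges contain the single vertex \<open>v\<close> of \<open>P'\<close>; hence \<open>U\<close> is red complete, and so are the free
vertices of \<open>A\<close> with \<open>GB\<close>. If \<open>v\<close> has at most one blue neighbour in \<open>GB\<close>, it can be inserted into \<open>K\<close> together with a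
vertex of \<open>Q'\<close>. If it has two, \<open>v\<close> enlarges the block of \<open>P\<close>, and the argument of \<open>full_side\<close> goes through with \<open>v\<close> and
the common foot as two extra vertices.\<close>

lemma missing_one_side:
  assumes rg: "\<tau> = M" "M \<le> c" and star: "star v" and v: "v \<in> P'" and p: "card P + 1 = M"
  shows False
proof -
  have vA: "v \<in> A" "v \<notin> U" "v \<notin> set K" "v \<notin> B"
    using v disj by auto
  have PQ: "R x y" if "x \<in> P" "y \<in> Q" for x y
    using starPQ[OF star that] that vA by blast
  have FAGB: "R x y" if "x \<in> FA" "y \<in> GB" for x y
    using starG[OF star, of x y] that vA by blast
  interpret f: component B A R K c M \<tau> U
    by (rule flip)
  \<comment> \<open>If \<open>Q'\<close> were empty, \<open>full_side\<close> would apply with the sides exchanged.\<close>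
  have "Q' \<noteq> {}"
  proof
    assume e: "Q' = {}"
    then have "card Q' = 0"
      by (metis card.empty)
    then have "card Q = M"
      using card_PQ(2) by linarith
    then show False
      using f.full_side[of v] star star_flip rg by (metis add_le_same_cancel1 le_refl not_numeral_le_zero)
  qed
  then obtain b0 where b0: "b0 \<in> Q'"
    by blast
  then have q: "1 \<le> card Q'" "card Q + 1 \<le> M"
    using finite_parts(4) card_PQ(2) by (metis One_nat_def Suc_leI card_gt_0_iff empty_iff, metis (no_types, lifting)
        One_nat_def Suc_leI add_le_cancel_left card_gt_0_iff empty_iff)
  consider (one) w where "\<And>z. z \<in> GB \<Longrightarrow> Bl v z \<Longrightarrow> z = w"
    | (two) y1 y2 where "y1 \<in> GB" "y2 \<in> GB" "y1 \<noteq> y2" "Bl v y1" "Bl v y2"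
    by blast
  then show False
  proof cases
    case one
    have red: "R v z" if "z \<in> GB" "z \<noteq> w" for z
      using one[of z] BlI[of v z] that vA unfolding opposite_def by blast
    have rb: "R b z" if "b \<in> Q'" "z \<in> FA" for b z
      using FAGB[of z b] R_sym[of z b] that by blast
    show False
    proof (cases "\<exists>b\<in>Q'. R v b")
      case True
      then obtain b where b: "b \<in> Q'" "R v b"
        by blast
      show False
        using no_insertion[OF v b, of w] red rb[OF b(1)] by blast
    next
      case False
      then have "b0 = w"
        using red[of b0] b0 by blast
      then have ra: "R v z" if "z \<in> FB" for z
        using red[of z] that b0 by blast
      have "5 \<le> c"
        using rg M5 by linarith
      then show False
        by (rule no_universal_pair[OF _ v b0 ra rb[OF b0]])
    qed
  next
    case two
    have vX: "v \<notin> P \<union> GB"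
      using vA by blast
    have "\<not> M \<le> card GB"
    proof
      assume "M \<le> card GB"
      then have "has_cyc Bl (2 * M)"
        using p M5 by (intro complete_plus_one[OF P_GB finite_parts(1,8) blocks_disjoint(1) vX two]) linarith+
      then show False
        using no_blue_M by simp
    qed
    then have fb: "card FB + 1 \<le> card Q"
      using card_G(2) card_PQ(2) by linarith
    have pairs: False
      if xy: "x \<in> set K \<inter> B" "y \<in> set K \<inter> B" "x \<noteq> y" "u \<in> U" "R x u" "w \<in> U" "R y w" "u \<noteq> w" for x y u w
    proof -
      have "card Q \<le> 2 * (card P - 2)"
        using p q M5 by linarith
      then have "2 * ((card Q + 1) div 2) \<le> card FB"
        using two_gaps[OF _ xy, of "(card Q + 1) div 2"] long_path[OF starPQ[OF star]] by blast
      moreover have "k \<le> 2 * ((k + 1) div 2)" for k :: nat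
        by presburger
      ultimately show False
        using fb by (metis Suc_eq_plus1 le_trans not_less_eq_eq order_refl)
    qed
    show False
    proof (rule feet_cases)
      fix z
      assume "T \<inter> B = {z}"
      then have "card FB + 1 = c"
        using card_T(2) by simp
      then show False
        using fb q rg by linarith
    next
      fix a
      assume a: "a \<in> P" "\<And>z u. z \<in> set K \<inter> B \<Longrightarrow> u \<in> U \<Longrightarrow> R z u \<Longrightarrow> u = a"
      have bl: "complete Bl (P - {a}) ((set K \<inter> B) \<union> Q')"
        by (rule common_foot_blue) (rule a(2))
      have dj: "(P - {a}) \<inter> ((set K \<inter> B) \<union> Q') = {}" "a \<notin> (P - {a}) \<union> ((set K \<inter> B) \<union> Q')"
        "v \<notin> (P - {a}) \<union> ((set K \<inter> B) \<union> Q')" "a \<noteq> v"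
        using disj a vA by auto
      have fn: "finite (P - {a})" "finite ((set K \<inter> B) \<union> Q')"
        using finite_parts finB by auto
      have ca: "card (P - {a}) + 1 = card P"
        using a finite_parts(1) PQ_ne(1) by simp
      have GBsub: "GB \<subseteq> (set K \<inter> B) \<union> Q'"
        by auto
      have aGB: "Bl a y" if "y \<in> GB" for y
        using P_GB a(1) that unfolding complete_def by blast
      \<comment> \<open>A third vertex of \<open>GB\<close> lets \<open>v\<close> and \<open>a\<close> join the block of \<open>P - {a}\<close>.\<close>
      have gb2: "card GB \<le> 2"
      proof (rule ccontr)
        assume "\<not> ?thesis"
        then have "1 \<le> card (GB - {y1, y2})"
          using card_Diff_subset[of "{y1, y2}" GB] two(1-3) by simp
        then obtain y3 where y3: "y3 \<in> GB" "y3 \<noteq> y1" "y3 \<noteq> y2"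
          using card_ge_1E by blast
        have "has_cyc Bl (2 * M)"
        proof (rule complete_plus_two[OF bl fn dj _ _ _ two(3) y3(2,3) two(4,5) aGB[OF two(1)] aGB[OF y3(1)]])
          show "y1 \<in> (set K \<inter> B) \<union> Q'" "y2 \<in> (set K \<inter> B) \<union> Q'" "y3 \<in> (set K \<inter> B) \<union> Q'"
            using two(1,2) y3(1) GBsub by blast+
        qed (use rg p ca card_KQ' M5 in linarith)+
        then show False
          using no_blue_M by simp
      qed
      then have "card FB \<le> 1"
        using card_G(2) q by linarith
      then obtain w where w: "\<And>z. z \<in> FB \<Longrightarrow> z = w"
        using card_ge_2E[of FB] card_le_Suc0_iff_eq[OF finite_parts(6)] by (metis One_nat_def)
      obtain p0 p1 p2 p3 ys where k: "isK (p0 # p1 # p2 # p3 # ys)" and nw: "w \<notin> {p0, p1, p2, p3}"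
        and ab: "p0 \<in> B" "p1 \<in> A" "p2 \<in> B" "p3 \<in> A"
        using windowB[of w] by blast
      have k2: "isK (p2 # p3 # ys @ [p0, p1])"
        using isK_rotate[of "[p0, p1]" "p2 # p3 # ys"] k by simp
      have sK: "p0 \<in> set K" "p2 \<in> set K"
        using isK_set[OF k] by auto
      then have t: "p0 \<in> T" "p2 \<in> T"
        using w nw ab by blast+
      have foot: "R a y" if y: "y \<in> T" "y \<in> B" for y
      proof -
        obtain u where "u \<in> U" "R y u"
          using y by (auto simp: T_def)
        then show ?thesis
          using a(2)[of y u] y T_sub R_sym[of y u] by blast
      qed
      have "p1 \<in> FA" "p3 \<in> FA"
        using FA_next[OF k t(1)] FA_next[OF k2 t(2)] ab by blast+
      then have rb: "R b0 p1" "R b0 p3"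
        using FAGB[of p1 b0] FAGB[of p3 b0] R_sym[of p1 b0] R_sym[of p3 b0] b0 by blast+
      have ra: "R a p0" "R a p2"
        using foot t ab by blast+
      show False
        using crossing[of p0 p1 "[]" p2 p3 ys a b0] k ra rb a(1) b0 U_sub by auto
    qed (use pairs in blast)
  qed
qed

lemma star_side:
  assumes star: "star v" and P': "P' \<subseteq> {v}"
  shows False
proof -
  have "card P' \<le> 1"
    using P' card_mono[of "{v}" P'] by simp
  then have p: "card P = M \<or> card P + 1 = M \<and> 1 \<le> card P'"
    using card_PQ(1) by linarith
  have vP': "v \<in> P'" if "card P + 1 = M"
  proof -
    have "1 \<le> card P'"
      using that card_PQ(1) by linarith
    then show ?thesis
      using card_ge_1E[of P'] P' by blast
  qed
  show False
    using regime
  proof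
    assume rg: "\<tau> = M \<and> M \<le> c"
    show False
      using p full_side[OF star] missing_one_side[OF _ _ star] vP' rg by fastforce
  next
    assume rg: "M = \<tau> + 1 \<and> M = c + 2"
    have "card Q + 2 \<le> M"
    proof (cases "card P = M")
      case True
      then show ?thesis
        using critical_Q_bound[OF _ _ starPQ[OF star]] rg by blast
    next
      case False
      then have p1: "card P + 1 = M"
        using p by blast
      then have "v \<in> P'"
        by (rule vP')
      then have "v \<notin> P" "v \<notin> Q"
        by blast+
      then have "complete R P Q"
        by (intro complete_red) (use starPQ[OF star] in blast)
      then have "\<not> c + 1 \<le> card Q"
        using no_red_complete[of P Q] p1 rg by auto
      then show ?thesis
        using rg by linarith
    qed
    moreover have "\<tau> \<le> card P"
      using p rg by linarith
    ultimately show False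
      using full_side[OF star] by blast
  qed
qed

lemma star_false: "\<not> star v"
proof
  assume star: "star v"
  interpret f: component B A R K c M \<tau> U
    by (rule flip)
  show False
    using star_dichotomy[OF star] star_side[OF star] f.star_side[of v] star star_flip by metis
qed

section \<open>The component cannot exist\<close>

text \<open>Otherwise two disjoint connecting blue edges would give a blue cycle of length \<open>2 \<tau>\<close>, whichever blocks they join;
so these edges would form a star, contrary to \<open>star_false\<close>.\<close>

lemma few_outside:
  assumes u: "M + 1 \<le> card U"
  shows "card GA + card GB \<le> \<tau>"
proof (rule ccontr)
  assume "\<not> ?thesis"
  then have g: "\<tau> + 1 \<le> card GA + card GB"
    by linarith
  define E where "E x y \<longleftrightarrow> (x \<in> P \<and> y \<in> Q \<or> x \<in> GA \<and> y \<in> GB) \<and> Bl x y" for x y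
  have t: "3 \<le> \<tau>" "2 \<le> \<tau>" "\<tau> \<le> M" "\<tau> + 1 \<le> card U" "\<tau> \<le> card U" "\<tau> \<le> card U + 1"
    "\<tau> \<le> card GA + card GB" "\<tau> \<le> card GA + card GB + 1"
    using regime M5 u g by linarith+
  have "\<exists>v. \<forall>x y. E x y \<longrightarrow> x = v \<or> y = v"
  proof (rule star_of_no_two_disjoint)
    fix x y x' y'
    assume e: "E x y" "E x' y'"
    show "x = x' \<or> y = y'"
    proof (rule ccontr)
      assume "\<not> ?thesis"
      then have ne: "x \<noteq> x'" "y \<noteq> y'"
        by blast+
      note e' = e[unfolded E_def]
      note b = e'[THEN conjunct2]
      from e'[THEN conjunct1] have "has_cyc Bl (2 * \<tau>)"
      proof (elim disjE conjE)
        assume "x \<in> P" "y \<in> Q" "x' \<in> P" "y' \<in> Q"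
        then show ?thesis
          by (intro two_PQ_edges[OF _ _ ne(1) _ _ ne(2) b t(1,3) G_ge_1 t(4,8)])
      next
        assume "x \<in> GA" "y \<in> GB" "x' \<in> GA" "y' \<in> GB"
        then show ?thesis
          by (intro two_GG_edges[OF _ _ ne(1) _ _ ne(2) b t(1,3) g t(6)])
      next
        assume "x \<in> P" "y \<in> Q" "x' \<in> GA" "y' \<in> GB"
        then show ?thesis
          by (intro PQ_and_GG_edges[OF _ _ _ _ b t(2,3,5,7)])
      next
        assume "x \<in> GA" "y \<in> GB" "x' \<in> P" "y' \<in> Q"
        then show ?thesis
          by (intro PQ_and_GG_edges[OF _ _ _ _ b(2,1) t(2,3,5,7)])
      qed
      then show False
        using no_blue_\<tau> by simp
    qed
  qed
  then obtain v where v: "x = v \<or> y = v" if "E x y" for x y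
    by blast
  have AB: "x \<in> A \<and> y \<in> B" if "x \<in> P \<and> y \<in> Q \<or> x \<in> GA \<and> y \<in> GB" for x y
    using that by auto
  have EI: "E x y" if pq: "x \<in> P \<and> y \<in> Q \<or> x \<in> GA \<and> y \<in> GB" and "\<not> R x y" for x y
    unfolding E_def using pq BlI[OF _ that(2)] AB[OF pq] by (simp add: opposite_def)
  have "star v"
    unfolding star_def
  proof (intro conjI ballI impI; rule ccontr)
    show False if "x \<in> P" "y \<in> Q" "x \<noteq> v" "y \<noteq> v" "\<not> R x y" for x y
      using v[OF EI[OF disjI1[OF conjI[OF that(1,2)]] that(5)]] that(3,4) by blast
    show False if "x \<in> GA" "y \<in> GB" "x \<noteq> v" "y \<noteq> v" "\<not> R x y" for x y
      using v[OF EI[OF disjI2[OF conjI[OF that(1,2)]] that(5)]] that(3,4) by blast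
  qed
  then show False
    using star_false by blast
qed

text \<open>Edges inside \<open>U\<close> alone suffice for the star needed in \<open>critical_Q_bound\<close>.\<close>

lemma critical_side:
  assumes rg: "M = c + 2" and p: "card P = M" and u: "M + M \<le> card U + 1"
  shows False
proof -
  have \<tau>: "\<tau> + 1 = M"
    using regime rg by linarith
  have "\<exists>v. \<forall>x y. x \<in> P \<and> y \<in> Q \<and> Bl x y \<longrightarrow> x = v \<or> y = v"
  proof (rule star_of_no_two_disjoint)
    show "x = x' \<or> y = y'" if "x \<in> P \<and> y \<in> Q \<and> Bl x y" "x' \<in> P \<and> y' \<in> Q \<and> Bl x' y'" for x y x' y'
    proof (rule ccontr)
      assume "\<not> ?thesis"
      then have "has_cyc Bl (2 * \<tau>)"
        using that G_ge_1 by (intro two_PQ_edges[of x x' y y' \<tau>]) (use \<tau> rg F_half card_G M5 u in linarith)+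
      then show False
        using no_blue_\<tau> by simp
    qed
  qed
  then obtain v where v: "x = v \<or> y = v" if "x \<in> P" "y \<in> Q" "Bl x y" for x y
    by blast
  have "R x y" if "x \<in> P" "y \<in> Q" "x \<noteq> v" "y \<noteq> v" for x y
    using v[of x y] that BlI[of x y] unfolding opposite_def by blast
  then have "card Q + 2 \<le> M"
    using critical_Q_bound[OF rg p, of v] by blast
  then show False
    using card_PQ p u by linarith
qed

text \<open>If \<open>M \<le> c\<close>, the bound of \<open>few_outside\<close> forces all sizes to be equal and exactly half of \<open>K\<close> to be free, hence one
whole side of \<open>K\<close>, which completes a blue block. If \<open>M = c + 2\<close>, it forces \<open>P\<close> or \<open>Q\<close> to have \<open>M\<close> vertices and the
other at least \<open>M - 1\<close>.\<close>

lemma component_false: False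
proof -
  have "M + 1 \<le> card U"
    using small_component U_card by linarith
  then have few: "card FA + card P' + (card FB + card Q') \<le> \<tau>"
    using few_outside card_G by simp
  show False
    using regime
  proof
    assume rg: "\<tau> = M \<and> M \<le> c"
    then have "card FA + card FB = c" "card P = M" "card Q = M" "M = c"
      using few F_half card_PQ by linarith+
    moreover from this have "T \<inter> A = {} \<or> T \<inter> B = {}"
      using T_one_side by blast
    then have "card FA = c \<or> card FB = c"
      using card_T by (metis add_0 card.empty)
    ultimately show False
      using no_blue_complete[OF Q_GA blocks_disjoint(2) finite_parts(2,7)] no_blue_complete[OF P_GB blocks_disjoint(1) finite_parts(1,8)] card_G rg by force
  next
    assume rg: "M = \<tau> + 1 \<and> M = c + 2"
    interpret f: component B A R K c M \<tau> U
      by (rule flip)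
    have u: "M + M \<le> card U + 1" and pq: "card P = M \<or> card Q = M"
      using few F_half card_PQ rg by linarith+
    then show False
      using critical_side f.critical_side rg by blast
  qed
qed

end

context longest
begin

text \<open>If all red components outside \<open>K\<close> have fewer than \<open>M\<close> vertices, two red adjacent vertices have fewer than \<open>M\<close> red
neighbours together, and the blue graph outside \<open>K\<close> satisfies the condition of \<open>moon_moser\<close>.\<close>

lemma large_component:
  defines "E \<equiv> \<lambda>u v. R u v \<and> u \<notin> set K \<and> v \<notin> set K"
  shows "\<exists>u \<in> A \<union> B - set K. M \<le> card {w. E\<^sup>*\<^sup>* u w}"
proof (rule ccontr)
  let ?U = "\<lambda>u. {w. E\<^sup>*\<^sup>* u w}"
  assume n: "\<not> ?thesis"
  define F where "F u v \<longleftrightarrow> Bl u v \<and> u \<notin> set K \<and> v \<notin> set K" for u v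
  have AB: "v \<in> A \<union> B - set K" if "E\<^sup>*\<^sup>* u v" "u \<in> A \<union> B - set K" for u v
    using that
  proof (induction rule: rtranclp_induct)
    case (step y z)
    then show ?case
      using R_bip[of y z] unfolding E_def opposite_def by blast
  qed blast
  have "\<exists>xs. cyc F xs \<and> length xs = 2 * M \<and> set xs \<subseteq> (A - set K) \<union> (B - set K)"
  proof (rule moon_moser)
    show "finite (A - set K)" "finite (B - set K)" "card (A - set K) = M" "card (B - set K) = M"
      "(A - set K) \<inter> (B - set K) = {}" "2 \<le> M"
      using finA finB out_A out_B disj M5 by auto
    show "symp F"
      unfolding F_def symp_def using Bl_sym by blast
    show "u \<in> A - set K \<and> v \<in> B - set K \<or> u \<in> B - set K \<and> v \<in> A - set K" if "F u v" for u v
      using that unfolding F_def other_def opposite_def by blast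
    fix x y
    assume xy: "x \<in> A - set K" "y \<in> B - set K" "\<not> F x y"
    then have r: "R x y"
      unfolding F_def other_def opposite_def by blast
    let ?X = "{v \<in> A - set K. R y v}" and ?Y = "{v \<in> B - set K. R x v}"
    have "E x y"
      using r xy by (auto simp: E_def)
    then have sub: "?X \<union> ?Y \<subseteq> ?U x"
      using xy by (auto simp: E_def intro: rtranclp.intros)
    have "?U x \<subseteq> A \<union> B"
      using AB xy by blast
    then have finU: "finite (?U x)"
      using finA finB finite_subset by blast
    have "card ?X + card ?Y = card (?X \<union> ?Y)"
      by (rule card_Un_disjoint[symmetric]) (use finA finB disj in auto)
    also have "\<dots> \<le> card (?U x)"
      by (rule card_mono[OF finU sub])
    also have "\<dots> < M"
      using n xy(1) by (meson DiffI Diff_iff UnI1 not_le)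
    finally have lt: "card ?X + card ?Y < M" .
    have "{v \<in> B - set K. F x v} = (B - set K) - ?Y" "{v \<in> A - set K. F y v} = (A - set K) - ?X"
      using xy disj by (auto simp: F_def other_def opposite_def)
    moreover have "card ((B - set K) - ?Y) = card (B - set K) - card ?Y" "card ((A - set K) - ?X) = card (A - set K) - card ?X"
      by (rule card_Diff_subset; use finA finB in auto)+
    ultimately have eq: "card {v \<in> B - set K. F x v} = M - card ?Y" "card {v \<in> A - set K. F y v} = M - card ?X"
      by (simp_all only: out_A out_B)
    have "p = M - r \<Longrightarrow> q = M - s \<Longrightarrow> s + r < M \<Longrightarrow> M < p + q" for p q r s :: nat
      by linarith
    from this[OF eq lt] show "M < card {v \<in> B - set K. F x v} + card {v \<in> A - set K. F y v}" .
  qed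
  then obtain xs where "cyc F xs" "length xs = 2 * M"
    by blast
  then have "has_cyc Bl (2 * M)"
    using cyc_mono[of F xs Bl] by (auto simp: F_def intro: has_cycI)
  then show False
    using no_blue_M by simp
qed

theorem longest_false: False
proof -
  define E where "E u v \<longleftrightarrow> R u v \<and> u \<notin> set K \<and> v \<notin> set K" for u v
  \<comment> \<open>The component of \<open>u0\<close> in the red graph outside \<open>K\<close>.\<close>
  obtain u0 where u0: "u0 \<in> A \<union> B - set K" "M \<le> card {w. E\<^sup>*\<^sup>* u0 w}"
    using large_component unfolding E_def by blast
  have symE: "E\<^sup>*\<^sup>* v u" if "E\<^sup>*\<^sup>* u v" for u v
  proof -
    have "symp E"
      unfolding symp_def E_def using R_sym by blast
    then show ?thesis
      using that symp_rtranclp sympD by metis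
  qed
  interpret component A B R K c M \<tau> "{w. E\<^sup>*\<^sup>* u0 w}"
  proof
    show "{w. E\<^sup>*\<^sup>* u0 w} \<subseteq> A \<union> B - set K"
    proof
      fix w
      assume "w \<in> {w. E\<^sup>*\<^sup>* u0 w}"
      then have "E\<^sup>*\<^sup>* u0 w"
        by simp
      then show "w \<in> A \<union> B - set K"
      proof (induction rule: rtranclp_induct)
        case (step y z)
        then show ?case
          using R_bip[of y z] unfolding E_def opposite_def by blast
      qed (rule u0)
    qed
    then have sub: "w \<in> A \<union> B - set K" if "E\<^sup>*\<^sup>* u0 w" for w
      using that by blast
    show "v \<in> {w. E\<^sup>*\<^sup>* u0 w}" if "u \<in> {w. E\<^sup>*\<^sup>* u0 w}" "R u v" "v \<notin> set K" for u v
    proof -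
      have "E u v"
        unfolding E_def using that sub[of u] by blast
      then show ?thesis
        using that(1) rtranclp.rtrancl_into_rtrancl[of E u0 u v] by simp
    qed
    show "\<exists>ws. path R ws \<and> hd ws = u \<and> last ws = w \<and> set ws \<subseteq> {w. E\<^sup>*\<^sup>* u0 w}"
      if "u \<in> {w. E\<^sup>*\<^sup>* u0 w}" "w \<in> {w. E\<^sup>*\<^sup>* u0 w}" for u w
    proof -
      have "E\<^sup>*\<^sup>* u w"
        using symE[of u0 u] rtranclp_trans[of E u u0 w] that by simp
      from reachable_path[OF this]
      obtain ws where ws: "path E ws" "hd ws = u" "last ws = w" "\<forall>v\<in>set ws. E\<^sup>*\<^sup>* u v"
        by (elim exE conjE) (rule that)
      have "path R ws"
        by (rule path_mono[OF ws(1)]) (simp add: E_def)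
      moreover have "set ws \<subseteq> {w. E\<^sup>*\<^sup>* u0 w}"
        using ws(4) that(1) rtranclp_trans[of E u0 u] by blast
      ultimately show ?thesis
        using ws(2,3) by (intro exI[of _ ws] conjI)
    qed
  qed (rule u0)
  show False
    by (rule component_false)
qed

end

text \<open>The host may be larger than needed: it is cut down to \<open>c + M\<close> vertices on each side that contain \<open>K\<close>.\<close>

lemma core:
  assumes bic: "bicol A B R" and K: "cyc R K" "length K = 2 * c" and longest: "\<And>xs. cyc R xs \<Longrightarrow> length xs \<le> 2 * c"
    and card: "c + M \<le> card A" "c + M \<le> card B" and "3 \<le> c" "5 \<le> M"
    and no: "\<not> has_cyc (other A B R) (2 * \<tau>)" "\<not> has_cyc (other A B R) (2 * M)"
    and "\<tau> = M \<and> M \<le> c \<or> M = \<tau> + 1 \<and> M = c + 2"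
  shows False
proof -
  interpret b: bicol A B R
    by (rule bic)
  note counts = b.cyc_counts[OF K]
  obtain A' where A': "set K \<inter> A \<subseteq> A'" "A' \<subseteq> A" "card A' = c + M"
    using superset_of_card[of "set K \<inter> A" A "c + M"] counts b.finA card by auto
  obtain B' where B': "set K \<inter> B \<subseteq> B'" "B' \<subseteq> B" "card B' = c + M"
    using superset_of_card[of "set K \<inter> B" B "c + M"] counts b.finB card by auto
  let ?R = "restr A' B' R"
  interpret r: bicol A' B' ?R
    by (rule bicol_restr[OF bic A'(2) B'(2)])
  have sub: "set K \<subseteq> A' \<union> B'"
    using counts(1) A' B' by blast
  have cK: "cyc ?R K"
  proof (rule cyc_mono[OF K(1)])
    show "?R x y" if "x \<in> set K" "y \<in> set K" "R x y" for x y
      using that sub b.R_bip[of x y] A'(2) B'(2) b.disj unfolding restr_def opposite_def by blast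
  qed
  interpret longest A' B' ?R K c M \<tau>
  proof
    show "length xs \<le> 2 * c" if "cyc ?R xs" for xs
      using longest cyc_mono[OF that, of R] unfolding restr_def by blast
    show "\<not> has_cyc (other A' B' ?R) (2 * \<tau>)" "\<not> has_cyc (other A' B' ?R) (2 * M)"
      using no has_cyc_other_restr[OF _ A'(2) B'(2)] by blast+
  qed (use assms cK A' B' in auto)
  show False
    by (rule longest_false)
qed

section \<open>Long monochromatic cycles\<close>

context bicol
begin

text \<open>All red neighbours of the first vertex of a longest path lie on it. Among its first five vertices only two are on
the other side, so some neighbour comes later.\<close>

lemma min_degree_3_cycle:
  assumes "x0 \<in> A \<union> B" and deg: "\<And>x. x \<in> A \<union> B \<Longrightarrow> 3 \<le> card {y. R x y}"
  shows "\<exists>xs. cyc R xs \<and> 6 \<le> length xs"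
proof -
  have "\<exists>ws. (path R ws \<and> set ws \<subseteq> A \<union> B) \<and> (\<forall>xs. path R xs \<and> set xs \<subseteq> A \<union> B \<longrightarrow> length xs \<le> length ws)"
  proof (rule ex_has_greatest_nat[where k = "[x0]"])
    show "path R [x0] \<and> set [x0] \<subseteq> A \<union> B"
      using assms(1) by simp
    show "\<forall>xs. path R xs \<and> set xs \<subseteq> A \<union> B \<longrightarrow> length xs < card (A \<union> B) + 1"
      using length_bound by (auto simp: path_def less_Suc_eq_le)
  qed
  then obtain ws where ws: "path R ws" "set ws \<subseteq> A \<union> B" and max: "\<And>xs. path R xs \<Longrightarrow> set xs \<subseteq> A \<union> B \<Longrightarrow> length xs \<le> length ws"
    by blast
  obtain x zs where xs: "ws = x # zs"
    using ws(1) by (cases ws) (auto simp: path_def)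
  have N: "{y. R x y} \<subseteq> set ws"
  proof
    fix y
    assume "y \<in> {y. R x y}"
    then have y: "R y x" "y \<in> A \<union> B"
      using R_sym[of x y] R_bip[of x y] by (auto simp: opposite_def)
    show "y \<in> set ws"
    proof (rule ccontr)
      assume "y \<notin> set ws"
      then have "path R (y # ws)"
        using path_Cons[OF ws(1)] y xs by simp
      then show False
        using max[of "y # ws"] ws(2) y by simp
    qed
  qed
  have five: "card ({y. R x y} \<inter> set (take 5 ws)) \<le> 2"
  proof -
    have p: "path R (take 5 ws)" "hd (take 5 ws) = x"
      using path_prefix[of R "take 5 ws" "drop 5 ws"] ws(1) xs by auto
    have div: "length (take 5 ws) div 2 \<le> 2"
      by simp
    show ?thesis
    proof (cases "x \<in> A")
      case True
      have "{y. R x y} \<inter> set (take 5 ws) \<subseteq> set (take 5 ws) \<inter> B"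
        using side_cases True by blast
      then have "card ({y. R x y} \<inter> set (take 5 ws)) \<le> card (set (take 5 ws) \<inter> B)"
        by (rule card_mono[rotated]) simp
      moreover have "card (set (take 5 ws) \<inter> B) = length (take 5 ws) div 2"
        using path_counts(1)[OF p(1)] p(2) True by blast
      ultimately show ?thesis
        using div by linarith
    next
      case False
      then have xB: "x \<in> B"
        using ws(2) xs by auto
      have "{y. R x y} \<inter> set (take 5 ws) \<subseteq> set (take 5 ws) \<inter> A"
        using side_cases xB by blast
      then have "card ({y. R x y} \<inter> set (take 5 ws)) \<le> card (set (take 5 ws) \<inter> A)"
        by (rule card_mono[rotated]) simp
      moreover have "card (set (take 5 ws) \<inter> A) = length (take 5 ws) div 2"
        using path_counts(2)[OF p(1)] p(2) xB by blast
      ultimately show ?thesis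
        using div by linarith
    qed
  qed
  have "\<not> {y. R x y} \<subseteq> set (take 5 ws)"
  proof
    assume "{y. R x y} \<subseteq> set (take 5 ws)"
    then have "{y. R x y} \<inter> set (take 5 ws) = {y. R x y}"
      by blast
    then show False
      using five deg[of x] ws(2) xs by auto
  qed
  then obtain y where y: "R x y" "y \<in> set ws" "y \<notin> set (take 5 ws)"
    using N by blast
  then obtain us vs where uv: "ws = (us @ [y]) @ vs"
    using split_list by fastforce
  have "5 \<le> length us"
  proof (rule ccontr)
    assume "\<not> ?thesis"
    then have "y \<in> set (take 5 ws)"
      unfolding uv by (auto simp: take_Cons' not_le)
    then show False
      using y by simp
  qed
  moreover have "path R (us @ [y])"
    using path_prefix ws(1) uv by blast
  moreover have "hd (us @ [y]) = x"
    using xs uv by (cases us) auto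
  ultimately have "cyc R (us @ [y])"
    using R_sym[OF y(1)] by (intro cyc_closeI) auto
  then show ?thesis
    using \<open>5 \<le> length us\<close> by (intro exI[of _ "us @ [y]"]) auto
qed

end

text \<open>Removing a vertex of degree at most two preserves the edge bound; what is left has minimum degree three.\<close>

lemma many_edges_cycle:
  assumes "bicol A B R" "2 * (card A + card B) < card {(x, y). x \<in> A \<and> y \<in> B \<and> R x y}"
  shows "\<exists>xs. cyc R xs \<and> 6 \<le> length xs"
  using assms
proof (induction "card A + card B" arbitrary: A B R rule: less_induct)
  case less
  let ?E = "\<lambda>A B R. {(x, y). x \<in> A \<and> y \<in> B \<and> R x y}"
  have delete: "\<exists>xs. cyc R xs \<and> 6 \<le> length xs"
    if bic: "bicol A B R" and e: "2 * (card A + card B) < card (?E A B R)" and x: "x \<in> A" "card {y. R x y} \<le> 2"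
      and IH: "\<And>R'. bicol (A - {x}) B R' \<Longrightarrow> 2 * (card (A - {x}) + card B) < card (?E (A - {x}) B R') \<Longrightarrow>
        \<exists>xs. cyc R' xs \<and> 6 \<le> length xs"
    for A B R x
  proof -
    interpret bicol A B R
      by (rule bic)
    let ?R = "restr (A - {x}) B R"
    have fe: "finite (?E A B R)"
      by (rule finite_subset[of _ "A \<times> B"]) (use finA finB in auto)
    have fx: "finite ({x} \<times> {y. R x y})"
    proof -
      have "{y. R x y} \<subseteq> A \<union> B"
        using R_bip unfolding opposite_def by blast
      then show ?thesis
        using finA finB by (simp add: finite_subset)
    qed
    have "?E A B R \<subseteq> ?E (A - {x}) B ?R \<union> {x} \<times> {y. R x y}"
      by (auto simp: restr_def opposite_def)
    moreover have "finite (?E (A - {x}) B ?R)"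
      by (rule finite_subset[of _ "A \<times> B"]) (use finA finB in auto)
    ultimately have "card (?E A B R) \<le> card (?E (A - {x}) B ?R \<union> {x} \<times> {y. R x y})"
      using fx by (intro card_mono) auto
    also have "\<dots> \<le> card (?E (A - {x}) B ?R) + card ({x} \<times> {y. R x y})"
      by (rule card_Un_le)
    finally have e1: "card (?E A B R) \<le> card (?E (A - {x}) B ?R) + 2"
      using x(2) by (simp add: card_cartesian_product)
    have e2: "card (A - {x}) + 1 = card A"
      using x(1) finA by (metis Suc_eq_plus1 card_Suc_Diff1)
    have "p \<le> q + 2 \<Longrightarrow> r + 1 = s \<Longrightarrow> 2 * (s + t) < p \<Longrightarrow> 2 * (r + t) < q" for p q r s t :: nat
      by presburger
    from this[OF e1 e2 e] have "2 * (card (A - {x}) + card B) < card (?E (A - {x}) B ?R)" .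
    then obtain xs where "cyc ?R xs" "6 \<le> length xs"
      using IH[of ?R] bicol_restr[OF bic, of "A - {x}" B] by blast
    then show ?thesis
      using cyc_mono[of ?R xs R] unfolding restr_def by blast
  qed
  interpret bicol A B R
    by (rule less.prems)
  have swap: "card (?E B A R) = card (?E A B R)"
    by (rule bij_betw_same_card[of prod.swap]) (auto simp: bij_betw_def inj_on_def image_iff dest: R_sym)
  consider (lowA) x where "x \<in> A" "card {y. R x y} \<le> 2" | (lowB) x where "x \<in> B" "card {y. R x y} \<le> 2"
    | (high) "\<And>x. x \<in> A \<union> B \<Longrightarrow> 3 \<le> card {y. R x y}"
    by fastforce
  then show ?case
  proof cases
    case lowA
    have "card (A - {x}) < card A"
      using card_Diff1_less[OF finA lowA(1)] .
    then show ?thesis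
      by (intro delete[of A B R x] less.hyps) (use lowA less.prems in auto)
  next
    case lowB
    have "card (B - {x}) < card B"
      using card_Diff1_less[OF finB lowB(1)] .
    then show ?thesis
      by (intro delete[of B A R x] less.hyps)
        (use lowB swap less.prems bicol_flip[OF less.prems(1)] in auto)
  next
    case high
    have "?E A B R \<noteq> {}"
      using less.prems(2) by (metis card.empty not_less_zero)
    then obtain x0 where "x0 \<in> A \<union> B"
      by blast
    then show ?thesis
      using min_degree_3_cycle high by blast
  qed
qed

text \<open>Among the 100 edges of \<open>K\<^bsub>10,10\<^esub>\<close> one colour has at least 50, and \<open>50 > 2 (10 + 10)\<close>.\<close>

lemma mono_six_cycle:
  assumes "bicol A B R" "10 \<le> card A" "10 \<le> card B"
  shows "\<exists>xs. (cyc R xs \<or> cyc (other A B R) xs) \<and> 6 \<le> length xs"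
proof -
  interpret b: bicol A B R
    by (rule assms)
  obtain A' where A': "A' \<subseteq> A" "card A' = 10"
    using obtain_subset_with_card_n[OF assms(2)] by blast
  obtain B' where B': "B' \<subseteq> B" "card B' = 10"
    using obtain_subset_with_card_n[OF assms(3)] by blast
  let ?R = "restr A' B' R" and ?E = "\<lambda>R. {(x, y). x \<in> A' \<and> y \<in> B' \<and> R x y}"
  have bic: "bicol A' B' ?R"
    by (rule bicol_restr[OF assms(1) A'(1) B'(1)])
  have fin: "finite A'" "finite B'"
    using A' B' b.finA b.finB finite_subset by blast+
  have "A' \<times> B' = ?E ?R \<union> ?E (other A' B' ?R)"
    by (auto simp: restr_def other_def opposite_def)
  then have "100 = card (?E ?R \<union> ?E (other A' B' ?R))"
    using A' B' card_cartesian_product[of A' B'] by simp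
  also have "\<dots> \<le> card (?E ?R) + card (?E (other A' B' ?R))"
    by (rule card_Un_le)
  finally have "40 < card (?E ?R) \<or> 40 < card (?E (other A' B' ?R))"
    by linarith
  then have "(\<exists>xs. cyc ?R xs \<and> 6 \<le> length xs) \<or> (\<exists>xs. cyc (other A' B' ?R) xs \<and> 6 \<le> length xs)"
    using many_edges_cycle[OF bic] many_edges_cycle[OF bicol_other[OF bic]] A' B' by auto
  moreover have "R u v" if "?R u v" for u v
    using that by (simp add: restr_def)
  moreover have "other A B R u v" if "other A' B' ?R u v" for u v
    using that A'(1) B'(1) unfolding other_def restr_def opposite_def by blast
  ultimately show ?thesis
    using cyc_mono[of ?R _ R] cyc_mono[of "other A' B' ?R" _ "other A B R"] by metis
qed

text \<open>A longest monochromatic cycle of length \<open>2 c < 2 m\<close> leaves at least \<open>c + 2\<close> vertices on each side, and no longer cycle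
exists in the other colour either: this is the regime \<open>M = c + 2\<close> of \<open>core\<close>.\<close>

lemma long_mono_cycle:
  assumes "bicol A B R" "5 \<le> m" "2 * m \<le> card A" "2 * m \<le> card B"
  shows "\<exists>xs. (cyc R xs \<or> cyc (other A B R) xs) \<and> 2 * m \<le> length xs"
proof (rule ccontr)
  assume n: "\<not> ?thesis"
  have one: False
    if bic: "bicol A B R" and xs: "cyc R xs" "6 \<le> length xs" and le: "\<And>ys. cyc (other A B R) ys \<Longrightarrow> \<exists>zs. cyc R zs \<and> length ys \<le> length zs"
      and nn: "\<And>ys. cyc R ys \<Longrightarrow> length ys < 2 * m" for R xs
  proof -
    interpret bicol A B R
      by (rule bic)
    obtain K c where K: "cyc R K" "length K = 2 * c" "\<And>ys. cyc R ys \<Longrightarrow> length ys \<le> 2 * c"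
      using longest_cycle[OF xs(1)] by blast
    have c: "3 \<le> c" "c + 1 \<le> m"
      using K(3)[OF xs(1)] xs(2) nn[OF K(1)] K(2) by linarith+
    have no: "\<not> has_cyc (other A B R) (2 * (c + i))" if "1 \<le> i" for i
    proof
      assume "has_cyc (other A B R) (2 * (c + i))"
      then obtain ys where ys: "cyc (other A B R) ys" "length ys = 2 * (c + i)"
        by (auto simp: has_cyc_def)
      obtain zs where zs: "cyc R zs" "length ys \<le> length zs"
        using le[OF ys(1)] by blast
      then show False
        using K(3)[OF zs(1)] zs(2) ys(2) that by simp
    qed
    show False
      by (rule core[OF bic K, of "c + 2" "c + 1"]) (use c assms no[of 1] no[of 2] in auto)
  qed
  interpret b: bicol A B R
    by (rule assms)
  have bic': "bicol A B (other A B R)" and oo: "other A B (other A B R) = R"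
    using bicol_other other_other assms(1) by blast+
  interpret b': bicol A B "other A B R"
    by (rule bic')
  obtain xs where xs: "cyc R xs \<or> cyc (other A B R) xs" "6 \<le> length xs"
    using mono_six_cycle[OF assms(1)] assms by fastforce
  define S where "S = {k. \<exists>ys. (cyc R ys \<or> cyc (other A B R) ys) \<and> length ys = k}"
  have fin: "finite S"
  proof (rule finite_subset)
    show "S \<subseteq> {..<2 * m}"
      using n unfolding S_def by (auto simp: not_le)
  qed simp
  have "S \<noteq> {}"
    using xs unfolding S_def by blast
  then have "Max S \<in> S"
    using fin by simp
  then obtain K where K: "cyc R K \<or> cyc (other A B R) K" "length K = Max S"
    unfolding S_def by auto
  have max: "length ys \<le> length K" if "cyc R ys \<or> cyc (other A B R) ys" for ys
  proof -
    have "length ys \<in> S"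
      using that unfolding S_def by blast
    then show ?thesis
      using Max_ge[OF fin] K(2) by simp
  qed
  have K6: "6 \<le> length K"
    using max[OF xs(1)] xs(2) by simp
  have lt: "length ys < 2 * m" if "cyc R ys \<or> cyc (other A B R) ys" for ys
    using n that by (auto simp: not_le)
  from K(1) show False
  proof
    assume "cyc R K"
    then show False
      using one[OF assms(1) _ K6] max lt by blast
  next
    assume "cyc (other A B R) K"
    then show False
      using one[OF bic' _ K6] max lt unfolding oo by blast
  qed
qed

text \<open>If some red cycle has length at least \<open>2 m\<close>, the longest one satisfies \<open>c \<ge> m\<close> and \<open>core\<close> applies with \<open>M = m\<close>. If
not, the long monochromatic cycle of \<open>long_mono_cycle\<close> is blue and longer than \<open>2 m\<close>; exchanging the colours,
\<open>skipped_length\<close> produces a red cycle of length \<open>2 m\<close> after all.\<close>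

lemma long_cycle_or_short_blue:
  assumes bic: "bicol A B R" and mn: "5 \<le> m" "m < n" and card: "n + m - 1 \<le> card A" "n + m - 1 \<le> card B"
    and no: "\<not> has_cyc (other A B R) (2 * m)"
  shows "\<exists>xs. cyc R xs \<and> 2 * n \<le> length xs"
proof (rule ccontr)
  assume n: "\<not> ?thesis"
  interpret b: bicol A B R
    by (rule bic)
  show False
  proof (cases "\<exists>xs. cyc R xs \<and> 2 * m \<le> length xs")
    case True
    then obtain xs where xs: "cyc R xs" "2 * m \<le> length xs"
      by blast
    obtain K c where K: "cyc R K" "length K = 2 * c" "\<And>ys. cyc R ys \<Longrightarrow> length ys \<le> 2 * c"
      using b.longest_cycle[OF xs(1)] by blast
    have "m \<le> c" "c + 1 \<le> n"
      using K xs n by (force, metis K(1,2) Suc_eq_plus1 mult_le_mono2 not_less_eq_eq)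
    then show False
      by (intro core[OF bic K, of m m]) (use mn card no in auto)
  next
    case False
    have "2 * m \<le> card A" "2 * m \<le> card B"
      using mn card by linarith+
    then obtain xs where "cyc (other A B R) xs" "2 * m \<le> length xs"
      using long_mono_cycle[OF bic mn(1)] False by blast
    then have "has_cyc (other A B (other A B R)) (2 * m)"
      using skipped_length[OF bicol_other[OF bic] _ _ no mn(1)] by blast
    then have "has_cyc R (2 * m)"
      using other_other[OF bic] by simp
    then show False
      using False by (auto simp: has_cyc_def)
  qed
qed

theorem mono_cycle_distinct:
  assumes "bicol A B R" "5 \<le> m" "m < n" "n + m - 1 \<le> card A" "n + m - 1 \<le> card B"
  shows "has_cyc R (2 * n) \<or> has_cyc (other A B R) (2 * m)"
  using long_cycle_or_short_blue[OF assms] skipped_length[OF assms(1) _ _ _ assms(2), of _ n] assms(3)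
  by fastforce

text \<open>On \<open>2 n\<close> vertices per side \<open>long_cycle_or_short_blue\<close> is available with \<open>n + 1\<close> in place of \<open>n\<close>.\<close>

theorem mono_cycle_equal:
  assumes "bicol A B R" "5 \<le> n" "2 * n \<le> card A" "2 * n \<le> card B"
  shows "has_cyc R (2 * n) \<or> has_cyc (other A B R) (2 * n)"
proof (rule ccontr)
  assume no: "\<not> ?thesis"
  then obtain xs where xs: "cyc R xs" "2 * (n + 1) \<le> length xs"
    using long_cycle_or_short_blue[of A B R n "n + 1"] assms by auto
  then show False
    using skipped_length[OF assms(1) xs(1), of n n] no assms by auto
qed

section \<open>Copies of cycles in coloured complete bipartite graphs\<close>

lemma cyc_iff_nth:
  "cyc E xs \<longleftrightarrow> 3 \<le> length xs \<and> distinct xs \<and> (\<forall>i<length xs. E (xs ! i) (xs ! ((i + 1) mod length xs)))"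
proof (cases "3 \<le> length xs")
  case True
  then have ne: "xs \<noteq> []"
    by auto
  have "successively E xs \<and> E (last xs) (hd xs) \<longleftrightarrow> (\<forall>i<length xs. E (xs ! i) (xs ! ((i + 1) mod length xs)))"
    (is "?l \<longleftrightarrow> ?r")
  proof
    assume l: ?l
    show ?r
    proof (intro allI impI)
      fix i
      assume "i < length xs"
      then consider "Suc i < length xs" | "i = length xs - 1"
        by linarith
      then show "E (xs ! i) (xs ! ((i + 1) mod length xs))"
        using l ne by cases (auto simp: successively_conv_nth last_conv_nth hd_conv_nth)
    qed
  next
    assume r: ?r
    have "E (xs ! i) (xs ! Suc i)" if "Suc i < length xs" for i
      using r[rule_format, of i] that by simp
    moreover have "E (last xs) (hd xs)"
      using r[rule_format, of "length xs - 1"] ne by (simp add: last_conv_nth hd_conv_nth)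
    ultimately show ?l
      by (simp add: successively_conv_nth)
  qed
  then show ?thesis
    unfolding cyc_def by blast
qed (simp add: cyc_def)

lemma contains_cycle_iff:
  assumes edges: "\<And>u v. {u, v} \<in> edges G \<longleftrightarrow> E u v" and verts: "\<And>u v. E u v \<Longrightarrow> u \<in> verts G" and k: "3 \<le> k"
  shows "contains_copy G (cycle_graph k) \<longleftrightarrow> has_cyc E k"
proof
  assume "contains_copy G (cycle_graph k)"
  then obtain f where f: "inj_on f {..<k}" and "\<forall>e\<in>edges (cycle_graph k). f ` e \<in> edges G"
    unfolding contains_copy_def by (auto simp: cycle_graph_def)
  moreover have "{i, (i + 1) mod k} \<in> edges (cycle_graph k)" if "i < k" for i
    using that by (auto simp: cycle_graph_def)
  ultimately have fe: "f ` {i, (i + 1) mod k} \<in> edges G" if "i < k" for i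
    using that by blast
  have "cyc E (map f [0..<k])"
    unfolding cyc_iff_nth using f fe k edges by (auto simp: distinct_map atLeast_upt lessThan_atLeast0)
  then show "has_cyc E k"
    by (rule has_cycI) simp
next
  assume "has_cyc E k"
  then obtain xs where xs: "length xs = k" "distinct xs" "\<And>i. i < k \<Longrightarrow> E (xs ! i) (xs ! ((i + 1) mod k))"
    unfolding has_cyc_def cyc_iff_nth by auto
  have "inj_on (\<lambda>i. xs ! i) {..<k}"
    using xs by (auto simp: inj_on_def nth_eq_iff_index_eq)
  moreover have "(\<lambda>i. xs ! i) ` {..<k} \<subseteq> verts G"
    using xs(3) verts by blast
  ultimately show "contains_copy G (cycle_graph k)"
    unfolding contains_copy_def cycle_graph_def using xs(3) edges by (intro exI[of _ "\<lambda>i. xs ! i"]) auto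
qed

abbreviation "left_side N \<equiv> (Inl ` {..<N} :: (nat + nat) set)"
abbreviation "right_side N \<equiv> (Inr ` {..<N} :: (nat + nat) set)"

lemma complete_bipartite_edge_iff:
  "{u, v} \<in> edges (complete_bipartite N) \<longleftrightarrow> opposite (left_side N) (right_side N) u v"
  by (auto simp: complete_bipartite_def opposite_def doubleton_eq_iff)

text \<open>A colouring is determined by its first colour class, an arbitrary symmetric relation between the two sides.\<close>

lemma br_arrows_cycles_iff:
  assumes n: "2 \<le> n" and m: "2 \<le> m"
  shows "br_arrows N (cycle_graph (2 * n)) (cycle_graph (2 * m)) \<longleftrightarrow>
    (\<forall>R. bicol (left_side N) (right_side N) R \<longrightarrow>
      has_cyc R (2 * n) \<or> has_cyc (other (left_side N) (right_side N) R) (2 * m))"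
    (is "?l \<longleftrightarrow> ?r")
proof -
  let ?A = "left_side N" and ?B = "right_side N" and ?G = "complete_bipartite N"
  have copy: "contains_copy (color_class ?G c i) (cycle_graph k) \<longleftrightarrow> has_cyc (\<lambda>u v. opposite ?A ?B u v \<and> c {u, v} = i) k"
    if "3 \<le> k" for c i k
  proof (rule contains_cycle_iff)
    show "{u, v} \<in> edges (color_class ?G c i) \<longleftrightarrow> opposite ?A ?B u v \<and> c {u, v} = i" for u v
      unfolding color_class_def using complete_bipartite_edge_iff[of u v N] by simp
    show "u \<in> verts (color_class ?G c i)" if "opposite ?A ?B u v \<and> c {u, v} = i" for u v
      using that by (auto simp: color_class_def complete_bipartite_def opposite_def)
  qed (rule that)
  have nm: "3 \<le> 2 * n" "3 \<le> 2 * m"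
    using n m by auto
  show ?thesis
  proof
    assume l: ?l
    show ?r
    proof (intro allI impI)
      fix R
      assume "bicol ?A ?B R"
      then interpret bicol ?A ?B R .
      define c where "c e = (if \<exists>u v. e = {u, v} \<and> R u v then 1 else 2 :: nat)" for e
      have c1: "c {u, v} = 1 \<longleftrightarrow> R u v" for u v
        unfolding c_def using R_sym[of v u] by (auto simp: doubleton_eq_iff)
      have c2: "c {u, v} = 2 \<longleftrightarrow> \<not> R u v" for u v
        using c1[of u v] unfolding c_def by (simp split: if_splits)
      have "two_coloring ?G c"
        unfolding two_coloring_def c_def by simp
      then have "contains_copy (color_class ?G c 1) (cycle_graph (2 * n)) \<or> contains_copy (color_class ?G c 2) (cycle_graph (2 * m))"
        using l unfolding br_arrows_def by blast
      moreover have "(\<lambda>u v. opposite ?A ?B u v \<and> c {u, v} = 1) = R"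
        using R_bip c1 by (auto simp: fun_eq_iff)
      moreover have "(\<lambda>u v. opposite ?A ?B u v \<and> c {u, v} = 2) = Bl"
        using c2 by (auto simp: fun_eq_iff other_def)
      ultimately show "has_cyc R (2 * n) \<or> has_cyc Bl (2 * m)"
        unfolding copy[OF nm(1)] copy[OF nm(2)] by simp
    qed
  next
    assume r: ?r
    show ?l
      unfolding br_arrows_def
    proof (intro allI impI)
      fix c
      assume c: "two_coloring ?G c"
      let ?R = "\<lambda>u v. opposite ?A ?B u v \<and> c {u, v} = 1"
      have "bicol ?A ?B ?R"
        by unfold_locales (auto simp: opposite_def insert_commute)
      then have "has_cyc ?R (2 * n) \<or> has_cyc (other ?A ?B ?R) (2 * m)"
        using r by blast
      moreover have "c {u, v} = 1 \<or> c {u, v} = 2" if "opposite ?A ?B u v" for u v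
        using c that complete_bipartite_edge_iff[of u v N] unfolding two_coloring_def by blast
      then have "other ?A ?B ?R = (\<lambda>u v. opposite ?A ?B u v \<and> c {u, v} = 2)"
        by (force simp: other_def fun_eq_iff)
      ultimately show "contains_copy (color_class ?G c 1) (cycle_graph (2 * n)) \<or> contains_copy (color_class ?G c 2) (cycle_graph (2 * m))"
        unfolding copy[OF nm(1)] copy[OF nm(2)] by simp
    qed
  qed
qed

section \<open>Colourings without the two cycles\<close>

lemma cyc_neighbour: "cyc E xs \<Longrightarrow> x \<in> set xs \<Longrightarrow> \<exists>y. E x y"
  unfolding cyc_iff_nth by (auto simp: in_set_conv_nth)

text \<open>The red edges are those at the first \<open>n - 1\<close> vertices of one side. A red cycle of length \<open>2 n\<close> would need \<open>n\<close> of
them, a blue one of length \<open>2 m\<close> would need \<open>m\<close> of the others.\<close>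

lemma not_arrows_small:
  assumes "2 \<le> n" "2 \<le> m" "N + 2 \<le> n + m"
  shows "\<not> br_arrows N (cycle_graph (2 * n)) (cycle_graph (2 * m))"
proof -
  let ?A = "left_side N" and ?B = "right_side N" and ?S = "Inl ` {..<n - 1} :: (nat + nat) set"
  define R where "R u v \<longleftrightarrow> opposite ?A ?B u v \<and> (u \<in> ?S \<or> v \<in> ?S)" for u v
  interpret bicol ?A ?B R
    by unfold_locales (auto simp: R_def opposite_def)
  have "\<not> has_cyc R (2 * n)"
  proof
    assume "has_cyc R (2 * n)"
    then obtain xs where xs: "cyc R xs" "length xs = 2 * n"
      by (auto simp: has_cyc_def)
    have "set xs \<inter> ?A \<subseteq> ?S"
    proof
      fix u
      assume u: "u \<in> set xs \<inter> ?A"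
      then obtain v where "R u v"
        using cyc_neighbour xs(1) by fast
      then show "u \<in> ?S"
        using u by (auto simp: R_def opposite_def)
    qed
    then have "card (set xs \<inter> ?A) \<le> card ?S"
      by (rule card_mono[rotated]) simp
    then show False
      using cyc_counts(2)[OF xs] assms by (simp add: card_image)
  qed
  moreover have "\<not> has_cyc Bl (2 * m)"
  proof
    interpret o: bicol ?A ?B Bl
      by (rule bicol_other[OF bicol_axioms])
    assume "has_cyc Bl (2 * m)"
    then obtain xs where xs: "cyc Bl xs" "length xs = 2 * m"
      by (auto simp: has_cyc_def)
    have "set xs \<inter> ?A \<subseteq> Inl ` {n - 1..<N}"
    proof
      fix u
      assume u: "u \<in> set xs \<inter> ?A"
      then obtain v where "Bl u v"
        using cyc_neighbour xs(1) by fast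
      then have "u \<notin> ?S"
        using u by (auto simp: R_def other_def)
      moreover obtain i where "u = Inl i" "i < N"
        using u by auto
      ultimately show "u \<in> Inl ` {n - 1..<N}"
        by (cases "i < n - 1") auto
    qed
    then have "card (set xs \<inter> ?A) \<le> card (Inl ` {n - 1..<N} :: (nat + nat) set)"
      by (rule card_mono[rotated]) simp
    then show False
      using o.cyc_counts(2)[OF xs] assms by (simp add: card_image)
  qed
  ultimately show ?thesis
    unfolding br_arrows_cycles_iff[OF assms(1,2)] using bicol_axioms by blast
qed

lemma successively_eq_constant: "successively (\<lambda>x y. h x = h y) xs \<Longrightarrow> z \<in> set xs \<Longrightarrow> h z = h (hd xs)"
  by (induction xs rule: induct_list012) auto

text \<open>A cycle minus one vertex is still connected, so a labelling that is constant along edges avoiding \<open>x\<close> is constant on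
it.\<close>

lemma cyc_one_class:
  assumes c: "cyc E xs" and h: "\<And>u v. E u v \<Longrightarrow> u \<noteq> x \<Longrightarrow> v \<noteq> x \<Longrightarrow> h u = h v"
  shows "\<exists>p. \<forall>z\<in>set xs. z \<noteq> x \<longrightarrow> h z = p"
proof -
  have "\<exists>ys. set xs \<subseteq> insert x (set ys) \<and> x \<notin> set ys \<and> successively E ys"
  proof (cases "x \<in> set xs")
    case True
    then obtain us vs where uv: "xs = us @ x # vs"
      using split_list by metis
    then have "cyc E (x # vs @ us)"
      using cyc_swap[of E us "x # vs"] c by simp
    then have "successively E (vs @ us)" "x \<notin> set (vs @ us)"
      by (auto simp: cyc_def successively_Cons)
    then show ?thesis
      using uv by (intro exI[of _ "vs @ us"]) auto
  next
    case False
    then show ?thesis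
      using c by (intro exI[of _ xs]) (auto simp: cyc_def)
  qed
  then obtain ys where ys: "set xs \<subseteq> insert x (set ys)" "x \<notin> set ys" "successively E ys"
    by blast
  have s: "successively (\<lambda>u v. h u = h v) ys"
    by (rule successively_mono[OF ys(3)]) (use h ys(2) in metis)
  show ?thesis
  proof (intro exI ballI impI)
    fix z
    assume "z \<in> set xs" "z \<noteq> x"
    then have "z \<in> set ys"
      using ys(1) by blast
    then show "h z = h (hd ys)"
      by (rule successively_eq_constant[OF s])
  qed
qed

text \<open>Cut each side into two blocks of \<open>k = n - 1\<close> vertices and one last vertex, so that \<open>i div k\<close> is 0, 1 or 2. Red are
the edges between blocks of equal number and all edges at the last vertex of the left side. A red cycle minus
that vertex therefore stays in blocks of one number, and a blue cycle minus the last vertex of the right side stays in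
opposite blocks; either has too few vertices on the side from which nothing was removed.\<close>

lemma not_arrows_equal:
  assumes "2 \<le> n"
  shows "\<not> br_arrows (2 * n - 1) (cycle_graph (2 * n)) (cycle_graph (2 * n))"
proof -
  define k where "k = n - 1"
  let ?N = "2 * n - 1"
  let ?A = "left_side ?N" and ?B = "right_side ?N"
  have k: "1 \<le> k" "n = k + 1"
    using assms by (auto simp: k_def)
  define S where "S i j \<longleftrightarrow> i div k = j div k \<or> i div k = 2" for i j
  define R where "R u v \<longleftrightarrow> opposite ?A ?B u v \<and> (\<exists>i j. S i j \<and> {u, v} = {Inl i, Inr j})" for u v
  interpret bicol ?A ?B R
    by unfold_locales (auto simp: R_def opposite_def insert_commute)
  interpret o: bicol ?A ?B Bl
    by (rule bicol_other[OF bicol_axioms])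
  have small: "i div k \<le> 2" and two: "i div k = 2 \<longleftrightarrow> i = 2 * k" if "i < ?N" for i
  proof -
    have "i \<le> 2 * k"
      using that k by linarith
    then have "i div k \<le> 2 * k div k"
      by (rule div_le_mono)
    then show "i div k \<le> 2"
      using k by simp
    show "i div k = 2 \<longleftrightarrow> i = 2 * k"
    proof
      assume "i div k = 2"
      then have "2 * k \<le> i"
        using div_times_less_eq_dividend[of i k] by simp
      then show "i = 2 * k"
        using \<open>i \<le> 2 * k\<close> by simp
    qed (use k in simp)
  qed
  have small_class: "card {z \<in> f ` {..<?N}. \<exists>i. z = f i \<and> i div k = p} \<le> k" for f :: "nat \<Rightarrow> nat + nat" and p
  proof -
    have "{z \<in> f ` {..<?N}. \<exists>i. z = f i \<and> i div k = p} \<subseteq> f ` {p * k..<p * k + k}"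
    proof
      fix z
      assume "z \<in> {z \<in> f ` {..<?N}. \<exists>i. z = f i \<and> i div k = p}"
      then obtain i where "z = f i" "i div k = p"
        by blast
      then show "z \<in> f ` {p * k..<p * k + k}"
        using div_times_less_eq_dividend[of i k] dividend_less_div_times[of k i] k by auto
    qed
    then have "card {z \<in> f ` {..<?N}. \<exists>i. z = f i \<and> i div k = p} \<le> card (f ` {p * k..<p * k + k})"
      by (rule card_mono[rotated]) simp
    also have "\<dots> \<le> k"
      using card_image_le[of "{p * k..<p * k + k}" f] by simp
    finally show ?thesis .
  qed
  have "\<not> has_cyc R (2 * n)"
  proof
    assume "has_cyc R (2 * n)"
    then obtain xs where xs: "cyc R xs" "length xs = 2 * n"
      by (auto simp: has_cyc_def)
    let ?h = "case_sum (\<lambda>i. i div k) (\<lambda>j. j div k)"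
    have "\<exists>p. \<forall>z\<in>set xs. z \<noteq> Inl (2 * k) \<longrightarrow> ?h z = p"
    proof (rule cyc_one_class[OF xs(1)])
      fix u v
      assume "R u v" and ne: "u \<noteq> Inl (2 * k)" "v \<noteq> Inl (2 * k)"
      then obtain i j where ij: "S i j" "{u, v} = {Inl i, Inr j}" "i < ?N"
        by (auto simp: R_def opposite_def doubleton_eq_iff)
      then show "?h u = ?h v"
        using ne two[OF ij(3)] by (auto simp: doubleton_eq_iff S_def)
    qed
    then obtain p where p: "\<And>z. z \<in> set xs \<Longrightarrow> z \<noteq> Inl (2 * k) \<Longrightarrow> ?h z = p"
      by blast
    have "set xs \<inter> ?B \<subseteq> {z \<in> ?B. \<exists>j. z = Inr j \<and> j div k = p}"
      using p by fastforce
    then have "card (set xs \<inter> ?B) \<le> card {z \<in> ?B. \<exists>j. z = Inr j \<and> j div k = p}"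
      by (rule card_mono[rotated]) simp
    then show False
      using cyc_counts(3)[OF xs] small_class[of Inr p] k by linarith
  qed
  moreover have "\<not> has_cyc Bl (2 * n)"
  proof
    assume "has_cyc Bl (2 * n)"
    then obtain xs where xs: "cyc Bl xs" "length xs = 2 * n"
      by (auto simp: has_cyc_def)
    let ?h = "case_sum (\<lambda>i. i div k) (\<lambda>j. 1 - j div k)"
    have "\<exists>p. \<forall>z\<in>set xs. z \<noteq> Inr (2 * k) \<longrightarrow> ?h z = p"
    proof (rule cyc_one_class[OF xs(1)])
      fix u v
      assume b: "Bl u v" and ne: "u \<noteq> Inr (2 * k)" "v \<noteq> Inr (2 * k)"
      then obtain i j where ij: "{u, v} = {Inl i, Inr j}" "i < ?N" "j < ?N"
        by (auto simp: other_def opposite_def doubleton_eq_iff)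
      then have "\<not> S i j"
        using b by (auto simp: other_def R_def)
      moreover have "j \<noteq> 2 * k"
        using ij(1) ne by (auto simp: doubleton_eq_iff)
      ultimately have "i div k = 1 - j div k"
        using small[OF ij(2)] small[OF ij(3)] two[OF ij(3)] unfolding S_def by linarith
      then show "?h u = ?h v"
        using ij(1) by (auto simp: doubleton_eq_iff)
    qed
    then obtain p where p: "\<And>z. z \<in> set xs \<Longrightarrow> z \<noteq> Inr (2 * k) \<Longrightarrow> ?h z = p"
      by blast
    have "set xs \<inter> ?A \<subseteq> {z \<in> ?A. \<exists>i. z = Inl i \<and> i div k = p}"
      using p by fastforce
    then have "card (set xs \<inter> ?A) \<le> card {z \<in> ?A. \<exists>i. z = Inl i \<and> i div k = p}"
      by (rule card_mono[rotated]) simp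
    then show False
      using o.cyc_counts(2)[OF xs] small_class[of Inl p] k by linarith
  qed
  ultimately show ?thesis
    unfolding br_arrows_cycles_iff[OF assms assms] using bicol_axioms by blast
qed

section \<open>The bipartite Ramsey numbers\<close>

lemma arrows_distinct:
  assumes "5 \<le> n" "5 \<le> m" "n \<noteq> m"
  shows "br_arrows (n + m - 1) (cycle_graph (2 * n)) (cycle_graph (2 * m))"
proof -
  let ?N = "n + m - 1"
  let ?A = "left_side ?N" and ?B = "right_side ?N"
  have card: "card ?A = ?N" "card ?B = ?N"
    by (simp_all add: card_image)
  have "has_cyc R (2 * n) \<or> has_cyc (other ?A ?B R) (2 * m)" if bic: "bicol ?A ?B R" for R
  proof (cases "m < n")
    case True
    then show ?thesis
      using mono_cycle_distinct[OF bic assms(2)] card by simp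
  next
    case False
    then have "n < m"
      using assms by simp
    then show ?thesis
      using mono_cycle_distinct[OF bicol_other[OF bic] assms(1)] card unfolding other_other[OF bic] by fastforce
  qed
  then show ?thesis
    using br_arrows_cycles_iff[of n m] assms by simp
qed

lemma arrows_equal:
  assumes "5 \<le> n"
  shows "br_arrows (2 * n) (cycle_graph (2 * n)) (cycle_graph (2 * n))"
proof -
  let ?A = "left_side (2 * n)" and ?B = "right_side (2 * n)"
  have card: "card ?A = 2 * n" "card ?B = 2 * n"
    by (simp_all add: card_image)
  then have "has_cyc R (2 * n) \<or> has_cyc (other ?A ?B R) (2 * n)" if "bicol ?A ?B R" for R
    using mono_cycle_equal[OF that assms] by simp
  then show ?thesis
    using br_arrows_cycles_iff[of n n] assms by simp
qed

theorem theorem1p3: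
  fixes n m :: nat
  assumes "n \<ge> 5" and "m \<ge> 5"
  shows "(n \<noteq> m \<longrightarrow> br (cycle_graph (2 * n)) (cycle_graph (2 * m)) = n + m - 1)
       \<and> (n = m \<longrightarrow> br (cycle_graph (2 * n)) (cycle_graph (2 * m)) = m + n)"
proof (intro conjI impI)
  assume "n \<noteq> m"
  then have arr: "br_arrows (n + m - 1) (cycle_graph (2 * n)) (cycle_graph (2 * m))"
    using arrows_distinct assms by blast
  show "br (cycle_graph (2 * n)) (cycle_graph (2 * m)) = n + m - 1"
    unfolding br_def
  proof (rule Least_equality, rule arr)
    fix N
    assume N: "br_arrows N (cycle_graph (2 * n)) (cycle_graph (2 * m))"
    then have "\<not> N + 2 \<le> n + m"
      using not_arrows_small[of n m N] assms by auto
    then show "n + m - 1 \<le> N"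
      by linarith
  qed
next
  assume e: "n = m"
  have arr: "br_arrows (m + n) (cycle_graph (2 * n)) (cycle_graph (2 * m))"
    using arrows_equal[OF assms(1)] e by (simp add: mult_2)
  show "br (cycle_graph (2 * n)) (cycle_graph (2 * m)) = m + n"
    unfolding br_def
  proof (rule Least_equality, rule arr)
    fix N
    assume N: "br_arrows N (cycle_graph (2 * n)) (cycle_graph (2 * m))"
    then have "\<not> N + 2 \<le> n + m" "N \<noteq> 2 * n - 1"
      using not_arrows_small[of n m N] not_arrows_equal[of n] assms e by auto
    then show "m + n \<le> N"
      using e by linarith
  qed
qed

end
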